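(* Let $K$ be a nonarchimedean local field with residue field of cardinality $q$, and let $N\geq 2$ be an integer. For a complex tuple $\boldsymbol{s}=(s_{ij})_{1\leq i<j\leq N}$, the integral $$\mathcal{Z}_N(\mathbb{P}^1(K),\boldsymbol{s})=\int_{(\mathbb{P}^1(K))^N}\prod_{1\leq i<j\leq N}\delta([x_{i,0}:x_{i,1}],[x_{j,0}:x_{j,1}])^{s_{ij}}\,d\nu^N$$ converges absolutely if and only if $\boldsymbol{s}\in\Omega_N$, and in this case it can be written as the finite sum $$\mathcal{Z}_N(\mathbb{P}^1(K),\boldsymbol{s})=\frac{1}{(q+1)^{N-1}}\sum_{\Phi\in\mathcal{R}_N}\frac{q^{N+\sum_{i<j}s_{ij}}+1-\deg_{\Phi}([N])}{q+1-\deg_{\Phi}([N])}\prod_{\lambda\in\mathcal{B}(\Phi)}\frac{(q-1)_{\deg_{\Phi}(\lambda)-1}}{q^{e_\lambda(\boldsymbol{s})}-1}.$$ The summand for each $\Phi\in\mathcal{R}_N$ is defined for all prime powers $q$, as the denominator $q+1-\deg_\Phi([N])$ is cancelled by the factor $(q-1)_{\deg_\Phi([N])-1}$ inside the product over $\lambda\in\mathcal{B}(\Phi)$ (note $[N]\in\mathcal{B}(\Phi)$); the summand is understood with this cancellation carried out.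
   Context: Field. $K$ is a nonarchimedean local field with canonical absolute value $|\cdot|$, closed unit ball (ring of integers) $R=\{x\in K:|x|\leq 1\}$, open unit ball (maximal ideal) $P=\{x\in K:|x|<1\}$, $q=\#(R/P)$, and $|\cdot|$ is normalized so that $|\pi|=q^{-1}$ for any generator $\pi$ of $P$. Projective line. $\mathbb{P}^1(K)$ is the set of classes $[x_0:x_1]$ of nonzero vectors $(x_0,x_1)\in K^2$ modulo scaling by $K^\times$, with the quotient topology. The spherical metric is $$\delta([x_0:x_1],[y_0:y_1])=\frac{|x_0y_1-x_1y_0|}{\max\{|x_0|,|x_1|\}\cdot\max\{|y_0|,|y_1|\}}.$$ The group $PGL_2(R)$ (the quotient of $GL_2(R)$ by its center $R^\times$) acts on $\mathbb{P}^1(K)$: the class of $\left(\begin{smallmatrix}a&b\\c&d\end{smallmatrix}\right)\in GL_2(R)$ sends $[x_0:x_1]$ to $[ax_0+bx_1:cx_0+dx_1]$. $\nu$ is the unique $PGL_2(R)$-invariant Borel probability measure on $\mathbb{P}^1(K)$ and $\nu^N$ is the product measure on $(\mathbb{P}^1(K))^N$ (tuples with two equal entries form a null set). Splitting chains. Write $[N]=\{1,\dots,N\}$. For partitions of $[N]$, $\phi>\psi$ means that $\psi$ is a refinement of $\phi$ and $\psi\neq\phi$. A splitting chain of order $N\geq 2$ and length $L\geq 1$ is a tuple $\Phi=(\phi_0,\dots,\phi_L)$ of partitions of $[N]$ with $$\{[N]\}=\phi_0>\phi_1>\dots>\phi_L=\{\{1\},\dots,\{N\}\}.$$ Its set of branches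 $\mathcal{B}(\Phi)=(\phi_0\cup\dots\cup\phi_{L-1})\setminus\phi_L$ is the set of all non-singleton parts occurring in the partitions. For $\lambda\in\mathcal{B}(\Phi)$, the depth is $\ell_\Phi(\lambda)=\max\{\ell:\lambda\in\phi_\ell\}$ and the degree is $\deg_\Phi(\lambda)=\#\{\lambda'\in\phi_{\ell_\Phi(\lambda)+1}:\lambda'\subset\lambda\}\geq 2$. $\Phi$ is reduced if each $\lambda\in\mathcal{B}(\Phi)$ satisfies $\lambda\in\phi_\ell\iff\ell=\ell_\Phi(\lambda)$. $\mathcal{R}_N$ is the set of reduced splitting chains of order $N$ (of any length). Exponents and domain. For $\lambda\subset[N]$, $$e_\lambda(\boldsymbol{s})=\#\lambda-1+\sum_{\substack{i<j\\ i,j\in\lambda}}s_{ij},\qquad \Omega_N=\bigcap_{\substack{\lambda\subset[N]\\ \#\lambda>1}}\{\boldsymbol{s}\in\mathbb{C}^{N(N-1)/2}:\operatorname{Re}(e_\lambda(\boldsymbol{s}))>0\}.$$ For $n\ge 0$, $(q-1)_n$ is the falling factorial $(z)_n=z(z-1)\cdots(z-n+1)$ evaluated at $z=q-1$. *)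

theory Defs
  imports "HOL-Analysis.Analysis" "HOL-Probability.Probability" "HOL-Number_Theory.Prime_Powers"
begin

section \<open>Nonarchimedean local fields\<close>

definition nonarch_abs :: "('k::field \<Rightarrow> real) \<Rightarrow> bool" where
  "nonarch_abs v \<longleftrightarrow>
     (\<forall>x. 0 \<le> v x) \<and> (\<forall>x. v x = 0 \<longleftrightarrow> x = 0) \<and>
     (\<forall>x y. v (x * y) = v x * v y) \<and> (\<forall>x y. v (x + y) \<le> max (v x) (v y))"

definition int_ring :: "('k::field \<Rightarrow> real) \<Rightarrow> 'k set" where
  "int_ring v = {x. v x \<le> 1}"

definition max_ideal :: "('k::field \<Rightarrow> real) \<Rightarrow> 'k set" where
  "max_ideal v = {x. v x < 1}"

definition residue_classes :: "('k::field \<Rightarrow> real) \<Rightarrow> 'k set set" where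
  "residue_classes v =
     int_ring v // {(x, y). x \<in> int_ring v \<and> y \<in> int_ring v \<and> x - y \<in> max_ideal v}"

definition residue_card :: "('k::field \<Rightarrow> real) \<Rightarrow> nat" where
  "residue_card v = card (residue_classes v)"

definition field_topology :: "('k::field \<Rightarrow> real) \<Rightarrow> 'k topology" where
  "field_topology v = Metric_space.mtopology UNIV (\<lambda>x y. v (x - y))"

text \<open>A local field is a field with a nontrivial absolute value whose topology is locally compact;
  finiteness of the residue field and principality of the maximal ideal are consequences.
  The last clause is the normalization singling out the canonical absolute value.\<close>

definition nonarch_local_field :: "('k::field \<Rightarrow> real) \<Rightarrow> bool" where
  "nonarch_local_field v \<longleftrightarrow>
     nonarch_abs v \<and> (\<exists>x. x \<noteq> 0 \<and> v x \<noteq> 1) \<and>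
     locally_compact_space (field_topology v) \<and>
     (\<forall>p. max_ideal v = {p * r | r. r \<in> int_ring v} \<longrightarrow> v p = 1 / real (residue_card v))"


section \<open>The projective line\<close>

definition proj_class :: "'k::field \<times> 'k \<Rightarrow> ('k \<times> 'k) set" where
  "proj_class x = {(c * fst x, c * snd x) | c. c \<noteq> 0}"

definition proj_line :: "('k::field \<times> 'k) set set" where
  "proj_line = proj_class ` (UNIV - {(0, 0)})"

definition punctured_plane :: "('k::field \<Rightarrow> real) \<Rightarrow> ('k \<times> 'k) topology" where
  "punctured_plane v =
     subtopology (prod_topology (field_topology v) (field_topology v)) (UNIV - {(0, 0)})"

definition proj_topology :: "('k::field \<Rightarrow> real) \<Rightarrow> ('k \<times> 'k) set topology" where
  "proj_topology v = topology (\<lambda>U. U \<subseteq> proj_line \<and>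
     openin (punctured_plane v) {x \<in> UNIV - {(0, 0)}. proj_class x \<in> U})"

definition proj_borel :: "('k::field \<Rightarrow> real) \<Rightarrow> ('k \<times> 'k) set measure" where
  "proj_borel v = sigma proj_line {U. openin (proj_topology v) U}"

definition vec_delta :: "('k::field \<Rightarrow> real) \<Rightarrow> 'k \<times> 'k \<Rightarrow> 'k \<times> 'k \<Rightarrow> real" where
  "vec_delta v x y = v (fst x * snd y - snd x * fst y) /
     (max (v (fst x)) (v (snd x)) * max (v (fst y)) (v (snd y)))"

text \<open>The spherical metric is evaluated on chosen representatives; lemma
  \<open>proj_delta_class\<close> below shows that the choice is immaterial.\<close>

definition proj_delta :: "('k::field \<Rightarrow> real) \<Rightarrow> ('k \<times> 'k) set \<Rightarrow> ('k \<times> 'k) set \<Rightarrow> real" where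
  "proj_delta v X Y = vec_delta v (SOME x. x \<in> X) (SOME y. y \<in> Y)"

text \<open>The quadruple \<open>(a, b, c, d)\<close> stands for the matrix with rows \<open>(a, b)\<close> and \<open>(c, d)\<close>.\<close>

definition GL2_int :: "('k::field \<Rightarrow> real) \<Rightarrow> ('k \<times> 'k \<times> 'k \<times> 'k) set" where
  "GL2_int v = {(a, b, c, d). a \<in> int_ring v \<and> b \<in> int_ring v \<and> c \<in> int_ring v \<and> d \<in> int_ring v \<and>
     (\<exists>u \<in> int_ring v. (a * d - b * c) * u = 1)}"

text \<open>The image of a line under a linear map. For invertible matrices this maps \<open>proj_class x\<close> to the
  class of the image of \<open>x\<close>, and it depends on the matrix only up to a nonzero scalar, so that
  invariance under \<open>PGL\<^sub>2(R)\<close> and under \<open>GL\<^sub>2(R)\<close> are the same condition.\<close>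

definition proj_act :: "'k::field \<times> 'k \<times> 'k \<times> 'k \<Rightarrow> ('k \<times> 'k) set \<Rightarrow> ('k \<times> 'k) set" where
  "proj_act g X = (case g of (a, b, c, d) \<Rightarrow>
     (\<lambda>x. (a * fst x + b * snd x, c * fst x + d * snd x)) ` X)"

definition invariant_prob :: "('k::field \<Rightarrow> real) \<Rightarrow> ('k \<times> 'k) set measure \<Rightarrow> bool" where
  "invariant_prob v \<nu> \<longleftrightarrow> prob_space \<nu> \<and> sets \<nu> = sets (proj_borel v) \<and>
     (\<forall>g \<in> GL2_int v. distr \<nu> (proj_borel v) (proj_act g) = \<nu>)"


section \<open>Splitting chains\<close>

text \<open>A chain \<open>(\<phi>\<^sub>0, \<dots>, \<phi>\<^sub>L)\<close> is a list of length \<open>L + 1\<close>. The library's \<open>refines A P Q\<close>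
  says that \<open>P\<close> and \<open>Q\<close> are partitions of \<open>A\<close> and \<open>P\<close> is a refinement of \<open>Q\<close>.\<close>

definition splitting_chain :: "nat \<Rightarrow> nat set set list \<Rightarrow> bool" where
  "splitting_chain N \<Phi> \<longleftrightarrow>
     2 \<le> length \<Phi> \<and> hd \<Phi> = {{1..N}} \<and> last \<Phi> = (\<lambda>i. {i}) ` {1..N} \<and>
     (\<forall>l. Suc l < length \<Phi> \<longrightarrow> refines {1..N} (\<Phi> ! Suc l) (\<Phi> ! l) \<and> \<Phi> ! Suc l \<noteq> \<Phi> ! l)"

definition branches :: "nat set set list \<Rightarrow> nat set set" where
  "branches \<Phi> = \<Union> (set (butlast \<Phi>)) - last \<Phi>"

definition depth :: "nat set set list \<Rightarrow> nat set \<Rightarrow> nat" where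
  "depth \<Phi> \<beta> = Max {l. l < length \<Phi> \<and> \<beta> \<in> \<Phi> ! l}"

definition chain_deg :: "nat set set list \<Rightarrow> nat set \<Rightarrow> nat" where
  "chain_deg \<Phi> \<beta> = card {\<mu> \<in> \<Phi> ! (depth \<Phi> \<beta> + 1). \<mu> \<subseteq> \<beta>}"

definition reduced :: "nat set set list \<Rightarrow> bool" where
  "reduced \<Phi> \<longleftrightarrow> (\<forall>\<beta> \<in> branches \<Phi>. \<forall>l < length \<Phi>. \<beta> \<in> \<Phi> ! l \<longleftrightarrow> l = depth \<Phi> \<beta>)"

definition reduced_chains :: "nat \<Rightarrow> nat set set list set" where
  "reduced_chains N = {\<Phi>. splitting_chain N \<Phi> \<and> reduced \<Phi>}"


section \<open>Exponents, integrand and summands\<close>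

text \<open>A tuple \<open>(s\<^sub>i\<^sub>j)\<close> is a function of two indices, of which only the values with
  \<open>1 \<le> i < j \<le> N\<close> are ever used.\<close>

definition pairs :: "nat set \<Rightarrow> (nat \<times> nat) set" where
  "pairs \<beta> = {(i, j). i \<in> \<beta> \<and> j \<in> \<beta> \<and> i < j}"

definition expo :: "nat set \<Rightarrow> (nat \<Rightarrow> nat \<Rightarrow> complex) \<Rightarrow> complex" where
  "expo \<beta> s = of_nat (card \<beta>) - 1 + (\<Sum>(i, j) \<in> pairs \<beta>. s i j)"

definition Omega :: "nat \<Rightarrow> (nat \<Rightarrow> nat \<Rightarrow> complex) set" where
  "Omega N = {s. \<forall>\<beta>. \<beta> \<subseteq> {1..N} \<and> 1 < card \<beta> \<longrightarrow> 0 < Re (expo \<beta> s)}"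

text \<open>Here \<open>0 powr z = 0\<close> for all \<open>z\<close>; this only concerns tuples with two equal entries.\<close>

definition integrand ::
    "('k::field \<Rightarrow> real) \<Rightarrow> nat \<Rightarrow> (nat \<Rightarrow> nat \<Rightarrow> complex) \<Rightarrow> (nat \<Rightarrow> ('k \<times> 'k) set) \<Rightarrow> complex" where
  "integrand v N s x = (\<Prod>(i, j) \<in> pairs {1..N}. complex_of_real (proj_delta v (x i) (x j)) powr s i j)"

definition falling :: "complex \<Rightarrow> nat \<Rightarrow> complex" where
  "falling z n = (\<Prod>k<n. z - of_nat k)"

definition branch_factor ::
    "nat \<Rightarrow> (nat \<Rightarrow> nat \<Rightarrow> complex) \<Rightarrow> nat set set list \<Rightarrow> nat set \<Rightarrow> complex" where
  "branch_factor q s \<Phi> \<beta> =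
     falling (of_nat q - 1) (chain_deg \<Phi> \<beta> - 1) / (of_nat q powr expo \<beta> s - 1)"

text \<open>The summand with the cancellation carried out: writing \<open>d\<close> for the degree of \<open>[N]\<close>, the last
  factor of \<open>(q - 1)\<^sub>d\<^sub>-\<^sub>1\<close> is \<open>q + 1 - d\<close>, so \<open>(q - 1)\<^sub>d\<^sub>-\<^sub>1 / (q + 1 - d)\<close> becomes
  \<open>(q - 1)\<^sub>d\<^sub>-\<^sub>2\<close>. Lemma \<open>chain_term_eq\<close> below compares it with the uncancelled expression.\<close>

definition chain_term ::
    "nat \<Rightarrow> nat \<Rightarrow> (nat \<Rightarrow> nat \<Rightarrow> complex) \<Rightarrow> nat set set list \<Rightarrow> complex" where
  "chain_term q N s \<Phi> =
     (of_nat q powr (of_nat N + (\<Sum>(i, j) \<in> pairs {1..N}. s i j)) + 1 - of_nat (chain_deg \<Phi> {1..N})) *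
     (falling (of_nat q - 1) (chain_deg \<Phi> {1..N} - 2) / (of_nat q powr expo {1..N} s - 1)) *
     (\<Prod>\<beta> \<in> branches \<Phi> - {{1..N}}. branch_factor q s \<Phi> \<beta>)"


section \<open>Consistency of the definitions\<close>

lemma Metric_space_abs:
  assumes "nonarch_abs v"
  shows "Metric_space UNIV (\<lambda>x y. v (x - y))"
proof -
  have nn: "0 \<le> v x" and z: "v x = 0 \<longleftrightarrow> x = 0" and m: "v (x * y) = v x * v y"
    and u: "v (x + y) \<le> max (v x) (v y)" for x y
    using assms by (auto simp: nonarch_abs_def)
  have "v 1 = 1" using m[of 1 1] z[of 1] by simp
  then have "v (- 1) = 1"
    using m[of "- 1" "- 1"] nn[of "- 1"] by (simp add: square_eq_1_iff)
  then have neg: "v (- x) = v x" for x using m[of "- 1" x] by simp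
  show ?thesis
  proof
    show "v (x - y) = v (y - x)" for x y using neg[of "x - y"] by simp
    show "v (x - z) \<le> v (x - y) + v (y - z)" for x y z
      using u[of "x - y" "y - z"] nn[of "x - y"] nn[of "y - z"] by simp
  qed (auto simp: nn z)
qed

lemma topspace_punctured_plane:
  assumes "nonarch_abs v"
  shows "topspace (punctured_plane v) = UNIV - {(0, 0)}"
  using Metric_space.topspace_mtopology[OF Metric_space_abs[OF assms]]
  by (simp add: punctured_plane_def field_topology_def)

lemma openin_proj_topology:
  assumes "nonarch_abs v"
  shows "openin (proj_topology v) U \<longleftrightarrow> U \<subseteq> proj_line \<and>
     openin (punctured_plane v) {x \<in> UNIV - {(0, 0)}. proj_class x \<in> U}"
proof -
  have "istopology (\<lambda>U. U \<subseteq> proj_line \<and>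
     openin (punctured_plane v) {x \<in> UNIV - {(0, 0)}. proj_class x \<in> U})"
    unfolding istopology_def
  proof (intro conjI allI impI)
    fix S T :: "('a \<times> 'a) set set"
    assume S: "S \<subseteq> proj_line \<and> openin (punctured_plane v) {x \<in> UNIV - {(0, 0)}. proj_class x \<in> S}"
      and T: "T \<subseteq> proj_line \<and> openin (punctured_plane v) {x \<in> UNIV - {(0, 0)}. proj_class x \<in> T}"
    then show "S \<inter> T \<subseteq> proj_line" by blast
    have "{x \<in> UNIV - {(0, 0)}. proj_class x \<in> S \<inter> T} =
      {x \<in> UNIV - {(0, 0)}. proj_class x \<in> S} \<inter> {x \<in> UNIV - {(0, 0)}. proj_class x \<in> T}"
      by blast
    then show "openin (punctured_plane v) {x \<in> UNIV - {(0, 0)}. proj_class x \<in> S \<inter> T}"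
      using S T by (simp only: openin_Int)
  next
    fix \<K> :: "('a \<times> 'a) set set set"
    assume K: "\<forall>S \<in> \<K>. S \<subseteq> proj_line \<and>
      openin (punctured_plane v) {x \<in> UNIV - {(0, 0)}. proj_class x \<in> S}"
    then show "\<Union>\<K> \<subseteq> proj_line" by blast
    have "{x \<in> UNIV - {(0, 0)}. proj_class x \<in> \<Union>\<K>} =
      (\<Union>S \<in> \<K>. {x \<in> UNIV - {(0, 0)}. proj_class x \<in> S})"
      by blast
    moreover have "openin (punctured_plane v) (\<Union>S \<in> \<K>. {x \<in> UNIV - {(0, 0)}. proj_class x \<in> S})"
      using K by (intro openin_Union) auto
    ultimately show "openin (punctured_plane v) {x \<in> UNIV - {(0, 0)}. proj_class x \<in> \<Union>\<K>}"
      by (simp only:)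
  qed
  then show ?thesis unfolding proj_topology_def by (simp only: topology_inverse')
qed

lemma topspace_proj_topology:
  assumes "nonarch_abs v"
  shows "topspace (proj_topology v) = proj_line"
proof -
  have "{x \<in> UNIV - {(0, 0)}. proj_class x \<in> proj_line} = topspace (punctured_plane v)"
    using topspace_punctured_plane[OF assms] by (auto simp: proj_line_def)
  then have "openin (proj_topology v) proj_line"
    by (simp only: openin_proj_topology[OF assms] openin_topspace simp_thms subset_refl)
  then show ?thesis
    by (meson assms openin_proj_topology openin_subset openin_topspace subset_antisym)
qed

lemma quotient_map_proj_class:
  assumes "nonarch_abs v"
  shows "quotient_map (punctured_plane v) (proj_topology v) proj_class"
  unfolding quotient_map_def
    topspace_punctured_plane[OF assms] topspace_proj_topology[OF assms]
    openin_proj_topology[OF assms]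
  by (auto simp: proj_line_def)

lemma proj_delta_class:
  assumes "nonarch_abs v"
  shows "proj_delta v (proj_class x) (proj_class y) = vec_delta v x y"
proof -
  have m: "v (x * y) = v x * v y" and z: "v x = 0 \<longleftrightarrow> x = 0" and nn: "0 \<le> v x" for x y
    using assms by (auto simp: nonarch_abs_def)
  have ex: "\<exists>c. c \<noteq> 0 \<and> (SOME w. w \<in> proj_class u) = (c * fst u, c * snd u)" for u :: "'a \<times> 'a"
  proof -
    have "(1 * fst u, 1 * snd u) \<in> proj_class u"
      unfolding proj_class_def using one_neq_zero by blast
    then have "(SOME w. w \<in> proj_class u) \<in> proj_class u" by (rule someI)
    then show ?thesis unfolding proj_class_def by blast
  qed
  obtain c where c: "c \<noteq> 0" "(SOME w. w \<in> proj_class x) = (c * fst x, c * snd x)" using ex by blast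
  obtain d where d: "d \<noteq> 0" "(SOME w. w \<in> proj_class y) = (d * fst y, d * snd y)" using ex by blast
  have num: "c * fst x * (d * snd y) - c * snd x * (d * fst y) = c * d * (fst x * snd y - snd x * fst y)"
    by (simp add: algebra_simps)
  have mx: "max (v e * a) (v e * b) = v e * max a b" for e a b
    using nn[of e] by (simp only: max_mult_distrib_left if_True)
  have nz: "v c \<noteq> 0" "v d \<noteq> 0" using c(1) d(1) by (simp_all only: z not_False_eq_True)
  have "proj_delta v (proj_class x) (proj_class y) = vec_delta v (c * fst x, c * snd x) (d * fst y, d * snd y)"
    by (simp only: proj_delta_def c(2) d(2))
  also have "\<dots> = (v c * v d * v (fst x * snd y - snd x * fst y)) /
      ((v c * max (v (fst x)) (v (snd x))) * (v d * max (v (fst y)) (v (snd y))))"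
    by (simp only: vec_delta_def fst_conv snd_conv num m mx)
  also have "\<dots> = vec_delta v x y"
    using nz by (simp add: vec_delta_def)
  finally show ?thesis .
qed

lemma proj_act_class:
  "proj_act (a, b, c, d) (proj_class x) =
    proj_class (a * fst x + b * snd x, c * fst x + d * snd x)"
proof -
  have *: "proj_class y = (\<lambda>k. (k * fst y, k * snd y)) ` (- {0})" for y :: "'a \<times> 'a"
    by (auto simp: proj_class_def)
  show ?thesis
    unfolding proj_act_def * image_image
    by (simp add: algebra_simps)
qed

lemma falling_cancel:
  assumes "2 \<le> d"
  shows "falling (z - 1) (d - 1) = (z + 1 - of_nat d) * falling (z - 1) (d - 2)"
proof -
  obtain n where "d = Suc (Suc n)" using assms by (metis add_2_eq_Suc le_Suc_ex)
  then show ?thesis by (simp add: falling_def algebra_simps)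
qed

lemma finite_branches:
  assumes "splitting_chain N \<Phi>"
  shows "finite (branches \<Phi>)"
proof -
  have "P \<subseteq> Pow {1..N}" if P: "P \<in> set \<Phi>" for P
  proof -
    obtain l where l: "l < length \<Phi>" "P = \<Phi> ! l" using P by (auto simp: in_set_conv_nth)
    show ?thesis
    proof (cases l)
      case 0
      have "\<Phi> \<noteq> []" using l by auto
      then have "P = hd \<Phi>" using 0 l by (simp add: hd_conv_nth)
      then show ?thesis using assms by (simp add: splitting_chain_def)
    next
      case (Suc k)
      have "refines {1..N} (\<Phi> ! Suc k) (\<Phi> ! k)"
        using assms l(1) Suc by (simp add: splitting_chain_def)
      then have "\<Union>P = {1..N}" using l(2) Suc by (simp add: refines_def partition_on_def)
      then show ?thesis by blast
    qed
  qed
  then have "\<Union> (set (butlast \<Phi>)) \<subseteq> Pow {1..N}"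
    by (intro Union_least) (simp add: in_set_butlastD)
  then have "finite (\<Union> (set (butlast \<Phi>)))"
    by (rule finite_subset) simp
  then show ?thesis by (simp add: branches_def)
qed

lemma full_in_branches:
  assumes "2 \<le> N" "splitting_chain N \<Phi>"
  shows "{1..N} \<in> branches \<Phi>"
proof -
  have "{1..N} \<notin> last \<Phi>"
  proof
    assume "{1..N} \<in> last \<Phi>"
    then obtain i where "{1..N} = {i}" using assms by (auto simp: splitting_chain_def)
    then have "card {1..N} = 1" by simp
    then show False using assms by simp
  qed
  moreover have "{1..N} \<in> hd \<Phi>" using assms by (simp add: splitting_chain_def)
  moreover have "hd \<Phi> \<in> set (butlast \<Phi>)"
  proof -
    have "2 \<le> length \<Phi>" using assms by (simp add: splitting_chain_def)
    then obtain x y xs where "\<Phi> = x # y # xs"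
      by (metis Suc_le_length_iff numeral_2_eq_2)
    then show ?thesis by simp
  qed
  ultimately show ?thesis by (auto simp: branches_def)
qed

lemma full_deg_ge_2:
  assumes "2 \<le> N" "splitting_chain N \<Phi>"
  shows "2 \<le> chain_deg \<Phi> {1..N}"
proof -
  define A where "A = {l. l < length \<Phi> \<and> {1..N} \<in> \<Phi> ! l}"
  define l where "l = depth \<Phi> {1..N}"
  have ne: "\<Phi> \<noteq> []" using assms(2) unfolding splitting_chain_def by force
  have fin: "finite A" by (simp add: A_def)
  have "\<Phi> ! 0 = {{1..N}}"
    using assms(2) hd_conv_nth[OF ne] unfolding splitting_chain_def by simp
  then have "0 \<in> A" using ne unfolding A_def by simp
  have lMax: "l = Max A" by (simp only: l_def depth_def A_def)
  have lA: "l \<in> A" using Max_in[OF fin] \<open>0 \<in> A\<close> unfolding lMax by blast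
  have top: "k \<le> l" if "k \<in> A" for k using Max_ge[OF fin that] unfolding lMax .
  have "{1..N} \<notin> last \<Phi>" using full_in_branches[OF assms] by (simp add: branches_def)
  then have "l \<noteq> length \<Phi> - 1" using lA ne by (auto simp: A_def last_conv_nth)
  then have lt: "Suc l < length \<Phi>" using lA by (auto simp: A_def)
  then have "refines {1..N} (\<Phi> ! Suc l) (\<Phi> ! l)"
    using assms by (auto simp: splitting_chain_def)
  then have part: "partition_on {1..N} (\<Phi> ! Suc l)" by (simp add: refines_def)
  have notin: "{1..N} \<notin> \<Phi> ! Suc l" using top[of "Suc l"] lt by (auto simp: A_def)
  have sub: "\<mu> \<subseteq> {1..N}" if "\<mu> \<in> \<Phi> ! Suc l" for \<mu>
    using part that by (auto simp: partition_on_def)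
  have finP: "finite (\<Phi> ! Suc l)" using part by (auto intro: finite_elements)
  have un: "\<Union> (\<Phi> ! Suc l) = {1..N}" using part by (simp add: partition_on_def)
  have "{\<mu> \<in> \<Phi> ! (l + 1). \<mu> \<subseteq> {1..N}} = \<Phi> ! Suc l" using sub by auto
  moreover have "card (\<Phi> ! Suc l) \<noteq> 0" using un assms finP by auto
  moreover have "card (\<Phi> ! Suc l) \<noteq> 1"
    using un notin by (auto simp: card_1_singleton_iff)
  ultimately show ?thesis by (simp add: chain_deg_def l_def)
qed

lemma chain_term_eq:
  assumes "2 \<le> N" "splitting_chain N \<Phi>" "q + 1 \<noteq> chain_deg \<Phi> {1..N}"
  shows "chain_term q N s \<Phi> =
     (of_nat q powr (of_nat N + (\<Sum>(i, j) \<in> pairs {1..N}. s i j)) + 1 - of_nat (chain_deg \<Phi> {1..N})) /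
     (of_nat q + 1 - of_nat (chain_deg \<Phi> {1..N})) *
     (\<Prod>\<beta> \<in> branches \<Phi>. falling (of_nat q - 1) (chain_deg \<Phi> \<beta> - 1) / (of_nat q powr expo \<beta> s - 1))"
proof -
  define d where "d = chain_deg \<Phi> {1..N}"
  have nz: "of_nat q + 1 - of_nat d \<noteq> (0 :: complex)"
    using assms(3) unfolding d_def by (metis eq_iff_diff_eq_0 of_nat_1 of_nat_add of_nat_eq_iff)
  have canc: "falling (of_nat q - 1) (d - 1) = (of_nat q + 1 - of_nat d) * falling (of_nat q - 1) (d - 2)"
    unfolding d_def by (rule falling_cancel[OF full_deg_ge_2[OF assms(1,2)]])
  show ?thesis
    unfolding chain_term_def branch_factor_def d_def[symmetric]
      prod.remove[OF finite_branches[OF assms(2)] full_in_branches[OF assms(1,2)]] canc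
    using nz by (simp add: divide_simps)
qed

end

theory Submission
  imports Defs
begin

text \<open>
  The balls of radius \<open>q\<^sup>-\<^sup>k\<close> of the spherical metric form a tree: the whole line splits into \<open>q + 1\<close> balls,
  every smaller ball into \<open>q\<close>, and invariance under the isometries \<open>GL\<^sub>2(R)\<close>, which act transitively,
  forces balls of equal radius to have equal measure. Only this tree structure matters.
  A tuple of points in a ball is sorted according to the child containing each entry. Entries in different
  children are at a known distance, and entries in different blocks are independent, so the integral over
  a ball is a sum over partitions of products of integrals over children. The one-block partition gives back the same
  integral one level down; iterating it produces a geometric series with ratio \<open>q\<^sup>-\<^sup>e\<close>, where \<open>e\<close>
  is the exponent of the index set. This yields a recursion for the integral over trees of nested partitions, which
  the reduced splitting chains solve. Divergence is seen on a minimal index set with \<open>Re e \<le> 0\<close>, whose series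
  has terms bounded away from \<open>0\<close>.
\<close>

subsection \<open>Sums over partitions\<close>

text \<open>Why the ratio is \<open>q^-e\<close>: \<open>m\<close> levels below a ball there are
  \<open>q^m\<close> balls, and passing to one of them scales the measure in each of the
  \<open>#I\<close> coordinates and every distance by \<open>q^-m\<close>; the total factor is
  \<open>q^(m (1 - #I - sum s)) = q^(-m e)\<close>. Complex exponents are controlled by their real
  parts: the kernel for the real parts is the norm of the kernel, its level sums are nonnegative,
  and the same evaluation provides the integrable majorant. Positivity also turns the level sums
  into a lower bound for the divergence. The root cannot be handled like the other balls, since it
  has one child more. There the tuple is sorted only once, so that a partition of \<open>[N]\<close>
  into \<open>d \<ge> 2\<close> blocks arises in two ways: directly among the \<open>q + 1\<close>
  children, or inside one child, through the recursion. Adding the two coefficients yields the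
  numerator \<open>q^(N + sum s) + 1 - d\<close> that distinguishes \<open>[N]\<close> from the
  other branches.\<close>

definition fibres :: "('i \<Rightarrow> 'b) \<Rightarrow> 'i set \<Rightarrow> 'i set set" where
  "fibres g I = (\<lambda>D. {i \<in> I. g i = D}) ` g ` I"

lemma fibres_alt: "fibres g I = (\<lambda>i. {j \<in> I. g j = g i}) ` I"
  by (auto simp: fibres_def)

lemma partition_on_fibres: "partition_on I (fibres g I)"
  by (rule partition_onI) (auto simp: fibres_def disjnt_def)

lemma inj_on_fibres: "inj_on (\<lambda>D. {i \<in> I. g i = D}) (g ` I)"
  by (rule inj_onI) blast

lemma card_fibres: "card (fibres g I) = card (g ` I)"
  unfolding fibres_def by (rule card_image[OF inj_on_fibres])

lemma partition_on_unique:
  assumes "partition_on A \<pi>" "\<mu> \<in> \<pi>" "\<nu> \<in> \<pi>" "x \<in> \<mu>" "x \<in> \<nu>"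
  shows "\<mu> = \<nu>"
  using assms unfolding partition_on_def disjoint_def by blast

text \<open>An assignment with fibre partition \<open>\<pi>\<close> is the same as an injective
  choice of a value for each block, whence the falling factorial of \<open>card C\<close>. Truncated
  subtraction makes the product vanish when there are more blocks than values.\<close>

lemma card_fibres_eq:
  assumes "finite I" "finite C" "partition_on I \<pi>"
  shows "card {g \<in> I \<rightarrow>\<^sub>E C. fibres g I = \<pi>} = (\<Prod>k<card \<pi>. card C - k)"
proof -
  let ?G = "{g \<in> I \<rightarrow>\<^sub>E C. fibres g I = \<pi>}" and ?F = "{f \<in> \<pi> \<rightarrow>\<^sub>E C. inj_on f \<pi>}"
  have fin: "finite \<pi>" using assms by (blast intro: finite_elements)
  define blk where "blk i = (THE \<mu>. \<mu> \<in> \<pi> \<and> i \<in> \<mu>)" for i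
  have blk: "blk i \<in> \<pi> \<and> i \<in> blk i" if i: "i \<in> I" for i
  proof -
    obtain \<mu> where \<mu>: "\<mu> \<in> \<pi>" "i \<in> \<mu>" using assms(3) i unfolding partition_on_def by blast
    show ?thesis unfolding blk_def
      by (rule theI[where a=\<mu>]) (use \<mu> partition_on_unique[OF assms(3)] in blast)+
  qed
  have blk_eq: "blk i = \<mu>" if "\<mu> \<in> \<pi>" "i \<in> \<mu>" for i \<mu>
    using that blk partition_on_unique[OF assms(3)] assms(3) unfolding partition_on_def by blast
  have sub: "\<mu> \<subseteq> I" if "\<mu> \<in> \<pi>" for \<mu> using assms(3) that unfolding partition_on_def by blast
  define rep where "rep \<mu> = (SOME i. i \<in> \<mu>)" for \<mu> :: "'a set"
  have rep: "rep \<mu> \<in> \<mu>" if "\<mu> \<in> \<pi>" for \<mu>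
    unfolding rep_def using assms(3) that unfolding partition_on_def by (metis some_in_eq)
  \<comment> \<open>Pull back along \<open>blk\<close>, the block containing an index; the inverse
    evaluates at the representative \<open>rep\<close> of each block.\<close>
  have "bij_betw (\<lambda>f. \<lambda>i\<in>I. f (blk i)) ?F ?G"
  proof (rule bij_betw_byWitness[where f' = "\<lambda>g. \<lambda>\<mu>\<in>\<pi>. g (rep \<mu>)"])
    show "\<forall>f\<in>?F. (\<lambda>\<mu>\<in>\<pi>. (\<lambda>i\<in>I. f (blk i)) (rep \<mu>)) = f"
    proof (intro ballI ext)
      fix f \<mu> assume f: "f \<in> ?F"
      show "(\<lambda>\<mu>\<in>\<pi>. (\<lambda>i\<in>I. f (blk i)) (rep \<mu>)) \<mu> = f \<mu>"
      proof (cases "\<mu> \<in> \<pi>")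
        case True
        then show ?thesis using rep[OF True] sub[OF True] blk_eq[OF True rep[OF True]] by auto
      next
        case False
        then show ?thesis using f by (auto simp: PiE_def extensional_def)
      qed
    qed
    show "\<forall>g\<in>?G. (\<lambda>i\<in>I. (\<lambda>\<mu>\<in>\<pi>. g (rep \<mu>)) (blk i)) = g"
    proof (intro ballI ext)
      fix g i assume g: "g \<in> ?G"
      show "(\<lambda>i\<in>I. (\<lambda>\<mu>\<in>\<pi>. g (rep \<mu>)) (blk i)) i = g i"
      proof (cases "i \<in> I")
        case True
        have "blk i \<in> fibres g I" using g blk[OF True] by simp
        then obtain D where "blk i = {j \<in> I. g j = D}" unfolding fibres_def by blast
        moreover have "rep (blk i) \<in> blk i" "i \<in> blk i" using rep blk[OF True] by auto
        ultimately have "g (rep (blk i)) = g i" by auto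
        then show ?thesis using True blk[OF True] by simp
      next
        case False
        then show ?thesis using g by (auto simp: PiE_def extensional_def)
      qed
    qed
    show "(\<lambda>f. \<lambda>i\<in>I. f (blk i)) ` ?F \<subseteq> ?G"
    proof (rule image_subsetI)
      fix f assume f: "f \<in> ?F"
      let ?g = "\<lambda>i\<in>I. f (blk i)"
      have *: "{j \<in> I. ?g j = ?g i} = blk i" if i: "i \<in> I" for i
      proof (intro equalityI subsetI)
        fix j assume "j \<in> {j \<in> I. ?g j = ?g i}"
        then have "j \<in> I" "f (blk j) = f (blk i)" using i by auto
        then have "blk j = blk i" using f blk i by (auto simp: inj_on_def)
        then show "j \<in> blk i" using blk[OF \<open>j \<in> I\<close>] by auto
      next
        fix j assume j: "j \<in> blk i"
        then show "j \<in> {j \<in> I. ?g j = ?g i}" using sub blk[OF i] blk_eq[of "blk i" j] i by auto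
      qed
      have "fibres ?g I = blk ` I" unfolding fibres_alt by (rule image_cong[OF refl *])
      also have "\<dots> = \<pi>"
      proof (intro equalityI subsetI)
        fix \<mu> assume m: "\<mu> \<in> \<pi>"
        then have "\<mu> = blk (rep \<mu>)" "rep \<mu> \<in> I" using blk_eq rep sub by blast+
        then show "\<mu> \<in> blk ` I" by blast
      qed (use blk in auto)
      finally show "?g \<in> ?G" using f blk by auto
    qed
    show "(\<lambda>g. \<lambda>\<mu>\<in>\<pi>. g (rep \<mu>)) ` ?G \<subseteq> ?F"
    proof (rule image_subsetI)
      fix g assume g: "g \<in> ?G"
      have "inj_on (\<lambda>\<mu>\<in>\<pi>. g (rep \<mu>)) \<pi>"
      proof (rule inj_onI)
        fix \<mu> \<nu> assume m: "\<mu> \<in> \<pi>" "\<nu> \<in> \<pi>" "(\<lambda>\<mu>\<in>\<pi>. g (rep \<mu>)) \<mu> = (\<lambda>\<mu>\<in>\<pi>. g (rep \<mu>)) \<nu>"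
        have "\<mu> \<in> fibres g I" using m g by simp
        then obtain D where "\<mu> = {j \<in> I. g j = D}" unfolding fibres_def by blast
        then have "rep \<nu> \<in> \<mu>" using m rep[of \<mu>] rep[of \<nu>] sub by auto
        then show "\<mu> = \<nu>" using m rep[of \<nu>] partition_on_unique[OF assms(3)] by blast
      qed
      then show "(\<lambda>\<mu>\<in>\<pi>. g (rep \<mu>)) \<in> ?F" using g rep sub by fastforce
    qed
  qed
  then have "card ?G = card ?F"
    by (simp add: bij_betw_same_card)
  also have "\<dots> = (\<Prod>k<card \<pi>. card C - k)"
    using card_inj_on_subset_funcset[OF fin assms(2) subset_refl] by (simp add: lessThan_atLeast0)
  finally show ?thesis .
qed

text \<open>Group the assignments by their fibre partition. With \<open>C\<close> the children of a
  ball, this passes from placements of the entries to partitions of the index set.\<close>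

lemma sum_PiE_fibres:
  fixes F :: "'i set set \<Rightarrow> 'c::comm_semiring_1"
  assumes "finite I" "finite C"
  shows "(\<Sum>g\<in>I \<rightarrow>\<^sub>E C. F (fibres g I)) =
    (\<Sum>\<pi>\<in>{\<pi>. partition_on I \<pi>}. of_nat (\<Prod>k<card \<pi>. card C - k) * F \<pi>)"
proof -
  have "(\<Sum>g\<in>I \<rightarrow>\<^sub>E C. F (fibres g I)) =
      (\<Sum>\<pi>\<in>{\<pi>. partition_on I \<pi>}. \<Sum>g\<in>{g \<in> I \<rightarrow>\<^sub>E C. fibres g I = \<pi>}. F (fibres g I))"
    by (rule sum.group[symmetric])
      (use assms in \<open>auto simp: partition_on_fibres finitely_many_partition_on intro: finite_PiE\<close>)
  also have "\<dots> = (\<Sum>\<pi>\<in>{\<pi>. partition_on I \<pi>}. of_nat (card {g \<in> I \<rightarrow>\<^sub>E C. fibres g I = \<pi>}) * F \<pi>)"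
    by (rule sum.cong[OF refl]) simp
  also have "\<dots> = (\<Sum>\<pi>\<in>{\<pi>. partition_on I \<pi>}. of_nat (\<Prod>k<card \<pi>. card C - k) * F \<pi>)"
    by (rule sum.cong[OF refl]) (use card_fibres_eq[OF assms] in simp)
  finally show ?thesis .
qed

lemma card_block_less:
  assumes "finite A" "partition_on A \<pi>" "2 \<le> card \<pi>" "\<mu> \<in> \<pi>"
  shows "card \<mu> < card A"
proof -
  have "\<pi> \<noteq> {\<mu>}" using assms(3) by auto
  then obtain \<nu> where n: "\<nu> \<in> \<pi>" "\<nu> \<noteq> \<mu>" using assms(4) by auto
  have "\<nu> \<noteq> {}" "\<nu> \<inter> \<mu> = {}" "\<nu> \<subseteq> A" "\<mu> \<subseteq> A"
    using assms(2,4) n by (auto simp: partition_on_def disjoint_def)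
  then have "\<mu> \<subset> A" by blast
  then show ?thesis by (rule psubset_card_mono[OF assms(1)])
qed

text \<open>The weighted count of rooted trees with leaf set \<open>A\<close> whose inner vertices
  have at least two children; a vertex is weighted by its leaf set and its number of children. The
  base case includes infinite sets, whose \<open>card\<close> is 0, so \<open>A\<close> is finite in
  the recursive case and blocks get smaller.\<close>

function tree_sum :: "('a set \<Rightarrow> nat \<Rightarrow> 'c::comm_semiring_1) \<Rightarrow> 'a set \<Rightarrow> 'c" where
  "tree_sum w A = (if card A \<le> 1 then 1 else
     \<Sum>\<pi>\<in>{\<pi>. partition_on A \<pi> \<and> 2 \<le> card \<pi>}. w A (card \<pi>) * (\<Prod>\<mu>\<in>\<pi>. tree_sum w \<mu>))"
  by pat_completeness auto
termination
proof (relation "Wellfounded.measure (\<lambda>(w, A). card A)")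
  fix w :: "'a set \<Rightarrow> nat \<Rightarrow> 'c" and A :: "'a set" and \<pi> \<mu>
  assume a: "\<not> card A \<le> 1" "\<pi> \<in> {\<pi>. partition_on A \<pi> \<and> 2 \<le> card \<pi>}" "\<mu> \<in> \<pi>"
  then have "finite A" using card.infinite by fastforce
  with a show "((w, \<mu>), (w, A)) \<in> Wellfounded.measure (\<lambda>(w, A). card A)"
    using card_block_less[of A \<pi> \<mu>] by simp
qed simp

declare tree_sum.simps [simp del]

lemma tree_sum_singleton: "card A = 1 \<Longrightarrow> tree_sum w A = 1"
  by (subst tree_sum.simps) simp

subsection \<open>Sums over chains\<close>

text \<open>One step of a reduced chain. Singletons are exempt because they cannot split
  further.\<close>

definition splits :: "'a set \<Rightarrow> 'a set set \<Rightarrow> 'a set set set" where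
  "splits A \<phi> = {\<psi>. refines A \<psi> \<phi> \<and> (\<forall>\<beta>\<in>\<phi>. 1 < card \<beta> \<longrightarrow> \<beta> \<notin> \<psi>)}"

text \<open>Distributivity: a step of the chain below \<open>\<phi>\<close> is an independent
  choice, for each non-singleton block, of a partition of that block into at least two parts. Hence
  the sum over all steps is the product over the blocks of the recursion for
  \<open>tree_sum\<close>.\<close>

lemma sum_splits:
  fixes w :: "'a set \<Rightarrow> nat \<Rightarrow> 'c::comm_semiring_1"
  assumes "finite A" "partition_on A \<phi>"
  shows "(\<Sum>\<psi>\<in>splits A \<phi>. (\<Prod>\<beta>\<in>{\<beta>\<in>\<phi>. 1 < card \<beta>}. w \<beta> (card {\<mu>\<in>\<psi>. \<mu> \<subseteq> \<beta>})) * (\<Prod>\<mu>\<in>\<psi>. tree_sum w \<mu>)) =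
    (\<Prod>\<beta>\<in>\<phi>. tree_sum w \<beta>)"
proof -
  \<comment> \<open>Singletons have only the trivial choice, with weight 1; this lets all blocks of
    \<open>\<phi>\<close> be treated uniformly.\<close>
  define B where "B \<beta> = (if card \<beta> \<le> 1 then {{\<beta>}} else {\<rho>. partition_on \<beta> \<rho> \<and> 2 \<le> card \<rho>})" for \<beta> :: "'a set"
  define u where "u \<beta> \<rho> = (if card \<beta> \<le> 1 then 1 else w \<beta> (card \<rho>))" for \<beta> :: "'a set" and \<rho> :: "'a set set"
  have finphi: "finite \<phi>" using assms by (rule finite_elements)
  have sub: "\<beta> \<subseteq> A" and finb: "finite \<beta>" and ne: "\<beta> \<noteq> {}" if "\<beta> \<in> \<phi>" for \<beta>
    using assms that unfolding partition_on_def by (auto intro: finite_subset)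
  have Bpart: "partition_on \<beta> \<rho>" if "\<beta> \<in> \<phi>" "\<rho> \<in> B \<beta>" for \<beta> \<rho>
    using that ne[OF that(1)] partition_on_space[of \<beta>] by (auto simp: B_def split: if_splits)
  have finB: "finite (B \<beta>)" if "\<beta> \<in> \<phi>" for \<beta>
    using finitely_many_partition_on[OF finb[OF that]] by (auto simp: B_def)
  have T: "tree_sum w \<beta> = (\<Sum>\<rho>\<in>B \<beta>. u \<beta> \<rho> * (\<Prod>\<mu>\<in>\<rho>. tree_sum w \<mu>))" for \<beta>
  proof (cases "card \<beta> \<le> 1")
    case True
    then show ?thesis by (simp add: B_def u_def)
  next
    case False
    then show ?thesis by (subst tree_sum.simps) (simp add: B_def u_def)
  qed
  have singB: "card \<beta> = 1" if "\<beta> \<in> \<phi>" "card \<beta> \<le> 1" for \<beta>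
    using that finb[OF that(1)] ne[OF that(1)] by (simp add: card_gt_0_iff le_Suc_eq)
  have restr: "{\<mu> \<in> \<Union>(g ` \<phi>). \<mu> \<subseteq> \<beta>} = g \<beta>" if g: "g \<in> PiE \<phi> B" and b: "\<beta> \<in> \<phi>" for g \<beta>
  proof (intro equalityI subsetI)
    fix \<mu> assume "\<mu> \<in> {\<mu> \<in> \<Union>(g ` \<phi>). \<mu> \<subseteq> \<beta>}"
    then obtain \<gamma> where c: "\<gamma> \<in> \<phi>" "\<mu> \<in> g \<gamma>" "\<mu> \<subseteq> \<beta>" by blast
    then have p: "partition_on \<gamma> (g \<gamma>)" using g by (intro Bpart) auto
    then obtain x where "x \<in> \<mu>" using c unfolding partition_on_def by fastforce
    then have "x \<in> \<gamma>" "x \<in> \<beta>" using c p unfolding partition_on_def by auto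
    then have "\<gamma> = \<beta>" using partition_on_unique[OF assms(2)] b c by blast
    then show "\<mu> \<in> g \<beta>" using c by simp
  next
    fix \<mu> assume m: "\<mu> \<in> g \<beta>"
    have "partition_on \<beta> (g \<beta>)" using g b by (intro Bpart) auto
    then show "\<mu> \<in> {\<mu> \<in> \<Union>(g ` \<phi>). \<mu> \<subseteq> \<beta>}" using m b unfolding partition_on_def by auto
  qed
  have "(\<Prod>\<beta>\<in>\<phi>. tree_sum w \<beta>) = (\<Prod>\<beta>\<in>\<phi>. \<Sum>\<rho>\<in>B \<beta>. u \<beta> \<rho> * (\<Prod>\<mu>\<in>\<rho>. tree_sum w \<mu>))"
    by (rule prod.cong[OF refl T])
  also have "\<dots> = (\<Sum>g\<in>PiE \<phi> B. \<Prod>\<beta>\<in>\<phi>. u \<beta> (g \<beta>) * (\<Prod>\<mu>\<in>g \<beta>. tree_sum w \<mu>))"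
    by (rule prod_sum_PiE) (use finphi finB in auto)
  also have "\<dots> = (\<Sum>\<psi>\<in>splits A \<phi>. (\<Prod>\<beta>\<in>{\<beta>\<in>\<phi>. 1 < card \<beta>}. w \<beta> (card {\<mu>\<in>\<psi>. \<mu> \<subseteq> \<beta>})) * (\<Prod>\<mu>\<in>\<psi>. tree_sum w \<mu>))"
  \<comment> \<open>Gluing the chosen partitions gives \<open>\<psi>\<close>; cutting
    \<open>\<psi>\<close> along the blocks of \<open>\<phi>\<close> recovers them, by
    \<open>restr\<close>.\<close>
  proof (rule sum.reindex_bij_witness[where j = "\<lambda>g. \<Union>(g ` \<phi>)" and i = "\<lambda>\<psi>. \<lambda>\<beta>\<in>\<phi>. {\<mu>\<in>\<psi>. \<mu> \<subseteq> \<beta>}"])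
    fix g assume g: "g \<in> PiE \<phi> B"
    have gp: "partition_on \<beta> (g \<beta>)" if "\<beta> \<in> \<phi>" for \<beta> using g that by (intro Bpart) auto
    show "(\<lambda>\<beta>\<in>\<phi>. {\<mu> \<in> \<Union>(g ` \<phi>). \<mu> \<subseteq> \<beta>}) = g"
      using restr[OF g] g by (intro ext) (auto simp: restrict_def PiE_def extensional_def)
    have "partition_on A (\<Union>(g ` \<phi>))"
    proof (rule partition_onI)
      have "\<Union>(\<Union>(g ` \<phi>)) = (\<Union>\<beta>\<in>\<phi>. \<Union>(g \<beta>))" by blast
      also have "\<dots> = (\<Union>\<beta>\<in>\<phi>. \<beta>)" using gp by (intro SUP_cong) (auto simp: partition_on_def)
      finally show "\<Union>(\<Union>(g ` \<phi>)) = A" using assms(2) by (simp add: partition_on_def)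
      show "{} \<notin> \<Union>(g ` \<phi>)" using gp by (auto simp: partition_on_def)
      fix p r assume pr: "p \<in> \<Union>(g ` \<phi>)" "r \<in> \<Union>(g ` \<phi>)" "p \<noteq> r"
      then obtain \<beta> \<gamma> where bc: "\<beta> \<in> \<phi>" "\<gamma> \<in> \<phi>" "p \<in> g \<beta>" "r \<in> g \<gamma>" by blast
      show "disjnt p r"
      proof (rule ccontr)
        assume "\<not> disjnt p r"
        then obtain x where x: "x \<in> p" "x \<in> r" by (auto simp: disjnt_def)
        have "x \<in> \<beta>" "x \<in> \<gamma>" using gp bc x unfolding partition_on_def by blast+
        then have "\<beta> = \<gamma>" using partition_on_unique[OF assms(2)] bc by blast
        then show False using partition_on_unique[OF gp[OF bc(1)] bc(3), of r x] bc x pr by blast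
      qed
    qed
    moreover have "\<exists>Y\<in>\<phi>. X \<subseteq> Y" if "X \<in> \<Union>(g ` \<phi>)" for X
      using that gp unfolding partition_on_def by blast
    moreover have "\<beta> \<notin> \<Union>(g ` \<phi>)" if b: "\<beta> \<in> \<phi>" "1 < card \<beta>" for \<beta>
    proof
      assume "\<beta> \<in> \<Union>(g ` \<phi>)"
      then have "\<beta> \<in> g \<beta>" using restr[OF g b(1)] by blast
      moreover have "2 \<le> card (g \<beta>)" using g b by (auto simp: PiE_def Pi_def B_def split: if_splits)
      ultimately show False using card_block_less[OF finb[OF b(1)] gp[OF b(1)]] by blast
    qed
    ultimately show "\<Union>(g ` \<phi>) \<in> splits A \<phi>" unfolding splits_def refines_def using assms(2) by blast
    have "(\<Prod>\<mu>\<in>\<Union>(g ` \<phi>). tree_sum w \<mu>) = (\<Prod>\<beta>\<in>\<phi>. \<Prod>\<mu>\<in>g \<beta>. tree_sum w \<mu>)"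
    proof (rule prod.UNION_disjoint[OF finphi])
      show "\<forall>i\<in>\<phi>. finite (g i)" using gp finb finite_elements by blast
      show "\<forall>i\<in>\<phi>. \<forall>j\<in>\<phi>. i \<noteq> j \<longrightarrow> g i \<inter> g j = {}"
      proof (intro ballI impI equals0I)
        fix i j \<mu> assume ij: "i \<in> \<phi>" "j \<in> \<phi>" "i \<noteq> j" "\<mu> \<in> g i \<inter> g j"
        then have "\<mu> \<subseteq> i" "\<mu> \<subseteq> j" "\<mu> \<noteq> {}" using gp unfolding partition_on_def by blast+
        then show False using partition_on_unique[OF assms(2) ij(1,2)] ij(3) by blast
      qed
    qed
    moreover have "(\<Prod>\<beta>\<in>\<phi>. u \<beta> (g \<beta>)) = (\<Prod>\<beta>\<in>{\<beta>\<in>\<phi>. 1 < card \<beta>}. w \<beta> (card {\<mu>\<in>\<Union>(g ` \<phi>). \<mu> \<subseteq> \<beta>}))"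
    proof -
      have "(\<Prod>\<beta>\<in>{\<beta>\<in>\<phi>. 1 < card \<beta>}. w \<beta> (card {\<mu>\<in>\<Union>(g ` \<phi>). \<mu> \<subseteq> \<beta>})) = (\<Prod>\<beta>\<in>{\<beta>\<in>\<phi>. 1 < card \<beta>}. u \<beta> (g \<beta>))"
        using restr[OF g] by (intro prod.cong) (auto simp: u_def)
      also have "\<dots> = (\<Prod>\<beta>\<in>\<phi>. u \<beta> (g \<beta>))"
        using finphi by (intro prod.mono_neutral_left) (auto simp: u_def)
      finally show ?thesis by simp
    qed
    ultimately show "(\<Prod>\<beta>\<in>{\<beta>\<in>\<phi>. 1 < card \<beta>}. w \<beta> (card {\<mu>\<in>\<Union>(g ` \<phi>). \<mu> \<subseteq> \<beta>})) * (\<Prod>\<mu>\<in>\<Union>(g ` \<phi>). tree_sum w \<mu>) =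
      (\<Prod>\<beta>\<in>\<phi>. u \<beta> (g \<beta>) * (\<Prod>\<mu>\<in>g \<beta>. tree_sum w \<mu>))" by (simp add: prod.distrib)
  next
    fix \<psi> assume p: "\<psi> \<in> splits A \<phi>"
    then have r: "refines A \<psi> \<phi>" and nb: "\<And>\<beta>. \<beta> \<in> \<phi> \<Longrightarrow> 1 < card \<beta> \<Longrightarrow> \<beta> \<notin> \<psi>" by (auto simp: splits_def)
    show "\<Union> ((\<lambda>\<beta>\<in>\<phi>. {\<mu> \<in> \<psi>. \<mu> \<subseteq> \<beta>}) ` \<phi>) = \<psi>"
      using r by (auto simp: refines_def)
    have "{\<mu> \<in> \<psi>. \<mu> \<subseteq> \<beta>} \<in> B \<beta>" if b: "\<beta> \<in> \<phi>" for \<beta>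
    proof (cases "card \<beta> \<le> 1")
      case True
      then have "card \<beta> = 1" using singB b by blast
      then obtain x where x: "\<beta> = {x}" by (auto simp: card_1_singleton_iff)
      have "partition_on {x} {\<mu> \<in> \<psi>. \<mu> \<subseteq> \<beta>}" using refines_obtains_subset[OF r b] x by simp
      then have un: "\<Union>{\<mu> \<in> \<psi>. \<mu> \<subseteq> \<beta>} = {x}" "{} \<notin> {\<mu> \<in> \<psi>. \<mu> \<subseteq> \<beta>}" unfolding partition_on_def by blast+
      have "\<mu> = {x}" if "\<mu> \<in> {\<mu> \<in> \<psi>. \<mu> \<subseteq> \<beta>}" for \<mu> using that un x by (metis mem_Collect_eq subset_singletonD)
      then have "{\<mu> \<in> \<psi>. \<mu> \<subseteq> \<beta>} = {{x}}" using un(1) by (metis (no_types, lifting) Union_empty equals0I insertI1 insert_absorb insert_not_empty is_singletonI' is_singleton_def)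
      then show ?thesis using x by (simp add: B_def)
    next
      case False
      have pb: "partition_on \<beta> {\<mu> \<in> \<psi>. \<mu> \<subseteq> \<beta>}" (is "partition_on \<beta> ?S") by (rule refines_obtains_subset[OF r b])
      have "finite ?S" by (rule finite_elements[OF finb[OF b] pb])
      have un: "\<Union>?S = \<beta>" using pb unfolding partition_on_def by blast
      have "\<beta> \<notin> ?S" using nb[OF b] False by auto
      then have "card ?S \<noteq> 1" using un by (auto simp: card_1_singleton_iff)
      moreover have "card ?S \<noteq> 0" using un \<open>finite ?S\<close> ne[OF b] by auto
      ultimately show ?thesis using False pb by (simp add: B_def)
    qed
    then show "(\<lambda>\<beta>\<in>\<phi>. {\<mu> \<in> \<psi>. \<mu> \<subseteq> \<beta>}) \<in> PiE \<phi> B" by simp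
  qed
  finally show ?thesis by simp
qed

text \<open>Reducedness means that every non-singleton block splits at each step; this makes the chains below
  a given partition into a product over its blocks.\<close>

fun split_chain :: "'a set \<Rightarrow> 'a set set list \<Rightarrow> bool" where
  "split_chain A [] \<longleftrightarrow> False"
| "split_chain A [\<phi>] \<longleftrightarrow> \<phi> = (\<lambda>i. {i}) ` A"
| "split_chain A (\<phi> # \<psi> # \<Phi>) \<longleftrightarrow> \<phi> \<noteq> (\<lambda>i. {i}) ` A \<and> \<psi> \<in> splits A \<phi> \<and> split_chain A (\<psi> # \<Phi>)"

text \<open>A non-singleton block is charged at each step where it is present, with the number of
  pieces it has one step later. In a \<open>split_chain\<close> below a partition it is present at
  one level only, so the number charged is its degree.\<close>

fun chain_weight :: "('a set \<Rightarrow> nat \<Rightarrow> 'c::comm_semiring_1) \<Rightarrow> 'a set set list \<Rightarrow> 'c" where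
  "chain_weight w [] = 1"
| "chain_weight w [\<phi>] = 1"
| "chain_weight w (\<phi> # \<psi> # \<Phi>) =
    (\<Prod>\<beta>\<in>{\<beta>\<in>\<phi>. 1 < card \<beta>}. w \<beta> (card {\<mu>\<in>\<psi>. \<mu> \<subseteq> \<beta>})) * chain_weight w (\<psi> # \<Phi>)"

lemma finite_splits: "finite A \<Longrightarrow> finite (splits A \<phi>)"
  by (rule finite_subset[OF _ finitely_many_partition_on]) (auto simp: splits_def refines_def)

lemma exists_nonsingleton_block:
  assumes "partition_on A \<phi>" "\<phi> \<noteq> (\<lambda>i. {i}) ` A" "finite A"
  shows "\<exists>\<beta>\<in>\<phi>. 1 < card \<beta>"
proof (rule ccontr)
  assume *: "\<not> ?thesis"
  have s: "\<exists>i\<in>A. \<beta> = {i}" if b: "\<beta> \<in> \<phi>" for \<beta>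
  proof -
    have "\<beta> \<subseteq> A" "\<beta> \<noteq> {}" using assms b unfolding partition_on_def by blast+
    moreover have "card \<beta> \<noteq> 0" using calculation assms(3) finite_subset by fastforce
    ultimately have "card \<beta> = 1" using * b by force
    then show ?thesis using \<open>\<beta> \<subseteq> A\<close> by (auto simp: card_1_singleton_iff)
  qed
  have "{i} \<in> \<phi>" if i: "i \<in> A" for i
  proof -
    obtain \<beta> where "\<beta> \<in> \<phi>" "i \<in> \<beta>" using assms(1) i unfolding partition_on_def by blast
    with s show ?thesis by fastforce
  qed
  with s assms(2) show False by blast
qed

lemma split_chains_step:
  assumes "\<phi> \<noteq> (\<lambda>i. {i}) ` A"
  shows "{\<Phi>. split_chain A (\<phi> # \<Phi>)} = (\<Union>\<psi>\<in>splits A \<phi>. (#) \<psi> ` {\<Phi>. split_chain A (\<psi> # \<Phi>)})"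
proof (intro equalityI subsetI)
  fix \<Phi> assume "\<Phi> \<in> {\<Phi>. split_chain A (\<phi> # \<Phi>)}"
  then show "\<Phi> \<in> (\<Union>\<psi>\<in>splits A \<phi>. (#) \<psi> ` {\<Phi>. split_chain A (\<psi> # \<Phi>)})"
    using assms by (cases \<Phi>) auto
qed (use assms in auto)

text \<open>By \<open>sum_splits\<close> the product over the blocks is reproduced by one step of
  the chain. The induction counts the pairs of elements sharing a block, a number that drops at each
  step, whereas the lengths of the chains are not bounded beforehand. Finiteness is carried along
  because sums over infinite sets default to 0.\<close>

lemma sum_split_chains:
  fixes w :: "'a set \<Rightarrow> nat \<Rightarrow> 'c::comm_semiring_1"
  assumes "finite A" "partition_on A \<phi>"
  shows "finite {\<Phi>. split_chain A (\<phi> # \<Phi>)} \<and>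
    (\<Sum>\<Phi>\<in>{\<Phi>. split_chain A (\<phi> # \<Phi>)}. chain_weight w (\<phi> # \<Phi>)) = (\<Prod>\<beta>\<in>\<phi>. tree_sum w \<beta>)"
  using assms(2)
proof (induction "card {(i, j). \<exists>\<beta>\<in>\<phi>. i \<in> \<beta> \<and> j \<in> \<beta>}" arbitrary: \<phi> rule: less_induct)
  case less
  show ?case
  proof (cases "\<phi> = (\<lambda>i. {i}) ` A")
    case True
    have "\<Phi> = []" if "split_chain A (\<phi> # \<Phi>)" for \<Phi> using that True by (cases \<Phi>) auto
    then have eq: "{\<Phi>. split_chain A (\<phi> # \<Phi>)} = {[]}" using True by auto
    have "(\<Prod>\<beta>\<in>\<phi>. tree_sum w \<beta>) = 1"
      by (rule prod.neutral) (auto simp: True tree_sum_singleton)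
    then show ?thesis unfolding eq by simp
  next
    case False
    have IH: "finite {\<Phi>. split_chain A (\<psi> # \<Phi>)} \<and>
      (\<Sum>\<Phi>\<in>{\<Phi>. split_chain A (\<psi> # \<Phi>)}. chain_weight w (\<psi> # \<Phi>)) = (\<Prod>\<beta>\<in>\<psi>. tree_sum w \<beta>)"
      if psi: "\<psi> \<in> splits A \<phi>" for \<psi>
    proof (rule less.hyps)
      have ref: "refines A \<psi> \<phi>" and pp: "partition_on A \<psi>" using psi by (auto simp: splits_def refines_def)
      show "partition_on A \<psi>" by (fact pp)
      have "{(i, j). \<exists>\<beta>\<in>\<phi>. i \<in> \<beta> \<and> j \<in> \<beta>} \<subseteq> A \<times> A" using less.prems unfolding partition_on_def by blast
      then have fin: "finite {(i, j). \<exists>\<beta>\<in>\<phi>. i \<in> \<beta> \<and> j \<in> \<beta>}"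
        by (rule finite_subset) (simp add: assms(1))
      \<comment> \<open>Some block breaks up; a point of it, paired with a point outside its new
        block, is a pair that no longer shares a block.\<close>
      obtain \<beta> where b: "\<beta> \<in> \<phi>" "1 < card \<beta>" using exists_nonsingleton_block[OF less.prems False assms(1)] by blast
      then have "\<beta> \<notin> \<psi>" using psi by (auto simp: splits_def)
      obtain x where x: "x \<in> \<beta>" using b by fastforce
      then have "x \<in> A" using b less.prems unfolding partition_on_def by blast
      then obtain \<mu> where m: "\<mu> \<in> \<psi>" "x \<in> \<mu>" using pp unfolding partition_on_def by blast
      then obtain \<gamma> where g: "\<gamma> \<in> \<phi>" "\<mu> \<subseteq> \<gamma>" using ref unfolding refines_def by blast
      then have "\<gamma> = \<beta>" using partition_on_unique[OF less.prems g(1) b(1)] m x by blast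
      then have "\<mu> \<subseteq> \<beta>" "\<mu> \<noteq> \<beta>" using g(2) m(1) \<open>\<beta> \<notin> \<psi>\<close> by auto
      then obtain y where y: "y \<in> \<beta>" "y \<notin> \<mu>" by auto
      have "(x, y) \<notin> {(i, j). \<exists>\<beta>\<in>\<psi>. i \<in> \<beta> \<and> j \<in> \<beta>}" (is "_ \<notin> ?E")
        using y m partition_on_unique[OF pp] by blast
      moreover have "(x, y) \<in> {(i, j). \<exists>\<beta>\<in>\<phi>. i \<in> \<beta> \<and> j \<in> \<beta>}" (is "_ \<in> ?F")
        using x y b by blast
      moreover have "?E \<subseteq> ?F" using ref unfolding refines_def by blast
      moreover have "z \<notin> S \<Longrightarrow> z \<in> T \<Longrightarrow> S \<subseteq> T \<Longrightarrow> S \<subset> T" for z :: "'a \<times> 'a" and S T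
        by blast
      ultimately have "?E \<subset> ?F" by iprover
      then show "card ?E < card ?F" by (rule psubset_card_mono[OF fin])
    qed
    let ?S = "\<lambda>\<psi>. {\<Phi>. split_chain A (\<psi> # \<Phi>)}"
    have "(\<Sum>\<Phi>\<in>?S \<phi>. chain_weight w (\<phi> # \<Phi>)) = (\<Sum>\<psi>\<in>splits A \<phi>. \<Sum>\<Phi>\<in>(#) \<psi> ` ?S \<psi>. chain_weight w (\<phi> # \<Phi>))"
      unfolding split_chains_step[OF False]
      by (rule sum.UNION_disjoint) (use IH finite_splits[OF assms(1)] in auto)
    also have "\<dots> = (\<Sum>\<psi>\<in>splits A \<phi>. \<Sum>\<Phi>\<in>?S \<psi>. chain_weight w (\<phi> # \<psi> # \<Phi>))"
      by (rule sum.cong[OF refl], subst sum.reindex) auto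
    also have "\<dots> = (\<Sum>\<psi>\<in>splits A \<phi>. (\<Prod>\<beta>\<in>{\<beta>\<in>\<phi>. 1 < card \<beta>}. w \<beta> (card {\<mu>\<in>\<psi>. \<mu> \<subseteq> \<beta>})) * (\<Prod>\<mu>\<in>\<psi>. tree_sum w \<mu>))"
      by (rule sum.cong[OF refl]) (use IH in \<open>simp add: sum_distrib_left[symmetric]\<close>)
    also have "\<dots> = (\<Prod>\<beta>\<in>\<phi>. tree_sum w \<beta>)" by (rule sum_splits[OF assms(1) less.prems])
    finally have "(\<Sum>\<Phi>\<in>?S \<phi>. chain_weight w (\<phi> # \<Phi>)) = (\<Prod>\<beta>\<in>\<phi>. tree_sum w \<beta>)" .
    moreover have "finite (?S \<phi>)" unfolding split_chains_step[OF False]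
      using IH finite_splits[OF assms(1)] by auto
    ultimately show ?thesis by blast
  qed
qed


section \<open>Branches, depths and degrees of reduced chains\<close>

lemma split_chain_iff:
  "split_chain A \<Phi> \<longleftrightarrow> \<Phi> \<noteq> [] \<and> last \<Phi> = (\<lambda>i. {i}) ` A \<and>
    (\<forall>l. Suc l < length \<Phi> \<longrightarrow> \<Phi> ! l \<noteq> (\<lambda>i. {i}) ` A \<and> \<Phi> ! Suc l \<in> splits A (\<Phi> ! l))"
proof (induction A \<Phi> rule: split_chain.induct)
  case (3 A \<phi> \<psi> \<Phi>)
  show ?case unfolding split_chain.simps 3
    by (auto simp: nth_Cons split: nat.splits)
qed auto

lemma chain_weight_nth:
  "chain_weight w \<Phi> = (\<Prod>l<length \<Phi> - 1. \<Prod>\<beta>\<in>{\<beta>\<in>\<Phi> ! l. 1 < card \<beta>}. w \<beta> (card {\<mu>\<in>\<Phi> ! Suc l. \<mu> \<subseteq> \<beta>}))"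
proof (induction w \<Phi> rule: chain_weight.induct)
  case (3 w \<phi> \<psi> \<Phi>)
  then show ?case by (simp add: prod.lessThan_Suc_shift del: prod.lessThan_Suc)
qed auto

lemma splits_refines:
  assumes "\<And>l. Suc l < length \<Phi> \<Longrightarrow> refines A (\<Phi> ! Suc l) (\<Phi> ! l)" "i \<le> j" "j < length \<Phi>" "partition_on A (\<Phi> ! i)"
  shows "refines A (\<Phi> ! j) (\<Phi> ! i)"
  using assms(2,3)
proof (induction j rule: dec_induct)
  case base
  then show ?case by (simp add: refines_refl assms(4))
next
  case (step n)
  then show ?case using assms(1)[of n] refines_trans by (metis Suc_lessD)
qed

text \<open>If a block of level \<open>i\<close> recurred later, the block containing it at level
  \<open>i + 1\<close> would lie in a block of level \<open>i\<close>, which can only be the same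
  one. So it would already be present at level \<open>i + 1\<close>, although it has to split
  there.\<close>

lemma split_chain_disjoint:
  assumes "split_chain A \<Phi>" "partition_on A (hd \<Phi>)" "finite A"
    and "i < length \<Phi>" "j < length \<Phi>" "\<beta> \<in> \<Phi> ! i" "\<beta> \<in> \<Phi> ! j" "1 < card \<beta>"
  shows "i = j"
proof -
  have ref: "refines A (\<Phi> ! Suc l) (\<Phi> ! l)" and spl: "\<Phi> ! Suc l \<in> splits A (\<Phi> ! l)" if "Suc l < length \<Phi>" for l
    using assms(1) that unfolding split_chain_iff splits_def by auto
  have part: "partition_on A (\<Phi> ! l)" if "l < length \<Phi>" for l
    using that ref assms(2) unfolding refines_def by (cases l) (auto simp: hd_conv_nth)
  have "False" if ij: "i < j" "j < length \<Phi>" "\<beta> \<in> \<Phi> ! i" "\<beta> \<in> \<Phi> ! j" for i j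
  proof -
    have "refines A (\<Phi> ! j) (\<Phi> ! Suc i)"
      by (rule splits_refines) (use ref part ij in auto)
    then obtain \<gamma> where g: "\<gamma> \<in> \<Phi> ! Suc i" "\<beta> \<subseteq> \<gamma>" using ij unfolding refines_def by blast
    have "refines A (\<Phi> ! Suc i) (\<Phi> ! i)" using ref ij by auto
    then obtain \<beta>' where b: "\<beta>' \<in> \<Phi> ! i" "\<gamma> \<subseteq> \<beta>'" using g unfolding refines_def by blast
    obtain x where "x \<in> \<beta>" using assms(8) by fastforce
    then have "\<beta>' = \<beta>" using partition_on_unique[of A "\<Phi> ! i" \<beta>' \<beta> x] part[of i] b g ij by auto
    then have "\<beta> = \<gamma>" using b g by blast
    then show False using spl[of i] ij g assms(8) unfolding splits_def by auto
  qed
  then show ?thesis using assms(4-7) by (metis linorder_neqE_nat)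
qed

lemma refines_singletons:
  assumes "refines A \<psi> ((\<lambda>i. {i}) ` A)"
  shows "\<psi> = (\<lambda>i. {i}) ` A"
proof (rule refines_asym[OF assms])
  show "refines A ((\<lambda>i. {i}) ` A) \<psi>"
    using assms unfolding refines_def partition_on_def by blast
qed

lemma full_neq_singletons:
  assumes "2 \<le> (N::nat)"
  shows "{{1..N}} \<noteq> (\<lambda>i. {i}) ` {1..N}"
proof
  assume "{{1..N}} = (\<lambda>i. {i}) ` {1..N}"
  then have "card {{1..N}} = card {1..N}" by (metis card_image inj_singleton inj_on_subset subset_UNIV)
  then show False using assms by simp
qed

context
  fixes N :: nat and \<Phi> :: "nat set set list"
  assumes N: "2 \<le> N" and split: "split_chain {1..N} \<Phi>" and hd: "hd \<Phi> = {{1..N}}"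
begin

lemma split_chain_length: "2 \<le> length \<Phi>"
proof (rule ccontr)
  assume "\<not> 2 \<le> length \<Phi>"
  moreover have "\<Phi> \<noteq> []" using split by auto
  ultimately obtain \<phi> where "\<Phi> = [\<phi>]" by (cases \<Phi>; cases "tl \<Phi>") auto
  then have "{{1..N}} = (\<lambda>i. {i}) ` {1..N}" using split hd by simp
  then show False using full_neq_singletons[OF N] by contradiction
qed

lemma split_chain_nth_0: "\<Phi> ! 0 = {{1..N}}"
  using hd split_chain_length by (cases \<Phi>) auto

lemma split_chain_partition: "l < length \<Phi> \<Longrightarrow> partition_on {1..N} (\<Phi> ! l)"
proof (cases l)
  case 0
  then have "\<Phi> ! l = {{1..N}}" using split_chain_nth_0 by simp
  then show ?thesis using N partition_on_space[of "{1..N}"] by simp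
next
  case (Suc k)
  assume "l < length \<Phi>"
  then show ?thesis using split Suc unfolding split_chain_iff splits_def refines_def by auto
qed

lemma split_chain_branches:
  "branches \<Phi> = (\<Union>l<length \<Phi> - 1. {\<beta>\<in>\<Phi> ! l. 1 < card \<beta>})"
proof -
  have block: "\<beta> \<notin> (\<lambda>i. {i}) ` {1..N} \<longleftrightarrow> 1 < card \<beta>" if "l < length \<Phi>" "\<beta> \<in> \<Phi> ! l" for \<beta> l
  proof -
    have "\<beta> \<subseteq> {1..N}" "\<beta> \<noteq> {}" using split_chain_partition[OF that(1)] that(2) unfolding partition_on_def by blast+
    moreover have "card \<beta> \<noteq> 0" using calculation finite_subset by fastforce
    moreover have "card \<beta> = 1 \<longleftrightarrow> \<beta> \<in> (\<lambda>i. {i}) ` {1..N}"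
      using calculation(1) by (auto simp: card_1_singleton_iff)
    ultimately show ?thesis by linarith
  qed
  have "last \<Phi> = (\<lambda>i. {i}) ` {1..N}" using split unfolding split_chain_iff by blast
  moreover have "\<Union> (set (butlast \<Phi>)) = (\<Union>l<length \<Phi> - 1. \<Phi> ! l)"
    by (force simp: set_conv_nth nth_butlast)
  ultimately have *: "branches \<Phi> = (\<Union>l<length \<Phi> - 1. \<Phi> ! l) - (\<lambda>i. {i}) ` {1..N}"
    by (simp only: branches_def)
  have "\<Phi> ! l - (\<lambda>i. {i}) ` {1..N} = {\<beta>\<in>\<Phi> ! l. 1 < card \<beta>}" if "l < length \<Phi> - 1" for l
    using block[of l] that by (simp only: set_diff_eq) (rule Collect_cong, auto)
  then have "(\<Union>l<length \<Phi> - 1. \<Phi> ! l - (\<lambda>i. {i}) ` {1..N}) = (\<Union>l<length \<Phi> - 1. {\<beta>\<in>\<Phi> ! l. 1 < card \<beta>})"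
    by (intro SUP_cong) auto
  then show ?thesis unfolding * by (simp only: UN_extend_simps)
qed

lemma split_chain_depth:
  assumes "l < length \<Phi>" "\<beta> \<in> \<Phi> ! l" "1 < card \<beta>"
  shows "depth \<Phi> \<beta> = l"
proof -
  have part: "partition_on {1..N} (hd \<Phi>)" unfolding hd using N by (intro partition_on_space) auto
  have "{k. k < length \<Phi> \<and> \<beta> \<in> \<Phi> ! k} = {l}"
    using split_chain_disjoint[OF split part _ _ _ _ _ assms(3)] assms by auto
  then show ?thesis by (simp add: depth_def)
qed

lemma split_chain_reduced: "\<Phi> \<in> reduced_chains N"
proof -
  have ne: "\<Phi> ! Suc l \<noteq> \<Phi> ! l" if l: "Suc l < length \<Phi>" for l
  proof
    assume eq: "\<Phi> ! Suc l = \<Phi> ! l"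
    have "\<Phi> ! l \<noteq> (\<lambda>i. {i}) ` {1..N}" using split l unfolding split_chain_iff by blast
    then obtain \<beta> where "\<beta> \<in> \<Phi> ! l" "1 < card \<beta>"
      using exists_nonsingleton_block[OF split_chain_partition[of l]] l by auto
    moreover have "\<Phi> ! Suc l \<in> splits {1..N} (\<Phi> ! l)" using split l unfolding split_chain_iff by blast
    ultimately show False using eq unfolding splits_def by auto
  qed
  have "splitting_chain N \<Phi>"
    unfolding splitting_chain_def
    using split_chain_length hd split ne unfolding split_chain_iff splits_def by auto
  moreover have "reduced \<Phi>"
    unfolding reduced_def split_chain_branches using split_chain_depth
    by (metis (no_types, lifting) UN_E lessThan_iff less_diff_conv mem_Collect_eq add_lessD1)
  ultimately show ?thesis by (simp add: reduced_chains_def)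
qed

lemma split_chain_deg:
  assumes "l < length \<Phi>" "\<beta> \<in> \<Phi> ! l" "1 < card \<beta>"
  shows "chain_deg \<Phi> \<beta> = card {\<mu>\<in>\<Phi> ! Suc l. \<mu> \<subseteq> \<beta>}"
  by (simp add: chain_deg_def split_chain_depth[OF assms])

text \<open>\<open>[N]\<close> occurs at level 0 only and every other branch at exactly one later
  level, so leaving out \<open>[N]\<close> amounts to dropping the head of the chain. It is left out
  because its factor in the formula has a different shape.\<close>

lemma prod_branches:
  "(\<Prod>\<beta>\<in>branches \<Phi> - {{1..N}}. w \<beta> (chain_deg \<Phi> \<beta>)) = chain_weight w (tl \<Phi>)"
proof -
  define L where "L = length \<Phi> - 2"
  have len: "length \<Phi> = Suc (Suc L)" using split_chain_length by (simp add: L_def)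
  note h0 = split_chain_nth_0
  have tl: "tl \<Phi> ! l = \<Phi> ! Suc l" if "l < Suc L" for l using that len by (simp add: nth_tl)
  let ?b = "\<lambda>l. {\<beta>\<in>\<Phi> ! l. 1 < card \<beta>}"
  have disj: "?b i \<inter> ?b j = {}" if "i < length \<Phi>" "j < length \<Phi>" "i \<noteq> j" for i j
    using split_chain_depth[OF that(1)] split_chain_depth[OF that(2)] that(3) by blast
  have full: "{{1..N}} = ?b 0" unfolding h0 using N by auto
  have br: "branches \<Phi> = ?b 0 \<union> (\<Union>l<L. ?b (Suc l))"
    unfolding split_chain_branches len by (auto simp: lessThan_Suc_eq_insert_0)
  have d0: "?b 0 \<inter> ?b (Suc l) = {}" if "l < L" for l using disj[of 0 "Suc l"] len that by simp
  have "?b (Suc l) - ?b 0 = ?b (Suc l)" if "l < L" for l using d0[OF that] by blast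
  then have "(\<Union>l<L. ?b (Suc l) - ?b 0) = (\<Union>l<L. ?b (Suc l))" by (intro SUP_cong) auto
  then have "branches \<Phi> - {{1..N}} = (\<Union>l<L. ?b (Suc l))"
    unfolding full br Un_Diff Diff_cancel Un_empty_left by (simp only: UN_simps)
  then have "(\<Prod>\<beta>\<in>branches \<Phi> - {{1..N}}. w \<beta> (chain_deg \<Phi> \<beta>)) = (\<Prod>\<beta>\<in>(\<Union>l<L. ?b (Suc l)). w \<beta> (chain_deg \<Phi> \<beta>))"
    by simp
  also have "\<dots> = (\<Prod>l<L. \<Prod>\<beta>\<in>?b (Suc l). w \<beta> (chain_deg \<Phi> \<beta>))"
  proof (rule prod.UNION_disjoint)
    show "\<forall>i\<in>{..<L}. finite (?b (Suc i))"
      using finite_elements[OF _ split_chain_partition] len by auto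
    show "\<forall>i\<in>{..<L}. \<forall>j\<in>{..<L}. i \<noteq> j \<longrightarrow> ?b (Suc i) \<inter> ?b (Suc j) = {}"
      by (intro ballI impI disj) (auto simp: len)
  qed simp
  also have "\<dots> = chain_weight w (tl \<Phi>)"
    unfolding chain_weight_nth
  proof (rule prod.cong)
    fix l assume "l \<in> {..<length (tl \<Phi>) - 1}"
    then have l: "l < L" using len by simp
    show "(\<Prod>\<beta>\<in>?b (Suc l). w \<beta> (chain_deg \<Phi> \<beta>)) =
        (\<Prod>\<beta>\<in>{\<beta>\<in>tl \<Phi> ! l. 1 < card \<beta>}. w \<beta> (card {\<mu>\<in>tl \<Phi> ! Suc l. \<mu> \<subseteq> \<beta>}))"
      using l tl[of l] tl[of "Suc l"] split_chain_deg[of "Suc l"] len by (intro prod.cong) auto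
  qed (simp add: len)
  finally show ?thesis .
qed

lemma split_chain_full_deg: "chain_deg \<Phi> {1..N} = card (\<Phi> ! 1)"
proof -
  have "chain_deg \<Phi> {1..N} = card {\<mu>\<in>\<Phi> ! Suc 0. \<mu> \<subseteq> {1..N}}"
    by (rule split_chain_deg) (use split_chain_length split_chain_nth_0 N in auto)
  also have "{\<mu>\<in>\<Phi> ! Suc 0. \<mu> \<subseteq> {1..N}} = \<Phi> ! 1"
    using split_chain_partition[of 1] split_chain_length unfolding partition_on_def by auto
  finally show ?thesis .
qed

end

text \<open>A non-singleton block kept in one step would be a branch at two levels, which
  reducedness forbids; conversely, if all such blocks split at each step, every branch has a single
  level. The partition into singletons cannot occur before the end, since it has no proper
  refinement.\<close>

lemma reduced_chains_eq:
  assumes "2 \<le> N"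
  shows "reduced_chains N = (#) {{1..N}} ` {\<Phi>. split_chain {1..N} ({{1..N}} # \<Phi>)}"
proof (intro equalityI subsetI)
  fix \<Phi> assume "\<Phi> \<in> (#) {{1..N}} ` {\<Phi>. split_chain {1..N} ({{1..N}} # \<Phi>)}"
  then show "\<Phi> \<in> reduced_chains N" using split_chain_reduced[OF assms, of \<Phi>] by auto
next
  fix \<Phi> assume "\<Phi> \<in> reduced_chains N"
  then have sc: "splitting_chain N \<Phi>" and red: "reduced \<Phi>" by (auto simp: reduced_chains_def)
  have len: "2 \<le> length \<Phi>" and last: "last \<Phi> = (\<lambda>i. {i}) ` {1..N}" and hd: "hd \<Phi> = {{1..N}}"
    using sc by (auto simp: splitting_chain_def)
  have "split_chain {1..N} \<Phi>"
    unfolding split_chain_iff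
  proof (intro conjI allI impI last)
    show "\<Phi> \<noteq> []" using len by auto
    fix l assume l: "Suc l < length \<Phi>"
    then have ref: "refines {1..N} (\<Phi> ! Suc l) (\<Phi> ! l)" and ne: "\<Phi> ! Suc l \<noteq> \<Phi> ! l"
      using sc by (auto simp: splitting_chain_def)
    show "\<Phi> ! l \<noteq> (\<lambda>i. {i}) ` {1..N}" using ref ne refines_singletons by metis
    have "\<beta> \<notin> \<Phi> ! Suc l" if b: "\<beta> \<in> \<Phi> ! l" "1 < card \<beta>" for \<beta>
    proof
      assume b': "\<beta> \<in> \<Phi> ! Suc l"
      have "\<Phi> ! l \<in> set (butlast \<Phi>)" using l by (metis Suc_lessE diff_Suc_1 length_butlast nth_butlast nth_mem)
      moreover have "\<beta> \<notin> last \<Phi>" unfolding last using b(2) by auto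
      ultimately have "\<beta> \<in> branches \<Phi>" unfolding branches_def using b(1) by blast
      then have "l = depth \<Phi> \<beta>" "Suc l = depth \<Phi> \<beta>"
        using red l b b' unfolding reduced_def by auto
      then show False by simp
    qed
    then show "\<Phi> ! Suc l \<in> splits {1..N} (\<Phi> ! l)" using ref unfolding splits_def by auto
  qed
  moreover have "\<Phi> = {{1..N}} # tl \<Phi>" using len hd by (metis length_0_conv list.exhaust_sel not_numeral_le_zero)
  ultimately show "\<Phi> \<in> (#) {{1..N}} ` {\<Phi>. split_chain {1..N} ({{1..N}} # \<Phi>)}"
    by (metis image_eqI mem_Collect_eq)
qed

text \<open>Splitting off the first step leaves a sum over the partitions of \<open>[N]\<close> into
  at least two blocks, below which \<open>sum_split_chains\<close> applies. The root has its own
  function \<open>F\<close> of the degree, as its factor is not of the form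
  \<open>w\<close>.\<close>

lemma sum_reduced_chains:
  fixes F :: "nat \<Rightarrow> 'c::comm_semiring_1"
  assumes "2 \<le> N"
  shows "finite (reduced_chains N)" and
    "(\<Sum>\<Phi>\<in>reduced_chains N. F (chain_deg \<Phi> {1..N}) * (\<Prod>\<beta>\<in>branches \<Phi> - {{1..N}}. w \<beta> (chain_deg \<Phi> \<beta>))) =
      (\<Sum>\<pi>\<in>{\<pi>. partition_on {1..N} \<pi> \<and> 2 \<le> card \<pi>}. F (card \<pi>) * (\<Prod>\<mu>\<in>\<pi>. tree_sum w \<mu>))"
    (is "?L = ?R")
proof -
  let ?A = "{1..N}"
  let ?S = "\<lambda>\<psi>. {\<Phi>. split_chain ?A (\<psi> # \<Phi>)}"
  have part: "partition_on ?A {?A}" using assms by (intro partition_on_space) auto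
  show "finite (reduced_chains N)" unfolding reduced_chains_eq[OF assms]
    using sum_split_chains[OF _ part] by auto
  note ne = full_neq_singletons[OF assms]
  have spl: "splits ?A {?A} = {\<pi>. partition_on ?A \<pi> \<and> 2 \<le> card \<pi>}"
  proof (intro equalityI subsetI)
    fix \<pi> assume "\<pi> \<in> splits ?A {?A}"
    then have p: "partition_on ?A \<pi>" "?A \<notin> \<pi>" using assms by (auto simp: splits_def refines_def)
    then have un: "\<Union>\<pi> = ?A" by (simp add: partition_on_def)
    have "finite \<pi>" using p(1) by (rule finite_elements[rotated]) simp
    then have "card \<pi> \<noteq> 0" "card \<pi> \<noteq> 1" using un assms p(2) by (auto simp: card_1_singleton_iff)
    then show "\<pi> \<in> {\<pi>. partition_on ?A \<pi> \<and> 2 \<le> card \<pi>}" using p by simp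
  next
    fix \<pi> assume p: "\<pi> \<in> {\<pi>. partition_on ?A \<pi> \<and> 2 \<le> card \<pi>}"
    then have "?A \<notin> \<pi>" using card_block_less[of ?A \<pi> ?A] by auto
    moreover have "\<forall>X\<in>\<pi>. X \<subseteq> ?A" using p unfolding partition_on_def by auto
    ultimately show "\<pi> \<in> splits ?A {?A}" using p part unfolding splits_def refines_def by auto
  qed
  have "?L =
     (\<Sum>\<Phi>\<in>reduced_chains N. F (card (\<Phi> ! 1)) * chain_weight w (tl \<Phi>))"
  proof (rule sum.cong[OF refl])
    fix \<Phi> assume "\<Phi> \<in> reduced_chains N"
    then have sc: "split_chain {1..N} \<Phi>" "hd \<Phi> = {{1..N}}" unfolding reduced_chains_eq[OF assms] by auto
    then show "F (chain_deg \<Phi> {1..N}) * (\<Prod>\<beta>\<in>branches \<Phi> - {{1..N}}. w \<beta> (chain_deg \<Phi> \<beta>)) = F (card (\<Phi> ! 1)) * chain_weight w (tl \<Phi>)"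
      by (simp only: split_chain_full_deg[OF assms sc] prod_branches[OF assms sc, of w])
  qed
  also have "\<dots> = (\<Sum>\<Phi>\<in>?S {?A}. F (card (\<Phi> ! 0)) * chain_weight w \<Phi>)"
    unfolding reduced_chains_eq[OF assms] by (subst sum.reindex) auto
  also have "\<dots> = (\<Sum>\<psi>\<in>splits ?A {?A}. \<Sum>\<Phi>\<in>(#) \<psi> ` ?S \<psi>. F (card (\<Phi> ! 0)) * chain_weight w \<Phi>)"
    unfolding split_chains_step[OF ne]
  proof (rule sum.UNION_disjoint)
    show "\<forall>\<psi>\<in>splits ?A {?A}. finite ((#) \<psi> ` ?S \<psi>)"
      using sum_split_chains[of ?A] unfolding splits_def refines_def by auto
  qed (auto simp: finite_splits)
  also have "\<dots> = (\<Sum>\<psi>\<in>splits ?A {?A}. F (card \<psi>) * (\<Sum>\<Phi>\<in>?S \<psi>. chain_weight w (\<psi> # \<Phi>)))"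
    by (rule sum.cong[OF refl], subst sum.reindex) (auto simp: sum_distrib_left)
  also have "\<dots> = (\<Sum>\<psi>\<in>splits ?A {?A}. F (card \<psi>) * (\<Prod>\<mu>\<in>\<psi>. tree_sum w \<mu>))"
  proof (rule sum.cong[OF refl])
    fix \<psi> assume "\<psi> \<in> splits ?A {?A}"
    then have "partition_on ?A \<psi>" by (simp add: splits_def refines_def)
    then have "(\<Sum>\<Phi>\<in>?S \<psi>. chain_weight w (\<psi> # \<Phi>)) = (\<Prod>\<mu>\<in>\<psi>. tree_sum w \<mu>)"
      using sum_split_chains[of ?A \<psi> w] by simp
    then show "F (card \<psi>) * (\<Sum>\<Phi>\<in>?S \<psi>. chain_weight w (\<psi> # \<Phi>)) = F (card \<psi>) * (\<Prod>\<mu>\<in>\<psi>. tree_sum w \<mu>)"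
      by (simp only:)
  qed
  finally show "?L = ?R"
    unfolding spl .
qed

subsection \<open>Exponents and tree weights\<close>

lemma finite_pairs [simp]: "finite I \<Longrightarrow> finite (pairs I)"
  by (rule finite_subset[of _ "I \<times> I"]) (auto simp: pairs_def)

text \<open>When the blocks sit in different children of one ball, these are the pairs whose
  distance is known.\<close>

definition cross_pairs :: "nat set \<Rightarrow> nat set set \<Rightarrow> (nat \<times> nat) set" where
  "cross_pairs I \<pi> = pairs I - (\<Union>\<mu>\<in>\<pi>. pairs \<mu>)"

text \<open>Stated for an arbitrary commutative monoid because it is used twice: additively for the
  exponents \<open>esum\<close> and multiplicatively for the kernels.\<close>

lemma (in comm_monoid_set) pairs_partition:
  assumes "finite I" "partition_on I \<pi>"
  shows "F h (pairs I) = F (\<lambda>\<mu>. F h (pairs \<mu>)) \<pi> \<^bold>* F h (cross_pairs I \<pi>)"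
proof -
  have sub: "\<mu> \<subseteq> I" if "\<mu> \<in> \<pi>" for \<mu> using assms(2) that unfolding partition_on_def by blast
  have "(\<Union>\<mu>\<in>\<pi>. pairs \<mu>) \<subseteq> pairs I" using sub by (auto simp: pairs_def)
  then have "F h (pairs I) = F h (pairs I - (\<Union>\<mu>\<in>\<pi>. pairs \<mu>)) \<^bold>* F h (\<Union>\<mu>\<in>\<pi>. pairs \<mu>)"
    by (rule subset_diff) (use assms(1) in simp)
  also have "F h (\<Union>\<mu>\<in>\<pi>. pairs \<mu>) = F (\<lambda>\<mu>. F h (pairs \<mu>)) \<pi>"
  proof (rule UNION_disjoint)
    show "finite \<pi>" using assms by (rule finite_elements)
    show "\<forall>i\<in>\<pi>. finite (pairs i)" using finite_subset[OF sub assms(1)] by simp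
    show "\<forall>i\<in>\<pi>. \<forall>j\<in>\<pi>. i \<noteq> j \<longrightarrow> pairs i \<inter> pairs j = {}"
      using partition_on_unique[OF assms(2)] by (auto simp: pairs_def)
  qed
  finally show ?thesis by (simp add: cross_pairs_def commute)
qed

definition esum :: "(nat \<Rightarrow> nat \<Rightarrow> complex) \<Rightarrow> nat set \<Rightarrow> complex" where
  "esum s I = (\<Sum>(i, j)\<in>pairs I. s i j)"

lemma expo_esum: "expo I s = of_nat (card I) - 1 + esum s I"
  by (simp add: expo_def esum_def)

text \<open>The kernel for these exponents is the norm of the kernel for \<open>s\<close> (see
  \<open>norm_kern\<close>), and the conditions on the exponents only see real parts. Evaluations
  for \<open>re_part s\<close> therefore bear on absolute convergence.\<close>

definition re_part :: "(nat \<Rightarrow> nat \<Rightarrow> complex) \<Rightarrow> nat \<Rightarrow> nat \<Rightarrow> complex" where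
  "re_part s i j = complex_of_real (Re (s i j))"

lemma esum_re_part: "esum (re_part s) I = of_real (Re (esum s I))"
  by (simp add: esum_def re_part_def case_prod_beta Re_sum)

lemma expo_re_part: "expo I (re_part s) = of_real (Re (expo I s))"
  by (simp add: expo_esum esum_re_part)

context
  fixes q :: nat
  assumes q: "2 \<le> q"
begin

lemma powr_q: "of_nat q powr (z::complex) = exp (z * of_real (ln (real q)))"
  using Ln_of_real[of "real q"] q by (simp add: powr_def)

lemma q_pos: "0 < q" using q by simp

lemma powr_q_add: "of_nat q powr (a + b) = of_nat q powr a * (of_nat q powr b :: complex)"
  by (simp add: powr_q exp_add ring_distribs)

lemma powr_q_minus: "of_nat q powr (- a) = inverse (of_nat q powr a :: complex)"
  by (simp add: powr_q exp_minus)

lemma powr_q_0: "of_nat q powr 0 = (1 :: complex)"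
  using q_pos by (simp add: powr_q)

lemma powr_q_1: "of_nat q powr 1 = (of_nat q :: complex)"
  using q_pos by (simp add: powr_q exp_of_real)

lemma powr_q_nonzero: "of_nat q powr a \<noteq> (0 :: complex)"
  using q_pos by (simp add: powr_q)

lemma powr_q_sum: "finite A \<Longrightarrow> of_nat q powr (\<Sum>x\<in>A. f x) = (\<Prod>x\<in>A. of_nat q powr f x :: complex)"
  by (induction A rule: finite_induct) (use q_pos in \<open>simp_all add: powr_q_0 powr_q_add\<close>)

lemma powr_q_of_nat_mult: "of_nat q powr (of_nat n * a) = (of_nat q powr a :: complex) ^ n"
  using q_pos by (induction n) (simp_all add: powr_q_0 powr_q_add ring_distribs)

lemma norm_powr_q: "norm (of_nat q powr a :: complex) = real q powr Re a"
  using q_pos by (simp add: powr_q powr_def)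

lemma powr_q_of_real: "of_nat q powr complex_of_real r = complex_of_real (real q powr r)"
proof -
  have "of_nat q powr complex_of_real r = exp (of_real (r * ln (real q)))" by (simp add: powr_q)
  also have "\<dots> = complex_of_real (real q powr r)" using q_pos by (simp only: exp_of_real) (simp add: powr_def)
  finally show ?thesis .
qed

lemma inverse_q_powr: "complex_of_real (1 / real q ^ k) powr z = of_nat q powr (- of_nat k * z)"
proof -
  have "ln (1 / real q ^ k) = - real k * ln (real q)" using q_pos by (simp add: ln_div ln_realpow)
  moreover have "0 < 1 / real q ^ k" using q by simp
  ultimately have "Ln (complex_of_real (1 / real q ^ k)) = - of_nat k * of_real (ln (real q))"
    by (subst Ln_of_real) auto
  moreover have "complex_of_real (1 / real q ^ k) \<noteq> 0" using q_pos by simp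
  ultimately have "complex_of_real (1 / real q ^ k) powr z = exp (z * (- of_nat k * of_real (ln (real q))))"
    by (simp only: powr_def if_False)
  then show ?thesis unfolding powr_q by (simp only: mult_ac minus_mult_left minus_mult_right)
qed

lemma powr_q_neq_1:
  assumes "0 < Re a"
  shows "of_nat q powr a \<noteq> (1 :: complex)"
proof
  assume "of_nat q powr a = (1 :: complex)"
  then have "real q powr Re a = 1" using norm_powr_q[of a] by simp
  then show False using assms q by simp
qed

lemma norm_powr_q_less_1: "0 < Re a \<Longrightarrow> norm (of_nat q powr (- a) :: complex) < 1"
  using q powr_less_cancel_iff[of "real q" "- Re a" 0] by (simp only: norm_powr_q uminus_complex.sel) simp

lemma norm_powr_q_ge_1: "Re a \<le> 0 \<Longrightarrow> 1 \<le> real q powr (- Re a)"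
  using q by (simp add: ge_one_powr_ge_zero)

definition tree_weight :: "(nat \<Rightarrow> nat \<Rightarrow> complex) \<Rightarrow> nat set \<Rightarrow> nat \<Rightarrow> complex" where
  "tree_weight s I d = falling (of_nat q - 1) (d - 1) / (of_nat q powr expo I s - 1)"

definition tree_val :: "(nat \<Rightarrow> nat \<Rightarrow> complex) \<Rightarrow> nat set \<Rightarrow> complex" where
  "tree_val s = tree_sum (tree_weight s)"

text \<open>Up to scaling, the integral over the tuples in a ball that occupy at least two of its
  \<open>q\<close> children: \<open>(q)_d\<close> counts the placements of \<open>d\<close> blocks
  into distinct children, and each block contributes its own value.\<close>

definition split_val :: "(nat \<Rightarrow> nat \<Rightarrow> complex) \<Rightarrow> nat set \<Rightarrow> complex" where
  "split_val s I = (\<Sum>\<pi>\<in>{\<pi>. partition_on I \<pi> \<and> 2 \<le> card \<pi>}. of_nat (\<Prod>k<card \<pi>. q - k) * (\<Prod>\<mu>\<in>\<pi>. tree_val s \<mu>))"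

text \<open>For \<open>d > n\<close> both sides contain the factor \<open>n - n\<close>, so the
  truncated subtraction on the left does no harm.\<close>

lemma of_nat_prod_diff: "of_nat (\<Prod>k<d. n - k) = falling (of_nat n) d"
proof (cases "d \<le> n")
  case True
  then show ?thesis by (simp add: falling_def of_nat_diff)
next
  case False
  then have "(\<Prod>k<d. n - k) = 0" by (auto intro!: bexI[of _ n])
  moreover have "falling (of_nat n) d = 0" using False by (auto simp: falling_def intro!: bexI[of _ n])
  ultimately show ?thesis by (simp only: of_nat_0)
qed

lemma falling_Suc: "falling z (Suc n) = z * falling (z - 1) n"
  unfolding falling_def by (subst prod.lessThan_Suc_shift) (simp add: algebra_simps)

text \<open>Since \<open>(q)_d = q (q - 1)_(d-1)\<close>, the coefficient of each partition is
  \<open>q (q^e - 1)\<close> times the tree weight. The factor \<open>q^e - 1\<close> is later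
  cancelled by the sum of the geometric series in \<open>good_step\<close>.\<close>

lemma split_val_eq:
  assumes "finite I" "2 \<le> card I" "of_nat q powr expo I s \<noteq> (1 :: complex)"
  shows "split_val s I = of_nat q * (of_nat q powr expo I s - 1) * tree_val s I"
proof -
  have "split_val s I = (\<Sum>\<pi>\<in>{\<pi>. partition_on I \<pi> \<and> 2 \<le> card \<pi>}.
      of_nat q * (of_nat q powr expo I s - 1) * (tree_weight s I (card \<pi>) * (\<Prod>\<mu>\<in>\<pi>. tree_val s \<mu>)))"
    unfolding split_val_def
  proof (rule sum.cong[OF refl])
    fix \<pi> assume "\<pi> \<in> {\<pi>. partition_on I \<pi> \<and> 2 \<le> card \<pi>}"
    then obtain d where d: "card \<pi> = Suc d" by (cases "card \<pi>") auto
    show "of_nat (\<Prod>k<card \<pi>. q - k) * (\<Prod>\<mu>\<in>\<pi>. tree_val s \<mu>) =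
      of_nat q * (of_nat q powr expo I s - 1) * (tree_weight s I (card \<pi>) * (\<Prod>\<mu>\<in>\<pi>. tree_val s \<mu>))"
      unfolding of_nat_prod_diff tree_weight_def d falling_Suc using assms(3) by simp
  qed
  also have "\<dots> = of_nat q * (of_nat q powr expo I s - 1) * tree_val s I"
    using assms(2) unfolding sum_distrib_left[symmetric] tree_val_def
    by (subst tree_sum.simps) simp
  finally show ?thesis .
qed

text \<open>The hypothesis concerns proper subsets only, so that the lemma also covers a set with
  \<open>Re e \<le> 0\<close> that is minimal with this property.\<close>

lemma split_val_pos:
  assumes "finite I" "2 \<le> card I" "\<And>\<mu>. \<mu> \<subset> I \<Longrightarrow> \<mu> \<noteq> {} \<Longrightarrow> \<exists>r>0. tree_val s \<mu> = of_real r"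
  shows "\<exists>r>0. split_val s I = complex_of_real r"
proof -
  let ?P = "{\<pi>. partition_on I \<pi> \<and> 2 \<le> card \<pi>}"
  have "\<forall>\<mu>. \<exists>r. \<mu> \<subset> I \<and> \<mu> \<noteq> {} \<longrightarrow> r > 0 \<and> tree_val s \<mu> = complex_of_real r" using assms(3) by blast
  then obtain r where r: "\<And>\<mu>. \<mu> \<subset> I \<Longrightarrow> \<mu> \<noteq> {} \<Longrightarrow> r \<mu> > 0 \<and> tree_val s \<mu> = complex_of_real (r \<mu>)" by metis
  have proper: "\<mu> \<subset> I \<and> \<mu> \<noteq> {}" if "\<pi> \<in> ?P" "\<mu> \<in> \<pi>" for \<pi> \<mu>
  proof -
    have "card \<mu> < card I" by (rule card_block_less[of I \<pi>]) (use that assms(1) in auto)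
    moreover have "\<mu> \<subseteq> I" "\<mu> \<noteq> {}" using that unfolding partition_on_def by auto
    ultimately show ?thesis by auto
  qed
  have eq: "split_val s I = of_real (\<Sum>\<pi>\<in>?P. real (\<Prod>k<card \<pi>. q - k) * (\<Prod>\<mu>\<in>\<pi>. r \<mu>))"
    unfolding split_val_def of_real_sum of_real_mult of_real_prod of_real_of_nat_eq
  proof (rule sum.cong[OF refl])
    fix \<pi> assume "\<pi> \<in> ?P"
    then have "(\<Prod>\<mu>\<in>\<pi>. tree_val s \<mu>) = (\<Prod>\<mu>\<in>\<pi>. complex_of_real (r \<mu>))"
      using proper r by (intro prod.cong refl) blast
    then show "of_nat (\<Prod>k<card \<pi>. q - k) * (\<Prod>\<mu>\<in>\<pi>. tree_val s \<mu>) = of_nat (\<Prod>k<card \<pi>. q - k) * (\<Prod>\<mu>\<in>\<pi>. complex_of_real (r \<mu>))"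
      by (simp only:)
  qed
  have fin: "finite ?P" using finitely_many_partition_on[OF assms(1)] by (rule rev_finite_subset) auto
  obtain i where i: "i \<in> I" using assms(2) by fastforce
  have ne: "I - {i} \<noteq> {}" proof
    assume "I - {i} = {}"
    then have "I = {i}" using i by blast
    then have "card I = 1" by simp
    then show False using assms(2) by simp
  qed
  \<comment> \<open>One term must be strictly positive. A two-block partition is chosen because
    \<open>q\<close> may be 2, in which case partitions into more blocks have coefficient 0.\<close>
  have p0: "partition_on I {{i}, I - {i}}" using i ne by (intro partition_onI) (auto simp: disjnt_def)
  have "{i} \<noteq> I - {i}" by blast
  then have c0: "card {{i}, I - {i}} = 2" by simp
  have "0 < (\<Sum>\<pi>\<in>?P. real (\<Prod>k<card \<pi>. q - k) * (\<Prod>\<mu>\<in>\<pi>. r \<mu>))"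
  proof (rule sum_pos2[OF fin])
    show "{{i}, I - {i}} \<in> ?P" using p0 c0 by simp
    then have "0 < (\<Prod>\<mu>\<in>{{i}, I - {i}}. r \<mu>)" using proper r by (intro prod_pos) blast
    moreover have "0 < real (\<Prod>k<2. q - k)" using q by (simp add: numeral_2_eq_2)
    ultimately show "0 < real (\<Prod>k<card {{i}, I - {i}}. q - k) * (\<Prod>\<mu>\<in>{{i}, I - {i}}. r \<mu>)"
      unfolding c0 by (rule mult_pos_pos[rotated])
    show "0 \<le> real (\<Prod>k<card \<pi>. q - k) * (\<Prod>\<mu>\<in>\<pi>. r \<mu>)" if "\<pi> \<in> ?P" for \<pi>
    proof (rule mult_nonneg_nonneg[OF of_nat_0_le_iff], rule prod_nonneg)
      show "0 \<le> r \<mu>" if "\<mu> \<in> \<pi>" for \<mu> using proper[OF \<open>\<pi> \<in> ?P\<close> that] r by (simp add: less_imp_le)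
    qed
  qed
  then show ?thesis using eq by blast
qed

text \<open>By \<open>split_val_eq\<close> the tree value is \<open>split_val\<close> divided by
  \<open>q (q^e - 1)\<close>, and both are positive for real exponents in the convergent
  range.\<close>

lemma tree_val_pos:
  assumes "finite I" "I \<noteq> {}" "\<And>\<mu>. \<mu> \<subseteq> I \<Longrightarrow> 1 < card \<mu> \<Longrightarrow> 0 < Re (expo \<mu> s)"
  shows "\<exists>r>0. tree_val (re_part s) I = complex_of_real r"
  using assms
proof (induction I rule: finite_psubset_induct)
  case (psubset I)
  show ?case
  proof (cases "card I \<le> 1")
    case True
    moreover have "card I \<noteq> 0" using psubset by simp
    ultimately have "card I = 1" by linarith
    then show ?thesis by (auto simp: tree_val_def tree_sum_singleton intro!: exI[of _ 1])
  next
    case False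
    have e: "0 < Re (expo I s)" using psubset.prems(2)[of I] False by simp
    obtain r where r: "r > 0" "split_val (re_part s) I = complex_of_real r"
    proof -
      have "\<exists>r>0. tree_val (re_part s) \<mu> = complex_of_real r" if "\<mu> \<subset> I" "\<mu> \<noteq> {}" for \<mu>
        using psubset.IH[OF that] psubset.prems(2) that(1) by (meson order.trans psubset_imp_subset)
      then have "\<exists>r>0. split_val (re_part s) I = complex_of_real r"
        using False by (intro split_val_pos[OF psubset.hyps]) auto
      then show ?thesis using that by blast
    qed
    have ne: "of_nat q powr expo I (re_part s) \<noteq> (1 :: complex)"
      using powr_q_neq_1[of "expo I (re_part s)"] e by (simp add: expo_re_part)
    have E: "of_nat q powr expo I (re_part s) = complex_of_real (real q powr Re (expo I s))"
      by (simp add: expo_re_part powr_q_of_real)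
    have gt: "1 < real q powr Re (expo I s)" using e q by simp
    have "of_nat q * (of_nat q powr expo I (re_part s) - 1) * tree_val (re_part s) I = complex_of_real r"
      using split_val_eq[OF psubset.hyps _ ne] False r(2) by simp
    then have "tree_val (re_part s) I = complex_of_real (r / (real q * (real q powr Re (expo I s) - 1)))"
      using ne q unfolding E by (simp add: field_simps)
    moreover have "0 < r / (real q * (real q powr Re (expo I s) - 1))" using r gt q by simp
    ultimately show ?thesis by blast
  qed
qed

end

subsection \<open>Trees of balls\<close>

text \<open>\<open>U k\<close> holds the balls of level \<open>k\<close>. The value of
  \<open>\<delta>\<close> is prescribed by the last level at which two points share a ball, and
  \<open>\<delta>_0\<close> covers points that are never separated. \<open>measure_ball\<close>
  starts at level 1 because the root has measure 1 and \<open>q + 1\<close> children.\<close>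

locale ball_tree = prob_space M for M :: "'a measure" +
  fixes U :: "nat \<Rightarrow> 'a set set" and q :: nat and \<delta> :: "'a \<Rightarrow> 'a \<Rightarrow> real"
  assumes q_ge_2: "2 \<le> q"
    and U_0: "U 0 = {space M}"
    and U_sets: "B \<in> U k \<Longrightarrow> B \<in> sets M"
    and U_eq: "B \<in> U k \<Longrightarrow> C \<in> U k \<Longrightarrow> x \<in> B \<Longrightarrow> x \<in> C \<Longrightarrow> B = C"
    and U_cover: "B \<in> U k \<Longrightarrow> x \<in> B \<Longrightarrow> \<exists>C\<in>U (Suc k). C \<subseteq> B \<and> x \<in> C"
    and card_children: "B \<in> U k \<Longrightarrow> card {C\<in>U (Suc k). C \<subseteq> B} = (if k = 0 then Suc q else q)"
    and measure_ball: "B \<in> U (Suc k) \<Longrightarrow> measure M B = 1 / (real (Suc q) * real q ^ k)"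
    and \<delta>_level: "B \<in> U k \<Longrightarrow> x \<in> B \<Longrightarrow> y \<in> B \<Longrightarrow> \<not> (\<exists>C\<in>U (Suc k). x \<in> C \<and> y \<in> C) \<Longrightarrow> \<delta> x y = 1 / real q ^ k"
    and \<delta>_0: "x \<in> space M \<Longrightarrow> (\<And>k. \<exists>B\<in>U k. x \<in> B \<and> y \<in> B) \<Longrightarrow> \<delta> x y = 0"
begin

definition children :: "nat \<Rightarrow> 'a set \<Rightarrow> 'a set set" where
  "children k B = {C \<in> U (Suc k). C \<subseteq> B}"

lemma finite_children: "B \<in> U k \<Longrightarrow> finite (children k B)"
  unfolding children_def by (rule card_ge_0_finite) (use card_children q_ge_2 in auto)

lemma ball_subset_space: "B \<in> U k \<Longrightarrow> B \<subseteq> space M"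
  using U_sets sets.sets_into_space by blast

lemma ball_nonempty: "B \<in> U k \<Longrightarrow> B \<noteq> {}"
proof (cases k)
  case (Suc n)
  assume "B \<in> U k"
  then have "0 < measure M B" using measure_ball[of B n] Suc q_ge_2 by simp
  then show ?thesis by auto
qed (use U_0 not_empty in auto)

lemma space_cover: "x \<in> space M \<Longrightarrow> \<exists>B\<in>U k. x \<in> B"
proof (induction k)
  case (Suc k)
  then show ?case using U_cover by blast
qed (simp add: U_0)

lemma parent:
  assumes "C \<in> U (Suc k)" "B \<in> U k" "x \<in> C" "x \<in> B"
  shows "C \<in> children k B"
proof -
  obtain D where "D \<in> U (Suc k)" "D \<subseteq> B" "x \<in> D" using U_cover[OF assms(2,4)] by blast
  then show ?thesis using U_eq[OF assms(1), of D x] assms(1,3) by (simp add: children_def)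
qed

lemma finite_U: "finite (U k)"
proof (induction k)
  case (Suc k)
  have "U (Suc k) \<subseteq> (\<Union>B\<in>U k. children k B)"
  proof
    fix C assume C: "C \<in> U (Suc k)"
    then obtain x where "x \<in> C" using ball_nonempty by blast
    moreover obtain B where "B \<in> U k" "x \<in> B" using space_cover ball_subset_space[OF C] \<open>x \<in> C\<close> by blast
    ultimately show "C \<in> (\<Union>B\<in>U k. children k B)" using parent C by blast
  qed
  moreover have "finite (\<Union>B\<in>U k. children k B)" using Suc finite_children by blast
  ultimately show ?case by (rule finite_subset)
qed (simp add: U_0)

definition same :: "nat \<Rightarrow> 'a \<Rightarrow> 'a \<Rightarrow> bool" where
  "same k x y \<longleftrightarrow> (\<exists>B\<in>U k. x \<in> B \<and> y \<in> B)"

lemma same_Suc: "same (Suc k) x y \<Longrightarrow> same k x y"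
proof -
  assume "same (Suc k) x y"
  then obtain C where C: "C \<in> U (Suc k)" "x \<in> C" "y \<in> C" by (auto simp: same_def)
  then obtain B where B: "B \<in> U k" "x \<in> B" using space_cover[of x k] ball_subset_space by blast
  then have "C \<subseteq> B" using parent[OF C(1) B(1) C(2) B(2)] by (simp add: children_def)
  then show ?thesis using B C by (auto simp: same_def)
qed

lemma same_antimono: "same n x y \<Longrightarrow> m \<le> n \<Longrightarrow> same m x y"
  by (induction n rule: nat_induct) (auto simp: le_Suc_eq same_Suc)

lemma same_0: "x \<in> space M \<Longrightarrow> y \<in> space M \<Longrightarrow> same 0 x y"
  by (simp add: same_def U_0)

lemma same_level:
  assumes "x \<in> space M" "y \<in> space M" "\<not> same K x y"
  obtains k where "same k x y" "\<not> same (Suc k) x y" "\<And>j. same j x y \<Longrightarrow> j \<le> k"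
proof -
  define n where "n = (LEAST n. \<not> same n x y)"
  have n: "\<not> same n x y" unfolding n_def by (rule LeastI[of _ K]) (rule assms(3))
  then obtain k where k: "n = Suc k" using same_0[OF assms(1,2)] by (cases n) auto
  have "same k x y" using not_less_Least[of k "\<lambda>n. \<not> same n x y"] k unfolding n_def by simp
  moreover have "j \<le> k" if "same j x y" for j
    using same_antimono[OF that, of n] n k by (meson not_less_eq_eq)
  ultimately show ?thesis using that n k by blast
qed

lemma \<delta>_same: "same k x y \<Longrightarrow> \<not> same (Suc k) x y \<Longrightarrow> \<delta> x y = 1 / real q ^ k"
  unfolding same_def using \<delta>_level by blast

text \<open>At most one term is nonzero, the one at the last common level. In this form the power is
  a countable combination of ball conditions, which makes it measurable. For points never separated
  all terms vanish, in accordance with \<open>0 powr z = 0\<close>.\<close>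

lemma \<delta>_powr_suminf:
  assumes "x \<in> space M" "y \<in> space M"
  shows "complex_of_real (\<delta> x y) powr z =
    (\<Sum>k. if same k x y \<and> \<not> same (Suc k) x y then complex_of_real (1 / real q ^ k) powr z else 0)"
    (is "_ = (\<Sum>k. ?f k)")
proof (cases "\<forall>k. same k x y")
  case True
  then have "\<delta> x y = 0" using \<delta>_0 assms unfolding same_def by blast
  then show ?thesis using True by simp
next
  case False
  then obtain k where k: "same k x y" "\<not> same (Suc k) x y" "\<And>j. same j x y \<Longrightarrow> j \<le> k"
    using same_level[OF assms] by blast
  have "?f j = 0" if "j \<noteq> k" for j
  proof -
    have "same (Suc j) x y" if "same j x y"
      using same_antimono[OF k(1), of "Suc j"] k(3)[OF that] \<open>j \<noteq> k\<close> by simp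
    then show ?thesis by auto
  qed
  then have "(\<Sum>j. ?f j) = ?f k" using suminf_finite[of "{k}" ?f] by simp
  then show ?thesis using k \<delta>_same by simp
qed

section \<open>Kernels on a ball and their splitting among the children\<close>

definition kern :: "(nat \<Rightarrow> nat \<Rightarrow> complex) \<Rightarrow> nat set \<Rightarrow> (nat \<Rightarrow> 'a) \<Rightarrow> complex" where
  "kern s I x = (\<Prod>(i, j)\<in>pairs I. complex_of_real (\<delta> (x i) (x j)) powr s i j)"

text \<open>Cutting off by zero, instead of restricting the measure, keeps the integrals for all
  balls and all index sets on one product space.\<close>

definition hker :: "(nat \<Rightarrow> nat \<Rightarrow> complex) \<Rightarrow> nat set \<Rightarrow> 'a set \<Rightarrow> (nat \<Rightarrow> 'a) \<Rightarrow> complex" where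
  "hker s I B x = (if \<forall>i\<in>I. x i \<in> B then kern s I x else 0)"

lemma kern_cong: "(\<And>i. i \<in> I \<Longrightarrow> x i = y i) \<Longrightarrow> kern s I x = kern s I y"
  unfolding kern_def by (rule prod.cong) (auto simp: pairs_def)

lemma hker_restrict: "hker s I B (restrict x I) = hker s I B x"
  unfolding hker_def using kern_cong[of I "restrict x I" x] by auto

lemma \<delta>_nonneg:
  assumes "x \<in> space M" "y \<in> space M"
  shows "0 \<le> \<delta> x y"
proof (cases "\<forall>k. same k x y")
  case True
  then show ?thesis using \<delta>_0 assms unfolding same_def by simp
next
  case False
  then show ?thesis using same_level[OF assms] \<delta>_same by (metis divide_nonneg_nonneg of_nat_0_le_iff zero_le_one zero_le_power)
qed

lemma norm_\<delta>_powr: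
  assumes "x \<in> space M" "y \<in> space M"
  shows "complex_of_real (\<delta> x y) powr complex_of_real (Re z) = complex_of_real (norm (complex_of_real (\<delta> x y) powr z))"
  using \<delta>_nonneg[OF assms] by (simp add: powr_of_real norm_powr_real_powr)

lemma norm_kern:
  assumes "\<And>i. i \<in> I \<Longrightarrow> x i \<in> space M"
  shows "kern (re_part s) I x = complex_of_real (norm (kern s I x))"
  unfolding kern_def prod_norm[symmetric] of_real_prod re_part_def case_prod_unfold
  by (intro prod.cong refl norm_\<delta>_powr assms) (auto simp: pairs_def)

lemma norm_hker:
  assumes "B \<in> U k"
  shows "hker (re_part s) I B x = complex_of_real (norm (hker s I B x))"
  using norm_kern[of I x s] ball_subset_space[OF assms] by (auto simp: hker_def)

lemma hker_singleton: "hker s {i} B x = (if x i \<in> B then 1 else 0)"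
proof -
  have "pairs {i} = {}" by (auto simp: pairs_def)
  then show ?thesis by (simp add: hker_def kern_def)
qed

text \<open>The separated pairs are all at distance \<open>q^-k\<close>, so together they contribute
  one power of \<open>q\<close>, whose exponent is governed by the total exponent minus that of the
  blocks.\<close>

lemma kern_split:
  assumes "finite I" "partition_on I \<pi>"
    and "\<And>i j. (i, j) \<in> cross_pairs I \<pi> \<Longrightarrow> \<delta> (x i) (x j) = 1 / real q ^ k"
  shows "kern s I x = of_nat q powr (- of_nat k * (esum s I - (\<Sum>\<mu>\<in>\<pi>. esum s \<mu>))) * (\<Prod>\<mu>\<in>\<pi>. kern s \<mu> x)"
proof -
  have fin: "finite (cross_pairs I \<pi>)" using assms(1) by (simp add: cross_pairs_def)
  have "(\<Prod>(i, j)\<in>cross_pairs I \<pi>. complex_of_real (\<delta> (x i) (x j)) powr s i j) =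
      (\<Prod>(i, j)\<in>cross_pairs I \<pi>. of_nat q powr (- of_nat k * s i j))"
  proof (rule prod.cong[OF refl], safe)
    fix i j assume "(i, j) \<in> cross_pairs I \<pi>"
    then show "complex_of_real (\<delta> (x i) (x j)) powr s i j = of_nat q powr (- of_nat k * s i j)"
      using assms(3) inverse_q_powr[OF q_ge_2, of k "s i j"] by (simp only:)
  qed
  also have "\<dots> = of_nat q powr (\<Sum>(i, j)\<in>cross_pairs I \<pi>. - of_nat k * s i j)"
    unfolding case_prod_unfold by (rule powr_q_sum[OF q_ge_2 fin, symmetric])
  also have "(\<Sum>(i, j)\<in>cross_pairs I \<pi>. - of_nat k * s i j) = - of_nat k * (\<Sum>(i, j)\<in>cross_pairs I \<pi>. s i j)"
    by (simp only: sum_distrib_left case_prod_unfold)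
  also have "(\<Sum>(i, j)\<in>cross_pairs I \<pi>. s i j) = esum s I - (\<Sum>\<mu>\<in>\<pi>. esum s \<mu>)"
    unfolding esum_def sum.pairs_partition[OF assms(1,2)] by simp
  finally show ?thesis unfolding kern_def prod.pairs_partition[OF assms(1,2)] by (simp only: mult.commute)
qed

definition split_term :: "nat \<Rightarrow> (nat \<Rightarrow> nat \<Rightarrow> complex) \<Rightarrow> nat set \<Rightarrow> (nat \<Rightarrow> 'a set) \<Rightarrow> (nat \<Rightarrow> 'a) \<Rightarrow> complex" where
  "split_term k s I g x = of_nat q powr (- of_nat k * (esum s I - (\<Sum>\<mu>\<in>fibres g I. esum s \<mu>))) *
    (\<Prod>D\<in>g ` I. hker s {i\<in>I. g i = D} D x)"

text \<open>At a tuple in \<open>B\<close> only one assignment contributes, the one sending each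
  entry to the child containing it: under any other, some entry lies outside its child and the
  kernel of its block vanishes. A tuple with an entry outside \<open>B\<close> gives 0 on both
  sides.\<close>

lemma hker_split:
  assumes "finite I" "B \<in> U k"
  shows "hker s I B x = (\<Sum>g\<in>I \<rightarrow>\<^sub>E children k B. split_term k s I g x)"
proof -
  let ?w = "\<lambda>g. of_nat q powr (- of_nat k * (esum s I - (\<Sum>\<mu>\<in>fibres g I. esum s \<mu>))) :: complex"
  let ?H = "\<lambda>g. \<Prod>D\<in>g ` I. hker s {i\<in>I. g i = D} D x"
  have fin: "finite (I \<rightarrow>\<^sub>E children k B)" using assms finite_children by (intro finite_PiE) auto
  have zero: "?H g = 0" if "\<not> (\<forall>i\<in>I. x i \<in> g i)" for g
  proof -
    obtain i where i: "i \<in> I" "x i \<notin> g i" using \<open>\<not> _\<close> by blast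
    then have "hker s {j\<in>I. g j = g i} (g i) x = 0" by (auto simp: hker_def)
    then show ?thesis using i assms(1) by (intro prod_zero) auto
  qed
  have "hker s I B x = (\<Sum>g\<in>I \<rightarrow>\<^sub>E children k B. ?w g * ?H g)"
  proof (cases "\<forall>i\<in>I. x i \<in> B")
    case False
    have "?H g = 0" if "g \<in> I \<rightarrow>\<^sub>E children k B" for g
      using False that by (intro zero) (auto simp: children_def PiE_def Pi_def)
    then have "(\<Sum>g\<in>I \<rightarrow>\<^sub>E children k B. ?w g * ?H g) = 0" by (intro sum.neutral) simp
    moreover have "hker s I B x = 0" using False by (simp only: hker_def if_False)
    ultimately show ?thesis by simp
  next
    case True
    then have "\<forall>i\<in>I. \<exists>C. C \<in> children k B \<and> x i \<in> C" using U_cover[OF assms(2)] unfolding children_def by blast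
    then obtain c where c: "\<And>i. i \<in> I \<Longrightarrow> c i \<in> children k B \<and> x i \<in> c i" by metis
    define g where "g = restrict c I"
    have g: "g \<in> I \<rightarrow>\<^sub>E children k B" "\<And>i. i \<in> I \<Longrightarrow> x i \<in> g i" using c by (auto simp: g_def)
    have ch: "g i \<in> U (Suc k)" if "i \<in> I" for i using g(1) that by (auto simp: children_def)
    have uniq: "?H g' = 0" if g': "g' \<in> I \<rightarrow>\<^sub>E children k B" "g' \<noteq> g" for g'
    proof (rule zero, rule notI)
      assume *: "\<forall>i\<in>I. x i \<in> g' i"
      have "g' i = g i" if "i \<in> I" for i
        using U_eq[of "g' i" "Suc k" "g i" "x i"] * g g'(1) that by (auto simp: children_def PiE_def Pi_def)
      then have "g' = g" using g(1) g'(1) by (intro PiE_ext)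
      then show False using g'(2) by contradiction
    qed
    have "(\<Sum>g\<in>I \<rightarrow>\<^sub>E children k B. ?w g * ?H g) = (\<Sum>g\<in>{g}. ?w g * ?H g)"
      by (rule sum.mono_neutral_right[OF fin]) (use g uniq in auto)
    moreover have "kern s I x = ?w g * (\<Prod>\<mu>\<in>fibres g I. kern s \<mu> x)"
    proof (rule kern_split[OF assms(1) partition_on_fibres])
      fix i j assume ij: "(i, j) \<in> cross_pairs I (fibres g I)"
      then have I: "i \<in> I" "j \<in> I" "i < j" by (auto simp: cross_pairs_def pairs_def)
      have ne: "g i \<noteq> g j"
      proof
        assume "g i = g j"
        then have "(i, j) \<in> pairs {l \<in> I. g l = g i}" using I by (auto simp: pairs_def)
        moreover have "{l \<in> I. g l = g i} \<in> fibres g I" unfolding fibres_alt using I by blast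
        ultimately show False using ij by (auto simp: cross_pairs_def)
      qed
      have "\<not> (\<exists>C\<in>U (Suc k). x i \<in> C \<and> x j \<in> C)"
        using ne U_eq ch g(2) I by metis
      then show "\<delta> (x i) (x j) = 1 / real q ^ k" using \<delta>_level[OF assms(2)] True I by blast
    qed
    moreover have "(\<Prod>\<mu>\<in>fibres g I. kern s \<mu> x) = ?H g"
      unfolding fibres_def prod.reindex[OF inj_on_fibres] o_def
      using g(2) by (intro prod.cong refl) (auto simp: hker_def)
    ultimately show ?thesis using True by (simp add: hker_def)
  qed
  then show ?thesis by (simp only: split_term_def)
qed

definition hsplit :: "nat \<Rightarrow> (nat \<Rightarrow> nat \<Rightarrow> complex) \<Rightarrow> nat set \<Rightarrow> 'a set \<Rightarrow> (nat \<Rightarrow> 'a) \<Rightarrow> complex" where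
  "hsplit k s I B x = (\<Sum>g\<in>{g \<in> I \<rightarrow>\<^sub>E children k B. 2 \<le> card (fibres g I)}. split_term k s I g x)"

text \<open>The assignments with fewer than two fibres are the constant ones. For them the distance
  factor is \<open>q^0 = 1\<close> and what remains is the full kernel on one child: the
  self-reproducing term that gets iterated.\<close>

lemma hker_step:
  assumes "finite I" "I \<noteq> {}" "B \<in> U k"
  shows "hker s I B x = (\<Sum>C\<in>children k B. hker s I C x) + hsplit k s I B x"
proof -
  let ?f = "\<lambda>g. split_term k s I g x"
  let ?G = "I \<rightarrow>\<^sub>E children k B"
  have fin: "finite ?G" using assms finite_children by (intro finite_PiE) auto
  obtain i0 where i0: "i0 \<in> I" using assms(2) by blast
  have const: "g ` I = {g i0} \<and> fibres g I = {I} \<and> g = (\<lambda>i\<in>I. g i0)" if g: "g \<in> ?G" "\<not> 2 \<le> card (fibres g I)" for g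
  proof -
    have "card (g ` I) \<noteq> 0" using assms i0 by auto
    then have "card (g ` I) = 1" using g(2) card_fibres[of g I] by linarith
    then have im: "g ` I = {g i0}" using i0 by (metis card_1_singletonE imageI singletonD)
    then have "fibres g I = {{i \<in> I. g i = g i0}}" by (simp add: fibres_def)
    moreover have eq: "g i = g i0" if "i \<in> I" for i using im that by blast
    moreover have "{i \<in> I. g i = g i0} = I" using eq by blast
    moreover have "g = (\<lambda>i\<in>I. g i0)" using eq g(1) by (intro ext) (auto simp: PiE_def extensional_def)
    ultimately show ?thesis using im by simp
  qed
  have "(\<Sum>g\<in>?G. ?f g) = (\<Sum>g\<in>?G - {g \<in> ?G. 2 \<le> card (fibres g I)}. ?f g) + hsplit k s I B x"
    unfolding hsplit_def by (rule sum.subset_diff[OF _ fin]) auto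
  also have "(\<Sum>g\<in>?G - {g \<in> ?G. 2 \<le> card (fibres g I)}. ?f g) = (\<Sum>C\<in>children k B. hker s I C x)"
  proof (rule sum.reindex_bij_witness[where i = "\<lambda>C. \<lambda>i\<in>I. C" and j = "\<lambda>g. g i0"])
    fix g assume g: "g \<in> ?G - {g \<in> ?G. 2 \<le> card (fibres g I)}"
    then have c: "g ` I = {g i0}" "fibres g I = {I}" "g = (\<lambda>i\<in>I. g i0)" using const[of g] by auto
    show "(\<lambda>i\<in>I. g i0) = g" using c(3) by simp
    show "g i0 \<in> children k B" using g i0 by auto
    have "{i \<in> I. g i = g i0} = I" using c(1) by blast
    then show "hker s I (g i0) x = ?f g" unfolding split_term_def c(1,2) using powr_q_0[OF q_ge_2] by simp
  next
    fix C assume C: "C \<in> children k B"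
    show "(\<lambda>i\<in>I. C) i0 = C" using i0 by simp
    have "(\<lambda>i\<in>I. C) ` I = {C}" using i0 by auto
    then have "card (fibres (\<lambda>i\<in>I. C) I) = 1" unfolding card_fibres by simp
    then show "(\<lambda>i\<in>I. C) \<in> ?G - {g \<in> ?G. 2 \<le> card (fibres g I)}" using C by auto
  qed
  finally show ?thesis using hker_split[OF assms(1,3)] by simp
qed

section \<open>Iteration down the tree\<close>

primrec descendants :: "nat \<Rightarrow> 'a set \<Rightarrow> nat \<Rightarrow> 'a set set" where
  "descendants k B 0 = {B}"
| "descendants k B (Suc m) = (\<Union>C\<in>descendants k B m. children (k + m) C)"

lemma descendants_U: "B \<in> U k \<Longrightarrow> descendants k B m \<subseteq> U (k + m)"
  by (induction m) (auto simp: children_def)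

lemma finite_descendants: "B \<in> U k \<Longrightarrow> finite (descendants k B m)"
  using descendants_U[of B k m] finite_U finite_subset by blast

lemma sum_descendants_Suc:
  fixes f :: "'a set \<Rightarrow> 'c::comm_monoid_add"
  assumes "B \<in> U k"
  shows "(\<Sum>D\<in>descendants k B (Suc m). f D) = (\<Sum>C\<in>descendants k B m. \<Sum>D\<in>children (k + m) C. f D)"
  unfolding descendants.simps
proof (rule sum.UNION_disjoint)
  show "finite (descendants k B m)" by (rule finite_descendants[OF assms])
  show "\<forall>C\<in>descendants k B m. finite (children (k + m) C)"
    using descendants_U[OF assms] finite_children by blast
  show "\<forall>C\<in>descendants k B m. \<forall>C'\<in>descendants k B m. C \<noteq> C' \<longrightarrow> children (k + m) C \<inter> children (k + m) C' = {}"
  proof (intro ballI impI equals0I)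
    fix C C' D assume C: "C \<in> descendants k B m" "C' \<in> descendants k B m" "C \<noteq> C'" "D \<in> children (k + m) C \<inter> children (k + m) C'"
    then have D: "D \<subseteq> C" "D \<subseteq> C'" "D \<in> U (Suc (k + m))" by (auto simp: children_def)
    obtain x where "x \<in> D" using ball_nonempty[OF D(3)] by blast
    then show False using U_eq[of C "k + m" C' x] descendants_U[OF assms] C D by blast
  qed
qed

lemma card_descendants: "B \<in> U (Suc k) \<Longrightarrow> card (descendants (Suc k) B m) = q ^ m"
proof (induction m)
  case (Suc m)
  have "card (descendants (Suc k) B (Suc m)) = (\<Sum>C\<in>descendants (Suc k) B m. \<Sum>D\<in>children (Suc k + m) C. 1)"
    unfolding sum_descendants_Suc[OF Suc.prems, symmetric] by simp
  also have "\<dots> = (\<Sum>C\<in>descendants (Suc k) B m. q)"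
  proof (rule sum.cong[OF refl])
    fix C assume "C \<in> descendants (Suc k) B m"
    then have "C \<in> U (Suc k + m)" using descendants_U[OF Suc.prems] by blast
    then show "(\<Sum>D\<in>children (Suc k + m) C. 1) = q" using card_children[of C "Suc k + m"] by (simp add: children_def)
  qed
  finally show ?case using Suc by simp
qed simp

text \<open>A finite identity, so no convergence enters. The last sum is supported on tuples whose
  entries still share a ball \<open>n\<close> levels below \<open>B\<close>.\<close>

lemma hker_telescope:
  assumes "finite I" "I \<noteq> {}" "B \<in> U k"
  shows "hker s I B x = (\<Sum>m<n. \<Sum>C\<in>descendants k B m. hsplit (k + m) s I C x) + (\<Sum>C\<in>descendants k B n. hker s I C x)"
proof (induction n)
  case (Suc n)
  have "(\<Sum>C\<in>descendants k B n. hker s I C x) =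
      (\<Sum>C\<in>descendants k B n. (\<Sum>D\<in>children (k + n) C. hker s I D x) + hsplit (k + n) s I C x)"
    by (rule sum.cong[OF refl], rule hker_step[OF assms(1,2)]) (use descendants_U[OF assms(3)] in blast)
  also have "\<dots> = (\<Sum>D\<in>descendants k B (Suc n). hker s I D x) + (\<Sum>C\<in>descendants k B n. hsplit (k + n) s I C x)"
    unfolding sum_descendants_Suc[OF assms(3)] by (simp add: sum.distrib)
  finally show ?case using Suc by simp
qed simp

subsection \<open>Integration over products\<close>

abbreviation PJ :: "nat set \<Rightarrow> (nat \<Rightarrow> 'a) measure" where
  "PJ J \<equiv> PiM J (\<lambda>_. M)"

lemma prob_space_PJ: "prob_space (PJ J)"
  by (rule prob_space_PiM) (rule prob_space_axioms)

lemma PJ_in_space: "x \<in> space (PJ J) \<Longrightarrow> i \<in> J \<Longrightarrow> x i \<in> space M"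
  by (auto simp: space_PiM)

lemma pred_same [measurable]:
  assumes "i \<in> J" "j \<in> J"
  shows "Measurable.pred (PJ J) (\<lambda>x. same k (x i) (x j))"
proof -
  have *: "Measurable.pred (PJ J) (\<lambda>x. x i \<in> B \<and> x j \<in> B)" if "B \<in> U k" for B
    using U_sets[OF that] assms by measurable
  show ?thesis unfolding same_def by (rule pred_intros_finite(4)[OF finite_U *])
qed

lemma measurable_kern:
  assumes "I \<subseteq> J"
  shows "kern s I \<in> borel_measurable (PJ J)"
proof -
  have meas: "(\<lambda>x. complex_of_real (\<delta> (x i) (x j)) powr z) \<in> borel_measurable (PJ J)" if "i \<in> J" "j \<in> J" for i j z
  proof (subst measurable_cong)
    fix x assume "x \<in> space (PJ J)"
    then show "complex_of_real (\<delta> (x i) (x j)) powr z =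
      (\<Sum>k. if same k (x i) (x j) \<and> \<not> same (Suc k) (x i) (x j) then complex_of_real (1 / real q ^ k) powr z else 0)"
      by (intro \<delta>_powr_suminf PJ_in_space[OF _ that(1)] PJ_in_space[OF _ that(2)])
  next
    have [measurable]: "Measurable.pred (PJ J) (\<lambda>x. same k (x i) (x j))" for k by (rule pred_same[OF that])
    show "(\<lambda>x. \<Sum>k. if same k (x i) (x j) \<and> \<not> same (Suc k) (x i) (x j) then complex_of_real (1 / real q ^ k) powr z else 0)
        \<in> borel_measurable (PJ J)"
      by measurable
  qed
  show ?thesis unfolding kern_def[abs_def] case_prod_unfold
  proof (rule borel_measurable_prod)
    fix p assume "p \<in> pairs I"
    then have "fst p \<in> J" "snd p \<in> J" using assms by (auto simp: pairs_def)
    then show "(\<lambda>x. complex_of_real (\<delta> (x (fst p)) (x (snd p))) powr s (fst p) (snd p)) \<in> borel_measurable (PJ J)"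
      by (rule meas)
  qed
qed

lemma measurable_hker:
  assumes "I \<subseteq> J" "finite I" "B \<in> U k"
  shows "hker s I B \<in> borel_measurable (PJ J)"
proof -
  have "Measurable.pred (PJ J) (\<lambda>x. x i \<in> B)" if "i \<in> I" for i
  proof -
    have "i \<in> J" using that assms(1) by blast
    then show ?thesis using U_sets[OF assms(3)] by measurable
  qed
  then have [measurable]: "Measurable.pred (PJ J) (\<lambda>x. \<forall>i\<in>I. x i \<in> B)"
    by (rule pred_intros_finite(3)[OF assms(2)])
  note measurable_kern[OF assms(1), measurable]
  show ?thesis unfolding hker_def[abs_def] by measurable
qed

lemma indep_coordinates:
  assumes "J \<noteq> {}"
  shows "prob_space.indep_vars (PJ J) (\<lambda>_. M) (\<lambda>i x. x i) J"
proof -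
  interpret P: prob_space "PJ J" by (rule prob_space_PJ)
  have "distr (PJ J) (PJ J) (\<lambda>x. \<lambda>i\<in>J. x i) = distr (PJ J) (PJ J) (\<lambda>x. x)"
    by (rule distr_cong) (auto simp: space_PiM)
  also have "\<dots> = PJ J" by simp
  also have "\<dots> = PiM J (\<lambda>i. distr (PJ J) M (\<lambda>x. x i))"
    by (rule PiM_cong[OF refl]) (rule distr_PiM_component[symmetric], auto intro: prob_space_axioms)
  finally show ?thesis
    by (subst P.indep_vars_iff_distr_eq_PiM'[OF assms]) auto
qed

text \<open>The coordinates of a product of probability spaces are independent, hence so are
  functions of disjoint groups of coordinates. The equation with \<open>restrict\<close> says that
  \<open>f l\<close> depends only on the coordinates in \<open>K l\<close>, while all functions live
  on the same space \<open>PJ J\<close>.\<close>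

lemma
  fixes f :: "'l \<Rightarrow> (nat \<Rightarrow> 'a) \<Rightarrow> 'c::{real_normed_field, banach, second_countable_topology}"
  assumes "J \<noteq> {}" "finite L" "disjoint_family_on K L" "\<And>l. l \<in> L \<Longrightarrow> K l \<subseteq> J"
    and "\<And>l. l \<in> L \<Longrightarrow> f l \<in> borel_measurable (PJ (K l))"
    and "\<And>l x. l \<in> L \<Longrightarrow> f l (restrict x (K l)) = f l x"
    and "\<And>l. l \<in> L \<Longrightarrow> integrable (PJ J) (f l)"
  shows integrable_prod_blocks: "integrable (PJ J) (\<lambda>x. \<Prod>l\<in>L. f l x)"
    and integral_prod_blocks: "integral\<^sup>L (PJ J) (\<lambda>x. \<Prod>l\<in>L. f l x) = (\<Prod>l\<in>L. integral\<^sup>L (PJ J) (f l))"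
proof -
  interpret P: prob_space "PJ J" by (rule prob_space_PJ)
  have "P.indep_vars (\<lambda>l. PJ (K l)) (\<lambda>l x. restrict (\<lambda>i. x i) (K l)) L"
    by (rule P.indep_vars_restrict[OF indep_coordinates[OF assms(1)] assms(4,3)])
  then have "P.indep_vars (\<lambda>_. borel) (\<lambda>l x. f l (restrict (\<lambda>i. x i) (K l))) L"
    by (rule P.indep_vars_compose2) (rule assms(5))
  then have ind: "P.indep_vars (\<lambda>_. borel) f L"
    by (subst P.indep_vars_cong[OF refl _ refl, of _ _ "\<lambda>l x. f l (restrict (\<lambda>i. x i) (K l))"]) (auto simp: assms(6))
  show "integrable (PJ J) (\<lambda>x. \<Prod>l\<in>L. f l x)"
    by (rule P.indep_vars_integrable[OF assms(2) ind assms(7)])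
  show "integral\<^sup>L (PJ J) (\<lambda>x. \<Prod>l\<in>L. f l x) = (\<Prod>l\<in>L. integral\<^sup>L (PJ J) (f l))"
    by (rule P.indep_vars_lebesgue_integral[OF assms(2) ind assms(7)])
qed

lemma
  assumes "i \<in> J" "B \<in> sets M"
  shows integrable_coord: "integrable (PJ J) (\<lambda>x. indicator B (x i) :: real)"
    and integral_coord: "integral\<^sup>L (PJ J) (\<lambda>x. indicator B (x i) :: real) = measure M B"
proof -
  have d: "distr (PJ J) M (\<lambda>x. x i) = M" by (rule distr_PiM_component) (use assms prob_space_axioms in auto)
  have m: "(\<lambda>x. x i) \<in> measurable (PJ J) M" using assms(1) by (rule measurable_component_singleton)
  have "integrable M (indicator B :: _ \<Rightarrow> real)" using assms(2) by (simp add: emeasure_eq_measure)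
  then show "integrable (PJ J) (\<lambda>x. indicator B (x i) :: real)"
    using integrable_distr[OF m, of "indicator B :: _ \<Rightarrow> real"] d by simp
  have "integral\<^sup>L (PJ J) (\<lambda>x. indicator B (x i) :: real) = integral\<^sup>L (distr (PJ J) M (\<lambda>x. x i)) (indicator B)"
    by (rule integral_distr[OF m, symmetric]) (use assms(2) in simp)
  then show "integral\<^sup>L (PJ J) (\<lambda>x. indicator B (x i) :: real) = measure M B"
    unfolding d using assms(2) sets.sets_into_space[OF assms(2)] by (simp add: Int_absorb2)
qed

lemma measure_box:
  assumes "finite I" "I \<subseteq> J" "J \<noteq> {}" "B \<in> sets M"
  shows "measure (PJ J) {x \<in> space (PJ J). \<forall>i\<in>I. x i \<in> B} = measure M B ^ card I"
proof -
  interpret P: prob_space "PJ J" by (rule prob_space_PJ)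
  have [measurable]: "Measurable.pred (PJ J) (\<lambda>x. \<forall>i\<in>I. x i \<in> B)"
  proof (rule pred_intros_finite(3)[OF assms(1)])
    show "Measurable.pred (PJ J) (\<lambda>x. x i \<in> B)" if "i \<in> I" for i
    proof -
      have "i \<in> J" using that assms(2) by blast
      then show ?thesis using assms(4) by measurable
    qed
  qed
  have eq: "(\<Prod>i\<in>I. indicator B (x i)) = (indicator {x \<in> space (PJ J). \<forall>i\<in>I. x i \<in> B} x :: real)" if "x \<in> space (PJ J)" for x
  proof (cases "\<forall>i\<in>I. x i \<in> B")
    case False
    then have "(\<Prod>i\<in>I. indicator B (x i)) = (0 :: real)" using assms(1) by (intro prod_zero) (auto simp: indicator_def)
    then show ?thesis using False by simp
  qed (use that in simp)
  have "measure (PJ J) {x \<in> space (PJ J). \<forall>i\<in>I. x i \<in> B} = integral\<^sup>L (PJ J) (indicator {x \<in> space (PJ J). \<forall>i\<in>I. x i \<in> B})"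
    by (simp add: Int_absorb2 subset_eq)
  also have "\<dots> = integral\<^sup>L (PJ J) (\<lambda>x. \<Prod>i\<in>I. indicator B (x i))"
    using eq by (intro Bochner_Integration.integral_cong) auto
  also have "\<dots> = (\<Prod>i\<in>I. integral\<^sup>L (PJ J) (\<lambda>x. indicator B (x i)))"
  proof (rule integral_prod_blocks[where K = "\<lambda>i. {i}"])
    show "(\<lambda>x. indicator B (x i) :: real) \<in> borel_measurable (PJ {i})" for i
      using assms(4) by measurable
  qed (use assms in \<open>auto simp: disjoint_family_on_def intro: integrable_coord\<close>)
  also have "\<dots> = (\<Prod>i\<in>I. measure M B)"
    using assms by (intro prod.cong refl integral_coord) auto
  finally show ?thesis by simp
qed

text \<open>The probability that two coordinates share a ball of level \<open>K + 1\<close> is at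
  most the sum of the squared measures of these balls, hence at most
  \<open>1 / ((q + 1) q^K)\<close>, which tends to 0.\<close>

lemma AE_not_same:
  assumes "i \<in> J" "j \<in> J" "i \<noteq> j"
  shows "AE x in PJ J. \<exists>K. \<not> same K (x i) (x j)"
proof -
  interpret P: prob_space "PJ J" by (rule prob_space_PJ)
  let ?S = "\<lambda>K. {x \<in> space (PJ J). same K (x i) (x j)}"
  let ?c = "\<lambda>K. 1 / (real (Suc q) * real q ^ K)"
  have [measurable]: "Measurable.pred (PJ J) (\<lambda>x. same k (x i) (x j))" for k by (rule pred_same[OF assms(1,2)])
  have le: "measure (PJ J) (?S (Suc K)) \<le> ?c K" for K
  proof -
    let ?A = "\<lambda>B. {x \<in> space (PJ J). \<forall>l\<in>{i, j}. x l \<in> B}"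
    have A: "?A B \<in> sets (PJ J)" if "B \<in> U (Suc K)" for B
    proof -
      have "Measurable.pred (PJ J) (\<lambda>x. x i \<in> B \<and> x j \<in> B)" using U_sets[OF that] assms(1,2) by measurable
      then show ?thesis by simp
    qed
    have "measure (PJ J) (?S (Suc K)) = measure (PJ J) (\<Union>B\<in>U (Suc K). ?A B)"
      by (rule arg_cong[where f = "measure (PJ J)"]) (auto simp: same_def)
    also have "\<dots> \<le> (\<Sum>B\<in>U (Suc K). measure (PJ J) (?A B))"
      by (rule P.finite_measure_subadditive_finite[OF finite_U]) (use A in auto)
    also have "\<dots> = (\<Sum>B\<in>U (Suc K). ?c K * measure M B)"
    proof (rule sum.cong[OF refl])
      fix B assume B: "B \<in> U (Suc K)"
      show "measure (PJ J) (?A B) = ?c K * measure M B"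
        using measure_box[of "{i, j}" J B] U_sets[OF B] assms measure_ball[OF B] by (auto simp: power2_eq_square)
    qed
    also have "\<dots> = ?c K * (\<Sum>B\<in>U (Suc K). measure M B)" by (simp only: sum_distrib_left)
    also have "(\<Sum>B\<in>U (Suc K). measure M B) = measure M (\<Union>B\<in>U (Suc K). B)"
    proof (rule finite_measure_finite_Union[symmetric, OF finite_U])
      show "(\<lambda>B. B) ` U (Suc K) \<subseteq> events" using U_sets by auto
      show "disjoint_family_on (\<lambda>B. B) (U (Suc K))"
        unfolding disjoint_family_on_def using U_eq by blast
    qed
    also have "?c K * \<dots> \<le> ?c K * 1" by (rule mult_left_mono) auto
    finally show ?thesis by simp
  qed
  have "measure (PJ J) {x \<in> space (PJ J). \<forall>K. same K (x i) (x j)} \<le> ?c K" for K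
    by (rule order_trans[OF P.finite_measure_mono le]) auto
  moreover have "?c \<longlonglongrightarrow> 0"
  proof -
    have "(\<lambda>K. (1 / real q) ^ K / real (Suc q)) \<longlonglongrightarrow> 0 / real (Suc q)"
      using q_ge_2 by (intro tendsto_divide tendsto_const LIMSEQ_power_zero) auto
    then show ?thesis by (simp add: power_divide mult.commute)
  qed
  ultimately have "measure (PJ J) {x \<in> space (PJ J). \<forall>K. same K (x i) (x j)} \<le> 0"
    by (intro LIMSEQ_le_const) auto
  then have "measure (PJ J) {x \<in> space (PJ J). \<forall>K. same K (x i) (x j)} = 0"
    by (simp add: measure_le_0_iff)
  then have "emeasure (PJ J) {x \<in> space (PJ J). \<forall>K. same K (x i) (x j)} = 0"
    by (simp add: P.emeasure_eq_measure)
  then show ?thesis by (intro AE_I[of _ _ "{x \<in> space (PJ J). \<forall>K. same K (x i) (x j)}"]) auto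
qed

text \<open>The common scale of a split at level \<open>k\<close>: the children have level
  \<open>k + 1\<close> and measure \<open>1 / ((q + 1) q^k)\<close>, one factor for each index, and
  separated pairs are at distance \<open>q^-k\<close>. Hence \<open>good\<close> attaches
  \<open>ball_scale k\<close> to balls of level \<open>Suc k\<close>: the scales of the blocks and
  the distance factor then multiply up to the scale of the whole set.\<close>

definition ball_scale :: "nat \<Rightarrow> (nat \<Rightarrow> nat \<Rightarrow> complex) \<Rightarrow> nat set \<Rightarrow> complex" where
  "ball_scale k s I = of_nat q powr (- of_nat k * (of_nat (card I) + esum s I)) / of_nat (Suc q) ^ card I"

text \<open>Required for all balls of positive level at once, since a split uses the values at the
  children and the iteration those at all deeper levels. Level 0 is excluded because the root has
  one child more.\<close>

definition good :: "nat set \<Rightarrow> (nat \<Rightarrow> nat \<Rightarrow> complex) \<Rightarrow> nat set \<Rightarrow> bool" where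
  "good J s I \<longleftrightarrow> (\<forall>k. \<forall>B\<in>U (Suc k). integrable (PJ J) (hker s I B) \<and>
    integral\<^sup>L (PJ J) (hker s I B) = ball_scale k s I * tree_val q s I)"

text \<open>Blocks in different children involve disjoint sets of coordinates, so the integral is
  the product of the block integrals supplied by \<open>good\<close>.\<close>

lemma
  assumes "J \<noteq> {}" "I \<subseteq> J" "finite I" "B \<in> U k" "g \<in> I \<rightarrow>\<^sub>E children k B" "\<And>\<mu>. \<mu> \<in> fibres g I \<Longrightarrow> good J s \<mu>"
  shows integrable_split_term: "integrable (PJ J) (split_term k s I g)"
    and integral_split_term: "integral\<^sup>L (PJ J) (split_term k s I g) = ball_scale k s I * (\<Prod>\<mu>\<in>fibres g I. tree_val q s \<mu>)"
proof -
  let ?K = "\<lambda>D. {i\<in>I. g i = D}"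
  have D: "D \<in> U (Suc k)" if "D \<in> g ` I" for D using that assms(5) by (auto simp: children_def)
  have gd: "good J s (?K D)" if "D \<in> g ` I" for D using that assms(6) by (auto simp: fibres_def)
  note blocks = assms(1) finite_imageI[OF assms(3)]
  have disj: "disjoint_family_on ?K (g ` I)" by (auto simp: disjoint_family_on_def)
  have sub: "?K D \<subseteq> J" for D using assms(2) by auto
  have meas: "hker s (?K D) D \<in> borel_measurable (PJ (?K D))" if "D \<in> g ` I" for D
    by (rule measurable_hker[OF subset_refl _ D[OF that]]) (use assms(3) in simp)
  have int: "integrable (PJ J) (hker s (?K D) D)" if "D \<in> g ` I" for D
    using gd[OF that] D[OF that] unfolding good_def by blast
  show "integrable (PJ J) (split_term k s I g)"
    unfolding split_term_def[abs_def]
    by (rule integrable_mult_right) (rule integrable_prod_blocks[OF blocks disj sub meas hker_restrict int])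
  have finf: "finite (fibres g I)" using assms(3) by (simp add: fibres_def)
  have cardI: "card I = (\<Sum>\<mu>\<in>fibres g I. card \<mu>)"
    by (rule product_partition[OF partition_on_fibres]) (use assms(3) in \<open>auto simp: fibres_def\<close>)
  let ?q = "of_nat q :: complex" and ?e = "\<Sum>\<mu>\<in>fibres g I. esum s \<mu>"
  have "(\<Prod>\<mu>\<in>fibres g I. ball_scale k s \<mu>) =
      (\<Prod>\<mu>\<in>fibres g I. ?q powr (- of_nat k * (of_nat (card \<mu>) + esum s \<mu>))) / (\<Prod>\<mu>\<in>fibres g I. of_nat (Suc q) ^ card \<mu>)"
    by (simp only: ball_scale_def prod_dividef)
  also have "(\<Prod>\<mu>\<in>fibres g I. of_nat (Suc q) ^ card \<mu>) = (of_nat (Suc q) ^ card I :: complex)"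
    unfolding cardI power_sum ..
  also have "(\<Prod>\<mu>\<in>fibres g I. ?q powr (- of_nat k * (of_nat (card \<mu>) + esum s \<mu>))) = ?q powr (- of_nat k * (of_nat (card I) + ?e))"
    unfolding powr_q_sum[OF q_ge_2 finf, symmetric] cardI of_nat_sum sum.distrib[symmetric] sum_distrib_left ..
  finally have scale: "(\<Prod>\<mu>\<in>fibres g I. ball_scale k s \<mu>) = ?q powr (- of_nat k * (of_nat (card I) + ?e)) / of_nat (Suc q) ^ card I" .
  \<comment> \<open>The block exponents cancel: the separated pairs supply
    \<open>esum s I - ?e\<close> and the blocks supply \<open>?e\<close>.\<close>
  have pow: "?q powr (- of_nat k * (esum s I - ?e)) * ?q powr (- of_nat k * (of_nat (card I) + ?e)) =
      ?q powr (- of_nat k * (of_nat (card I) + esum s I))"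
    unfolding powr_q_add[OF q_ge_2, symmetric] by (simp add: algebra_simps)
  have "integral\<^sup>L (PJ J) (split_term k s I g) =
      ?q powr (- of_nat k * (esum s I - ?e)) * (\<Prod>D\<in>g ` I. integral\<^sup>L (PJ J) (hker s (?K D) D))"
    unfolding split_term_def[abs_def] integral_mult_right_zero
    by (rule arg_cong[where f = "times _"]) (rule integral_prod_blocks[OF blocks disj sub meas hker_restrict int])
  also have "(\<Prod>D\<in>g ` I. integral\<^sup>L (PJ J) (hker s (?K D) D)) = (\<Prod>D\<in>g ` I. ball_scale k s (?K D) * tree_val q s (?K D))"
    by (rule prod.cong[OF refl]) (use gd D in \<open>simp add: good_def\<close>)
  also have "\<dots> = (\<Prod>\<mu>\<in>fibres g I. ball_scale k s \<mu> * tree_val q s \<mu>)"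
    unfolding fibres_def prod.reindex[OF inj_on_fibres] o_def ..
  also have "\<dots> = ?q powr (- of_nat k * (of_nat (card I) + ?e)) / of_nat (Suc q) ^ card I * (\<Prod>\<mu>\<in>fibres g I. tree_val q s \<mu>)"
    unfolding prod.distrib scale ..
  finally show "integral\<^sup>L (PJ J) (split_term k s I g) = ball_scale k s I * (\<Prod>\<mu>\<in>fibres g I. tree_val q s \<mu>)"
    by (simp only: ball_scale_def mult.assoc[symmetric] times_divide_eq_right pow)
qed

lemma fibres_proper:
  assumes "finite I" "2 \<le> card (fibres g I)" "\<mu> \<in> fibres g I"
  shows "\<mu> \<subset> I" "\<mu> \<noteq> {}"
proof -
  have "card \<mu> < card I" by (rule card_block_less[OF assms(1) partition_on_fibres assms(2,3)])
  then have "\<mu> \<noteq> I" by blast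
  moreover have "\<mu> \<subseteq> I" using assms(3) by (auto simp: fibres_def)
  ultimately show "\<mu> \<subset> I" by (rule psubsetI[rotated])
  show "\<mu> \<noteq> {}" using assms(3) by (auto simp: fibres_def)
qed

text \<open>The integral of a term depends on the assignment only through its fibre partition, so
  \<open>sum_PiE_fibres\<close> replaces assignments by partitions with multiplicity
  \<open>(q)_d\<close>. Having two fibres makes all blocks proper subsets, where \<open>good\<close>
  is available.\<close>

lemma
  assumes "J \<noteq> {}" "I \<subseteq> J" "finite I" "B \<in> U (Suc k)" "\<And>\<mu>. \<mu> \<subset> I \<Longrightarrow> \<mu> \<noteq> {} \<Longrightarrow> good J s \<mu>"
  shows integrable_hsplit: "integrable (PJ J) (hsplit (Suc k) s I B)"
    and integral_hsplit: "integral\<^sup>L (PJ J) (hsplit (Suc k) s I B) =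
      ball_scale (Suc k) s I * split_val q s I"
proof -
  let ?G = "{g \<in> I \<rightarrow>\<^sub>E children (Suc k) B. 2 \<le> card (fibres g I)}"
  have gd: "good J s \<mu>" if "g \<in> ?G" "\<mu> \<in> fibres g I" for g \<mu>
  proof -
    have "2 \<le> card (fibres g I)" using that(1) by simp
    from fibres_proper[OF assms(3) this that(2)] show ?thesis by (rule assms(5))
  qed
  have int: "integrable (PJ J) (split_term (Suc k) s I g)" if "g \<in> ?G" for g
    by (rule integrable_split_term[OF assms(1-4) _ gd[OF that]]) (use that in auto)
  have fin: "finite (I \<rightarrow>\<^sub>E children (Suc k) B)" using assms finite_children by (intro finite_PiE) auto
  show "integrable (PJ J) (hsplit (Suc k) s I B)"
    unfolding hsplit_def[abs_def]
    by (intro Bochner_Integration.integrable_sum int)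
  let ?c = "ball_scale (Suc k) s I"
  let ?F = "\<lambda>\<pi>. if 2 \<le> card \<pi> then \<Prod>\<mu>\<in>\<pi>. tree_val q s \<mu> else 0"
  have "integral\<^sup>L (PJ J) (hsplit (Suc k) s I B) = (\<Sum>g\<in>?G. integral\<^sup>L (PJ J) (split_term (Suc k) s I g))"
    unfolding hsplit_def[abs_def] by (rule Bochner_Integration.integral_sum[OF int])
  also have "\<dots> = (\<Sum>g\<in>?G. ?c * (\<Prod>\<mu>\<in>fibres g I. tree_val q s \<mu>))"
  proof (rule sum.cong[OF refl])
    fix g assume g: "g \<in> ?G"
    show "integral\<^sup>L (PJ J) (split_term (Suc k) s I g) = ?c * (\<Prod>\<mu>\<in>fibres g I. tree_val q s \<mu>)"
      by (rule integral_split_term[OF assms(1-4) _ gd[OF g]]) (use g in auto)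
  qed
  also have "\<dots> = ?c * (\<Sum>g\<in>?G. \<Prod>\<mu>\<in>fibres g I. tree_val q s \<mu>)" by (simp only: sum_distrib_left)
  also have "(\<Sum>g\<in>?G. \<Prod>\<mu>\<in>fibres g I. tree_val q s \<mu>) = (\<Sum>g\<in>I \<rightarrow>\<^sub>E children (Suc k) B. ?F (fibres g I))"
    by (rule sum.inter_filter[OF fin])
  also have "\<dots> = (\<Sum>\<pi>\<in>{\<pi>. partition_on I \<pi>}. of_nat (\<Prod>k<card \<pi>. q - k) * ?F \<pi>)"
    using sum_PiE_fibres[OF assms(3) finite_children[OF assms(4)], of ?F] card_children[OF assms(4)]
    by (simp add: children_def)
  also have "\<dots> = (\<Sum>\<pi>\<in>{\<pi>. partition_on I \<pi>}. if 2 \<le> card \<pi> then of_nat (\<Prod>k<card \<pi>. q - k) * (\<Prod>\<mu>\<in>\<pi>. tree_val q s \<mu>) else 0)"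
    by (rule sum.cong[OF refl]) simp
  also have "\<dots> = (\<Sum>\<pi>\<in>{\<pi> \<in> {\<pi>. partition_on I \<pi>}. 2 \<le> card \<pi>}. of_nat (\<Prod>k<card \<pi>. q - k) * (\<Prod>\<mu>\<in>\<pi>. tree_val q s \<mu>))"
    by (rule sum.inter_filter[OF finitely_many_partition_on[OF assms(3)], symmetric])
  also have "\<dots> = split_val q s I" unfolding split_val_def[OF q_ge_2] by simp
  finally show "integral\<^sup>L (PJ J) (hsplit (Suc k) s I B) = ?c * split_val q s I" .
qed

text \<open>The contribution of the tuples that stay in one ball for \<open>m\<close> levels below
  \<open>B\<close> and separate there; \<open>B\<close> itself has level
  \<open>Suc k\<close>.\<close>

definition hlevel :: "nat \<Rightarrow> nat \<Rightarrow> (nat \<Rightarrow> nat \<Rightarrow> complex) \<Rightarrow> nat set \<Rightarrow> 'a set \<Rightarrow> (nat \<Rightarrow> 'a) \<Rightarrow> complex" where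
  "hlevel k m s I B x = (\<Sum>C\<in>descendants (Suc k) B m. hsplit (Suc k + m) s I C x)"

text \<open>The ratio is the number of children times the scale of one step,
  \<open>q * q^(-(#I + esum)) = q^-e\<close>. No sign condition on \<open>e\<close> enters, so the
  formula serves both the convergent case and the divergence proof.\<close>

lemma
  assumes "J \<noteq> {}" "I \<subseteq> J" "finite I" "B \<in> U (Suc k)" "\<And>\<mu>. \<mu> \<subset> I \<Longrightarrow> \<mu> \<noteq> {} \<Longrightarrow> good J s \<mu>"
  shows integrable_hlevel: "integrable (PJ J) (hlevel k m s I B)"
    and integral_hlevel: "integral\<^sup>L (PJ J) (hlevel k m s I B) =
      ball_scale (Suc k) s I * split_val q s I * (of_nat q powr (- expo I s)) ^ m"
proof -
  have C: "C \<in> U (Suc (k + m))" if "C \<in> descendants (Suc k) B m" for C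
    using descendants_U[OF assms(4)] that by auto
  show "integrable (PJ J) (hlevel k m s I B)"
    unfolding hlevel_def[abs_def] add_Suc
    by (intro Bochner_Integration.integrable_sum integrable_hsplit[OF assms(1-3) C assms(5)])
  let ?q = "of_nat q :: complex" and ?e = "of_nat (card I) + esum s I"
  have "integral\<^sup>L (PJ J) (hlevel k m s I B) = (\<Sum>C\<in>descendants (Suc k) B m. integral\<^sup>L (PJ J) (hsplit (Suc (k + m)) s I C))"
    unfolding hlevel_def[abs_def] add_Suc
    by (subst Bochner_Integration.integral_sum) (use integrable_hsplit[OF assms(1-3) C assms(5)] in auto)
  also have "\<dots> = (\<Sum>C\<in>descendants (Suc k) B m. ball_scale (Suc (k + m)) s I * split_val q s I)"
    by (rule sum.cong[OF refl]) (rule integral_hsplit[OF assms(1-3) C assms(5)])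
  also have "\<dots> = ?q ^ m * (?q powr (- of_nat (Suc (k + m)) * ?e) / of_nat (Suc q) ^ card I * split_val q s I)"
    by (simp add: card_descendants[OF assms(4)] ball_scale_def)
  also have "?q powr (- of_nat (Suc (k + m)) * ?e) = ?q powr (- of_nat (Suc k) * ?e) * ?q powr (of_nat m * - ?e)"
    unfolding powr_q_add[OF q_ge_2, symmetric] by (simp add: algebra_simps)
  also have "?q powr (of_nat m * - ?e) = (?q powr (- ?e)) ^ m" by (rule powr_q_of_nat_mult[OF q_ge_2])
  also have "?q ^ m * (?q powr (- of_nat (Suc k) * ?e) * (?q powr (- ?e)) ^ m / of_nat (Suc q) ^ card I * split_val q s I) =
    ball_scale (Suc k) s I * split_val q s I * (?q * ?q powr (- ?e)) ^ m"
    by (simp add: power_mult_distrib ball_scale_def)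
  also have "?q * ?q powr (- ?e) = ?q powr (- expo I s)"
  proof -
    have "- expo I s = 1 + - ?e" by (simp add: expo_esum)
    then show ?thesis by (simp only: powr_q_add[OF q_ge_2] powr_q_1[OF q_ge_2])
  qed
  finally show "integral\<^sup>L (PJ J) (hlevel k m s I B) =
      ball_scale (Suc k) s I * split_val q s I * (?q powr (- expo I s)) ^ m" .
qed

subsection \<open>Summation over the levels of the tree\<close>

lemma split_term_re_part:
  assumes "g \<in> I \<rightarrow>\<^sub>E children k B"
  shows "split_term k (re_part s) I g x = complex_of_real (norm (split_term k s I g x))"
proof -
  let ?z = "- of_nat k * (esum s I - (\<Sum>\<mu>\<in>fibres g I. esum s \<mu>))"
  have "- of_nat k * (esum (re_part s) I - (\<Sum>\<mu>\<in>fibres g I. esum (re_part s) \<mu>)) = complex_of_real (Re ?z)"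
    by (simp add: esum_re_part Re_sum)
  then have "of_nat q powr (- of_nat k * (esum (re_part s) I - (\<Sum>\<mu>\<in>fibres g I. esum (re_part s) \<mu>))) =
      complex_of_real (norm (of_nat q powr ?z :: complex))"
    by (simp only: powr_q_of_real[OF q_ge_2] norm_powr_q[OF q_ge_2])
  moreover have "(\<Prod>D\<in>g ` I. hker (re_part s) {i\<in>I. g i = D} D x) =
      (\<Prod>D\<in>g ` I. complex_of_real (norm (hker s {i\<in>I. g i = D} D x)))"
  proof (rule prod.cong[OF refl])
    fix D assume "D \<in> g ` I"
    then have "D \<in> U (Suc k)" using assms by (auto simp: children_def)
    then show "hker (re_part s) {i\<in>I. g i = D} D x = complex_of_real (norm (hker s {i\<in>I. g i = D} D x))"
      by (rule norm_hker)
  qed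
  ultimately show ?thesis unfolding split_term_def norm_mult prod_norm[symmetric] of_real_mult of_real_prod by (simp only:)
qed

text \<open>Triangle inequality: for real exponents every term is nonnegative and equals the norm of
  the corresponding term for \<open>s\<close>.\<close>

lemma norm_hsplit_le: "norm (hsplit k s I B x) \<le> Re (hsplit k (re_part s) I B x)"
proof -
  have "hsplit k (re_part s) I B x =
      complex_of_real (\<Sum>g\<in>{g \<in> I \<rightarrow>\<^sub>E children k B. 2 \<le> card (fibres g I)}. norm (split_term k s I g x))"
    unfolding hsplit_def of_real_sum
    by (rule sum.cong[OF refl]) (rule split_term_re_part[of _ _ k B], simp)
  then show ?thesis by (simp add: hsplit_def sum_norm_le)
qed

lemma norm_hlevel_le: "norm (hlevel k m s I B x) \<le> Re (hlevel k m (re_part s) I B x)"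
  unfolding hlevel_def Re_sum by (rule sum_norm_le) (rule norm_hsplit_le)

lemma sum_hlevel_le:
  assumes "finite I" "I \<noteq> {}" "B \<in> U (Suc k)"
  shows "(\<Sum>m<n. Re (hlevel k m (re_part s) I B x)) \<le> norm (hker s I B x)"
proof -
  have "norm (hker s I B x) = Re (hker (re_part s) I B x)" unfolding norm_hker[OF assms(3)] by simp
  also have "\<dots> = (\<Sum>m<n. Re (hlevel k m (re_part s) I B x)) + (\<Sum>C\<in>descendants (Suc k) B n. Re (hker (re_part s) I C x))"
    unfolding hker_telescope[OF assms, of "re_part s" x n] hlevel_def by simp
  finally have eq: "norm (hker s I B x) = \<dots>" .
  have "0 \<le> (\<Sum>C\<in>descendants (Suc k) B n. Re (hker (re_part s) I C x))"
  proof (rule sum_nonneg)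
    fix C assume "C \<in> descendants (Suc k) B n"
    then have "C \<in> U (Suc k + n)" using descendants_U[OF assms(3)] by blast
    then show "0 \<le> Re (hker (re_part s) I C x)" by (simp add: norm_hker)
  qed
  then show ?thesis using eq by simp
qed

text \<open>Once two entries lie in different balls of level \<open>K\<close>, no ball of a deeper
  level contains the tuple, so the remainder vanishes and the partial sums are eventually constant.
  By \<open>AE_not_same\<close> this covers almost every tuple.\<close>

lemma hlevel_sums:
  assumes "finite I" "I \<noteq> {}" "B \<in> U (Suc k)" "i \<in> I" "j \<in> I" "\<not> same K (x i) (x j)"
  shows "(\<lambda>m. hlevel k m s I B x) sums hker s I B x"
  unfolding sums_def
proof (rule tendsto_eventually, rule eventually_sequentiallyI)
  fix n assume n: "K \<le> n"
  have "hker s I C x = 0" if "C \<in> descendants (Suc k) B n" for C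
  proof -
    have "C \<in> U (Suc k + n)" using descendants_U[OF assms(3)] that by blast
    moreover have "\<not> same (Suc k + n) (x i) (x j)"
      using same_antimono[of "Suc k + n" "x i" "x j" K] assms(6) n by auto
    ultimately have "\<not> (x i \<in> C \<and> x j \<in> C)" by (auto simp: same_def)
    then show ?thesis using assms(4,5) by (auto simp: hker_def)
  qed
  then show "(\<Sum>m<n. hlevel k m s I B x) = hker s I B x"
    unfolding hker_telescope[OF assms(1-3), of s x n] hlevel_def by simp
qed

lemma good_singleton:
  assumes "J \<noteq> {}" "i \<in> J"
  shows "good J s {i}"
  unfolding good_def
proof (intro allI ballI)
  fix k B assume B: "B \<in> U (Suc k)"
  have h: "hker s {i} B = (\<lambda>x. complex_of_real (indicator B (x i)))"
    by (rule ext) (simp add: hker_singleton)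
  have "pairs {i} = {}" by (auto simp: pairs_def)
  then have es: "esum s {i} = 0" by (simp add: esum_def)
  have "integrable (PJ J) (hker s {i} B)"
    unfolding h using integrable_coord[OF assms(2) U_sets[OF B]] by simp
  moreover have "integral\<^sup>L (PJ J) (hker s {i} B) = complex_of_real (1 / (real (Suc q) * real q ^ k))"
    unfolding h integral_complex_of_real integral_coord[OF assms(2) U_sets[OF B]] measure_ball[OF B] ..
  moreover have "of_nat q powr (- of_nat k * 1) = (inverse (of_nat q ^ k) :: complex)"
    using powr_q_of_nat_mult[OF q_ge_2, of k "-1"] powr_q_minus[OF q_ge_2, of 1] powr_q_1[OF q_ge_2]
    by (simp add: power_inverse)
  ultimately show "integrable (PJ J) (hker s {i} B) \<and> integral\<^sup>L (PJ J) (hker s {i} B) =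
      ball_scale k s {i} * tree_val q s {i}"
    by (simp add: ball_scale_def es tree_val_def[OF q_ge_2] tree_sum_singleton field_simps)
qed

text \<open>Termwise integration of the series of the \<open>hlevel\<close> terms. The majorant is
  the same formula for \<open>re_part s\<close>, whose ratio is also less than 1 in norm; this is
  why both exponent tuples are assumed good on proper subsets.\<close>

lemma good_step:
  assumes "J \<noteq> {}" "I \<subseteq> J" "finite I" "2 \<le> card I" "0 < Re (expo I s)"
    and "\<And>\<mu>. \<mu> \<subset> I \<Longrightarrow> \<mu> \<noteq> {} \<Longrightarrow> good J s \<mu>"
    and "\<And>\<mu>. \<mu> \<subset> I \<Longrightarrow> \<mu> \<noteq> {} \<Longrightarrow> good J (re_part s) \<mu>"
  shows "good J s I"
  unfolding good_def
proof (intro allI ballI)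
  fix k B assume B: "B \<in> U (Suc k)"
  let ?q = "of_nat q :: complex"
  define A where "A s = ball_scale (Suc k) s I * split_val q s I" for s
  have ne: "I \<noteq> {}" using assms(4) by auto
  have int: "integrable (PJ J) (hlevel k m s I B)" for m
    by (rule integrable_hlevel[OF assms(1-3) B assms(6)])
  have int_re: "integrable (PJ J) (hlevel k m (re_part s) I B)" for m
    by (rule integrable_hlevel[OF assms(1-3) B assms(7)])
  have val: "integral\<^sup>L (PJ J) (hlevel k m s I B) = A s * (?q powr (- expo I s)) ^ m" for m
    unfolding A_def by (rule integral_hlevel[OF assms(1-3) B assms(6)])
  have val_re: "integral\<^sup>L (PJ J) (hlevel k m (re_part s) I B) = A (re_part s) * (?q powr (- expo I (re_part s))) ^ m" for m
    unfolding A_def by (rule integral_hlevel[OF assms(1-3) B assms(7)])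
  have less: "norm (?q powr (- expo I s)) < 1" by (rule norm_powr_q_less_1[OF q_ge_2 assms(5)])
  have less_re: "norm (?q powr (- expo I (re_part s))) < 1"
    by (rule norm_powr_q_less_1[OF q_ge_2]) (use assms(5) in \<open>simp add: expo_re_part\<close>)
  obtain i j where ij: "i \<in> I" "j \<in> I" "i \<noteq> j" using assms(4) by (metis card_le_Suc0_iff_eq assms(3) not_less_eq_eq numeral_2_eq_2)
  have sums: "AE x in PJ J. (\<lambda>m. hlevel k m s I B x) sums hker s I B x"
  proof -
    have "AE x in PJ J. \<exists>K. \<not> same K (x i) (x j)" using AE_not_same ij assms(2) by blast
    then show ?thesis by eventually_elim (use hlevel_sums[OF assms(3) ne B ij(1,2)] in blast)
  qed
  have summable_x: "summable (\<lambda>m. norm (hlevel k m s I B x))" for x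
  proof (rule summable_comparison_test'[of "\<lambda>m. Re (hlevel k m (re_part s) I B x)" 0])
    show "summable (\<lambda>m. Re (hlevel k m (re_part s) I B x))"
    proof (rule summableI_nonneg_bounded[where x = "norm (hker s I B x)"])
      show "0 \<le> Re (hlevel k m (re_part s) I B x)" for m
        using norm_hlevel_le[of k m s I B x] norm_ge_zero order_trans by blast
      show "(\<Sum>m<n. Re (hlevel k m (re_part s) I B x)) \<le> norm (hker s I B x)" for n
        by (rule sum_hlevel_le[OF assms(3) ne B])
    qed
    show "norm (norm (hlevel k m s I B x)) \<le> Re (hlevel k m (re_part s) I B x)" for m
      using norm_hlevel_le[of k m s I B x] by simp
  qed
  have summable_int: "summable (\<lambda>m. integral\<^sup>L (PJ J) (\<lambda>x. norm (hlevel k m s I B x)))"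
  proof (rule summable_comparison_test')
    show "summable (\<lambda>m. norm (A (re_part s)) * norm (?q powr (- expo I (re_part s))) ^ m)"
      by (intro summable_mult summable_geometric) (use less_re in simp)
    fix m :: nat
    have "integral\<^sup>L (PJ J) (\<lambda>x. norm (hlevel k m s I B x)) \<le> integral\<^sup>L (PJ J) (\<lambda>x. Re (hlevel k m (re_part s) I B x))"
      by (intro integral_mono integrable_norm int integrable_Re int_re norm_hlevel_le)
    also have "\<dots> = Re (A (re_part s) * (?q powr (- expo I (re_part s))) ^ m)"
      unfolding val_re[symmetric] by (rule integral_Re[OF int_re])
    also have "\<dots> \<le> norm (A (re_part s) * (?q powr (- expo I (re_part s))) ^ m)" by (rule complex_Re_le_cmod)
    finally show "norm (integral\<^sup>L (PJ J) (\<lambda>x. norm (hlevel k m s I B x))) \<le>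
        norm (A (re_part s)) * norm (?q powr (- expo I (re_part s))) ^ m"
      by (simp add: norm_mult norm_power)
  qed
  note series = int AE_I2[OF summable_x] summable_int
  have hm: "hker s I B \<in> borel_measurable (PJ J)" by (rule measurable_hker[OF assms(2,3) B])
  have ae: "AE x in PJ J. (\<Sum>m. hlevel k m s I B x) = hker s I B x"
    using sums by eventually_elim (rule sums_unique[symmetric])
  have int_h: "integrable (PJ J) (hker s I B)"
    by (rule integrable_cong_AE_imp[OF integrable_suminf[OF series] hm]) (use ae in auto)
  have "(\<lambda>m. A s * (?q powr (- expo I s)) ^ m) sums integral\<^sup>L (PJ J) (\<lambda>x. \<Sum>m. hlevel k m s I B x)"
    using sums_integral[OF series] unfolding val .
  also have "integral\<^sup>L (PJ J) (\<lambda>x. \<Sum>m. hlevel k m s I B x) = integral\<^sup>L (PJ J) (hker s I B)"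
    by (rule integral_cong_AE[OF borel_measurable_integrable[OF integrable_suminf[OF series]] hm ae])
  finally have S: "(\<lambda>m. A s * (?q powr (- expo I s)) ^ m) sums integral\<^sup>L (PJ J) (hker s I B)" .
  have "(\<lambda>m. A s * (?q powr (- expo I s)) ^ m) sums (A s * (1 / (1 - ?q powr (- expo I s))))"
    by (intro sums_mult geometric_sums less)
  then have "integral\<^sup>L (PJ J) (hker s I B) = A s * (1 / (1 - ?q powr (- expo I s)))"
    using S sums_unique2 by blast
  also have "\<dots> = ball_scale k s I * tree_val q s I"
  proof -
    define E where "E = ?q powr expo I s"
    have E: "E \<noteq> 0" "E \<noteq> 1" using powr_q_nonzero[OF q_ge_2] powr_q_neq_1[OF q_ge_2 assms(5)] by (auto simp: E_def)
    have q0: "?q \<noteq> 0" using q_ge_2 by simp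
    \<comment> \<open>As \<open>#I + esum = e + 1\<close>, descending one level costs
      \<open>q^-e q^-1\<close>. Multiplied by \<open>q (q^e - 1)\<close> from
      \<open>split_val_eq\<close> and by \<open>1 / (1 - q^-e) = q^e / (q^e - 1)\<close> from the
      series, this becomes 1.\<close>
    have e1: "- of_nat (Suc k) * (of_nat (card I) + esum s I) =
        - of_nat k * (of_nat (card I) + esum s I) + (- expo I s + - 1)"
      by (simp add: expo_esum algebra_simps)
    have A: "A s = ?q powr (- of_nat k * (of_nat (card I) + esum s I)) * (inverse E * inverse ?q) / of_nat (Suc q) ^ card I *
        (?q * (E - 1) * tree_val q s I)"
      unfolding A_def ball_scale_def e1 powr_q_add[OF q_ge_2] powr_q_minus[OF q_ge_2] powr_q_1[OF q_ge_2]
        split_val_eq[OF q_ge_2 assms(3,4) E(2)[unfolded E_def]] E_def ..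
    have f: "1 - ?q powr (- expo I s) = (E - 1) / E" using E by (simp add: powr_q_minus[OF q_ge_2] E_def[symmetric] field_simps)
    have E1: "E - 1 \<noteq> 0" using E by simp
    have unit: "inverse E * inverse ?q * (?q * (E - 1)) * (1 / ((E - 1) / E)) = 1"
      using E q0 E1 by (simp add: field_simps)
    have "c * X / d * (Y * t) * Z = (X * Y * Z) * (c / d * t)" for c d t X Y Z :: complex
      by (simp add: divide_inverse mult_ac)
    then show ?thesis unfolding A f ball_scale_def by (simp only: unit mult_1_left)
  qed
  finally show "integrable (PJ J) (hker s I B) \<and> integral\<^sup>L (PJ J) (hker s I B) =
      ball_scale k s I * tree_val q s I"
    using int_h by blast
qed

text \<open>The induction keeps \<open>s\<close> arbitrary because \<open>good_step\<close> needs
  the proper subsets both for \<open>s\<close> and for \<open>re_part s\<close>.\<close>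

lemma good_of_expo:
  assumes "J \<noteq> {}" "finite J" "I \<subseteq> J" "I \<noteq> {}"
    and "\<And>\<mu>. \<mu> \<subseteq> I \<Longrightarrow> 1 < card \<mu> \<Longrightarrow> 0 < Re (expo \<mu> s)"
  shows "good J s I"
proof -
  have "finite I" using assms(2,3) finite_subset by blast
  then show ?thesis using assms(3-)
  proof (induction I arbitrary: s rule: finite_psubset_induct)
    case (psubset I)
    show ?case
    proof (cases "2 \<le> card I")
      case False
      then have "card I = 1" using psubset.hyps psubset.prems(2) by (metis One_nat_def Suc_1 card_0_eq le_less_linear less_2_cases)
      then obtain i where "I = {i}" by (rule card_1_singletonE)
      then show ?thesis using good_singleton[OF assms(1), of i s] psubset.prems by simp
    next
      case True
      show ?thesis
      proof (rule good_step[OF assms(1) psubset.prems(1) psubset.hyps True])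
        show "0 < Re (expo I s)" using psubset.prems(3)[of I] True by simp
        fix \<mu> assume m: "\<mu> \<subset> I" "\<mu> \<noteq> {}"
        show "good J s \<mu>"
          by (rule psubset.IH[OF m(1)]) (use m psubset.prems in auto)
        show "good J (re_part s) \<mu>"
          by (rule psubset.IH[OF m(1)]) (use m psubset.prems in \<open>auto simp: expo_re_part\<close>)
      qed
    qed
  qed
qed

text \<open>At the root one split suffices: the children have level 1, where \<open>good\<close>
  applies to all blocks, the whole of \<open>J\<close> included. Hence the one-block partition stays
  in the sum, and \<open>ball_scale 0\<close> leaves only
  \<open>1 / (q + 1) ^ card J\<close>.\<close>

lemma
  assumes "J \<noteq> {}" "finite J" and expo: "\<And>\<mu>. \<mu> \<subseteq> J \<Longrightarrow> 1 < card \<mu> \<Longrightarrow> 0 < Re (expo \<mu> s)"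
  shows integrable_total: "integrable (PJ J) (hker s J (space M))"
    and integral_total: "integral\<^sup>L (PJ J) (hker s J (space M)) =
      1 / of_nat (Suc q) ^ card J * (\<Sum>\<pi>\<in>{\<pi>. partition_on J \<pi>}. of_nat (\<Prod>k<card \<pi>. Suc q - k) * (\<Prod>\<mu>\<in>\<pi>. tree_val q s \<mu>))"
proof -
  have sp: "space M \<in> U 0" by (simp add: U_0)
  have gd: "good J s \<mu>" if "\<mu> \<in> fibres g J" for g \<mu>
    by (rule good_of_expo[OF assms(1,2)]) (use that expo in \<open>auto simp: fibres_def\<close>)
  let ?G = "J \<rightarrow>\<^sub>E children 0 (space M)"
  have h: "hker s J (space M) = (\<lambda>x. \<Sum>g\<in>?G. split_term 0 s J g x)"
    by (rule ext) (rule hker_split[OF assms(2) sp])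
  have int: "integrable (PJ J) (split_term 0 s J g)" if "g \<in> ?G" for g
    by (rule integrable_split_term[OF assms(1) subset_refl assms(2) sp that gd])
  show "integrable (PJ J) (hker s J (space M))"
    unfolding h by (intro Bochner_Integration.integrable_sum int)
  have "integral\<^sup>L (PJ J) (hker s J (space M)) = (\<Sum>g\<in>?G. integral\<^sup>L (PJ J) (split_term 0 s J g))"
    unfolding h by (rule Bochner_Integration.integral_sum[OF int])
  also have "\<dots> = (\<Sum>g\<in>?G. ball_scale 0 s J * (\<Prod>\<mu>\<in>fibres g J. tree_val q s \<mu>))"
    by (rule sum.cong[OF refl]) (rule integral_split_term[OF assms(1) subset_refl assms(2) sp _ gd])
  also have "\<dots> = 1 / of_nat (Suc q) ^ card J * (\<Sum>g\<in>?G. \<Prod>\<mu>\<in>fibres g J. tree_val q s \<mu>)"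
    unfolding sum_distrib_left ball_scale_def using powr_q_0[OF q_ge_2] by simp
  also have "(\<Sum>g\<in>?G. \<Prod>\<mu>\<in>fibres g J. tree_val q s \<mu>) =
      (\<Sum>\<pi>\<in>{\<pi>. partition_on J \<pi>}. of_nat (\<Prod>k<card \<pi>. Suc q - k) * (\<Prod>\<mu>\<in>\<pi>. tree_val q s \<mu>))"
    using sum_PiE_fibres[OF assms(2) finite_children[OF sp], of "\<lambda>\<pi>. \<Prod>\<mu>\<in>\<pi>. tree_val q s \<mu>"] card_children[OF sp]
    by (simp add: children_def)
  finally show "integral\<^sup>L (PJ J) (hker s J (space M)) =
      1 / of_nat (Suc q) ^ card J * (\<Sum>\<pi>\<in>{\<pi>. partition_on J \<pi>}. of_nat (\<Prod>k<card \<pi>. Suc q - k) * (\<Prod>\<mu>\<in>\<pi>. tree_val q s \<mu>))" .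
qed

section \<open>Divergence outside \<open>Omega\<close>\<close>

lemma kern_mult_le:
  assumes "I \<subseteq> J" "finite J" "B \<in> U 1" "B' \<in> U 1" "B \<noteq> B'"
  shows "norm (hker s I B x) * norm (hker s (J - I) B' x) \<le> norm (hker s J (space M) x)"
proof (cases "(\<forall>i\<in>I. x i \<in> B) \<and> (\<forall>i\<in>J - I. x i \<in> B')")
  case False
  have "hker s I B x = 0 \<or> hker s (J - I) B' x = 0"
  proof (cases "\<forall>i\<in>I. x i \<in> B")
    case True
    then have "\<not> (\<forall>i\<in>J - I. x i \<in> B')" using False by blast
    then show ?thesis by (simp only: hker_def if_False simp_thms)
  qed (simp only: hker_def if_False simp_thms)
  then show ?thesis by auto
next
  case True
  have sub: "B \<subseteq> space M" "B' \<subseteq> space M" using assms ball_subset_space by auto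
  have fin: "finite I" using assms finite_subset by blast
  let ?f = "\<lambda>(i, j). complex_of_real (\<delta> (x i) (x j)) powr s i j"
  \<comment> \<open>Points of distinct balls of level 1 separate at the root, at distance
    \<open>q^0 = 1\<close>. All mixed factors of the kernel are therefore 1, and it factors over
    \<open>I\<close> and \<open>J - I\<close>.\<close>
  have dist: "\<delta> a b = 1" if "a \<in> B \<and> b \<in> B' \<or> a \<in> B' \<and> b \<in> B" for a b
  proof -
    have "\<not> (\<exists>C\<in>U (Suc 0). a \<in> C \<and> b \<in> C)"
      using U_eq[of _ "Suc 0"] assms(3-5) that by (metis One_nat_def)
    moreover have "a \<in> space M" "b \<in> space M" using that sub by auto
    ultimately show ?thesis using \<delta>_level[of "space M" 0 a b] by (simp add: U_0)
  qed
  have one: "?f p = 1" if p: "p \<in> pairs J - (pairs I \<union> pairs (J - I))" for p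
  proof -
    obtain i j where ij: "p = (i, j)" "i \<in> J" "j \<in> J" "i \<in> I \<longleftrightarrow> j \<notin> I" using p by (auto simp: pairs_def)
    then have "\<delta> (x i) (x j) = 1" using True by (intro dist) auto
    then show ?thesis by (simp add: ij)
  qed
  have "kern s J x = (\<Prod>p\<in>pairs I \<union> pairs (J - I). ?f p)"
    unfolding kern_def
  proof (rule prod.mono_neutral_right)
    show "pairs I \<union> pairs (J - I) \<subseteq> pairs J" using assms(1) by (auto simp: pairs_def)
    show "\<forall>p\<in>pairs J - (pairs I \<union> pairs (J - I)). ?f p = 1" using one by blast
  qed (rule finite_pairs[OF assms(2)])
  also have "\<dots> = kern s I x * kern s (J - I) x"
    unfolding kern_def
  proof (rule prod.union_disjoint)
    show "finite (pairs I)" "finite (pairs (J - I))" using fin assms(2) by auto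
    show "pairs I \<inter> pairs (J - I) = {}" by (auto simp: pairs_def)
  qed
  finally have "kern s J x = kern s I x * kern s (J - I) x" .
  moreover have "\<forall>i\<in>J. x i \<in> space M" using True sub by blast
  ultimately show ?thesis using True by (simp add: hker_def norm_mult)
qed

lemma kern_nonzero:
  assumes "\<And>i. i \<in> I \<Longrightarrow> x i \<in> space M" "\<And>i j. i \<in> I \<Longrightarrow> j \<in> I \<Longrightarrow> i \<noteq> j \<Longrightarrow> \<exists>K. \<not> same K (x i) (x j)" "finite I"
  shows "kern s I x \<noteq> 0"
proof -
  have "\<delta> (x i) (x j) \<noteq> 0" if "(i, j) \<in> pairs I" for i j
  proof -
    have ij: "i \<in> I" "j \<in> I" "i \<noteq> j" using that by (auto simp: pairs_def)
    obtain K where "\<not> same K (x i) (x j)" using assms(2)[OF ij] by blast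
    then obtain k where "same k (x i) (x j)" "\<not> same (Suc k) (x i) (x j)"
      using same_level assms(1) ij by metis
    then have "\<delta> (x i) (x j) = 1 / real q ^ k" by (rule \<delta>_same)
    then show ?thesis using q_ge_2 by simp
  qed
  then show ?thesis unfolding kern_def using assms(3) by (auto simp: prod_zero_iff)
qed

text \<open>The truncation is needed because the kernel of the complementary block may itself have infinite integral.\<close>

lemma truncated_kernel_pos:
  assumes "J \<noteq> {}" "I \<subseteq> J" "finite J" "B \<in> U (Suc k)"
  shows "0 < integral\<^sup>L (PJ J) (\<lambda>x. min 1 (norm (hker s I B x)))"
proof -
  interpret P: prob_space "PJ J" by (rule prob_space_PJ)
  have fin: "finite I" using assms finite_subset by blast
  have [measurable]: "hker s I B \<in> borel_measurable (PJ J)" by (rule measurable_hker[OF assms(2) fin assms(4)])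
  have int: "integrable (PJ J) (\<lambda>x. min 1 (norm (hker s I B x)))"
    by (rule P.integrable_const_bound[of _ 1]) auto
  have "integral\<^sup>L (PJ J) (\<lambda>x. min 1 (norm (hker s I B x))) \<noteq> 0"
  proof
    assume "integral\<^sup>L (PJ J) (\<lambda>x. min 1 (norm (hker s I B x))) = 0"
    then have "AE x in PJ J. min 1 (norm (hker s I B x)) = 0"
      using integral_nonneg_eq_0_iff_AE[OF int] by simp
    then have "AE x in PJ J. hker s I B x = 0" by eventually_elim (auto simp: min_def split: if_splits)
    moreover have "AE x in PJ J. \<forall>i\<in>I. \<forall>j\<in>I. i \<noteq> j \<longrightarrow> (\<exists>K. \<not> same K (x i) (x j))"
      using fin assms(2) AE_not_same by (intro AE_finite_allI) (auto simp: subset_iff)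
    moreover have "AE x in PJ J. x \<in> space (PJ J)" by (rule AE_space)
    ultimately have "AE x in PJ J. \<not> (\<forall>i\<in>I. x i \<in> B)"
    proof eventually_elim
      case (elim x)
      then have "kern s I x \<noteq> 0" using assms(2) fin PJ_in_space by (intro kern_nonzero) auto
      then show ?case using elim(1) by (metis hker_def)
    qed
    then have "measure (PJ J) {x \<in> space (PJ J). \<forall>i\<in>I. x i \<in> B} = 0"
      by (intro P.prob_eq_0_AE) simp
    then show False
      using measure_box[OF fin assms(2,1) U_sets[OF assms(4)]] measure_ball[OF assms(4)] q_ge_2 by simp
  qed
  moreover have "0 \<le> integral\<^sup>L (PJ J) (\<lambda>x. min 1 (norm (hker s I B x)))" by (rule integral_nonneg_AE) auto
  ultimately show ?thesis by (auto simp only: less_le)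
qed

text \<open>A minimal \<open>S\<close> with \<open>Re e \<le> 0\<close> has all its proper subsets
  in the convergent range, so \<open>integral_hlevel\<close> gives its level integrals; for real
  exponents they are \<open>a\<close> times powers of \<open>q^(-Re e) \<ge> 1\<close>. With
  \<open>S\<close> placed in one ball of level 1 and the other indices in another, the first
  \<open>n\<close> levels force the integral of the norm to be at least \<open>n\<close> times a
  positive constant.\<close>

lemma integrable_imp_expo_pos:
  assumes "J \<noteq> {}" "finite J" "integrable (PJ J) (hker s J (space M))" "I \<subseteq> J" "1 < card I"
  shows "0 < Re (expo I s)"
proof (rule ccontr)
  assume "\<not> 0 < Re (expo I s)"
  then have "I \<in> {I. I \<subseteq> J \<and> 1 < card I \<and> Re (expo I s) \<le> 0}" using assms by simp
  moreover have "finite {I. I \<subseteq> J \<and> 1 < card I \<and> Re (expo I s) \<le> 0}" using assms(2) by simp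
  ultimately obtain S where S: "S \<subseteq> J" "1 < card S" "Re (expo S s) \<le> 0"
    and min: "\<And>T. T \<subset> S \<Longrightarrow> 1 < card T \<Longrightarrow> 0 < Re (expo T s)"
    using finite_has_minimal2[of "{I. I \<subseteq> J \<and> 1 < card I \<and> Re (expo I s) \<le> 0}" I]
    by (smt (verit) mem_Collect_eq not_le order.trans psubset_eq)
  interpret P: prob_space "PJ J" by (rule prob_space_PJ)
  have finS: "finite S" using S(1) assms(2) finite_subset by blast
  have neS: "S \<noteq> {}" using S(2) by auto
  have sp: "space M \<in> U 0" by (simp add: U_0)
  have "2 \<le> card (children 0 (space M))" using card_children[OF sp] q_ge_2 by (simp add: children_def)
  then obtain B B' where BB: "B \<in> children 0 (space M)" "B' \<in> children 0 (space M)" "B \<noteq> B'"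
    by (metis card_le_Suc0_iff_eq finite_children[OF sp] not_less_eq_eq numeral_2_eq_2)
  then have B: "B \<in> U (Suc 0)" "B' \<in> U (Suc 0)" by (auto simp: children_def)
  have gd: "good J (re_part s) \<mu>" if m: "\<mu> \<subset> S" "\<mu> \<noteq> {}" for \<mu>
  proof (rule good_of_expo[OF assms(1,2) _ m(2)])
    show "\<mu> \<subseteq> J" using m S by blast
    show "0 < Re (expo \<mu>' (re_part s))" if "\<mu>' \<subseteq> \<mu>" "1 < card \<mu>'" for \<mu>'
      using min[of \<mu>'] that m(1) by (auto simp: expo_re_part)
  qed
  have tv: "\<exists>r>0. tree_val q (re_part s) \<mu> = complex_of_real r" if m: "\<mu> \<subset> S" "\<mu> \<noteq> {}" for \<mu>
  proof (rule tree_val_pos[OF q_ge_2 _ m(2)])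
    show "finite \<mu>" using m finS finite_subset by blast
    show "0 < Re (expo \<mu>' s)" if "\<mu>' \<subseteq> \<mu>" "1 < card \<mu>'" for \<mu>' using min[of \<mu>'] that m(1) by auto
  qed
  obtain r where r: "0 < r" "split_val q (re_part s) S = complex_of_real r"
    using split_val_pos[OF q_ge_2 finS _ tv] S(2) by auto
  \<comment> \<open>The integral of level \<open>m = 0\<close> for real exponents: the scale
    belonging to a split of a ball of level 1, times \<open>split_val\<close>.\<close>
  define a where "a = real q powr (- (real (card S) + Re (esum s S))) / real (Suc q) ^ card S * r"
  have a: "0 < a" using r q_ge_2 by (simp add: a_def)
  let ?R = "\<lambda>m x. Re (hlevel 0 m (re_part s) S B x)"
  \<comment> \<open>If \<open>S = J\<close> there are no other indices, and this factor is
    constantly 1.\<close>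
  let ?t = "\<lambda>x. min 1 (norm (hker s (J - S) B' x))"
  have val: "a \<le> integral\<^sup>L (PJ J) (?R m)" for m
  proof -
    have int: "integrable (PJ J) (hlevel 0 m (re_part s) S B)"
      by (rule integrable_hlevel[OF assms(1) S(1) finS B(1) gd])
    have e1: "- of_nat (Suc 0) * (of_nat (card S) + esum (re_part s) S) = complex_of_real (- (real (card S) + Re (esum s S)))"
      by (simp add: esum_re_part)
    have e2: "- expo S (re_part s) = complex_of_real (- Re (expo S s))" by (simp add: expo_re_part)
    have "integral\<^sup>L (PJ J) (hlevel 0 m (re_part s) S B) =
        ball_scale (Suc 0) (re_part s) S * split_val q (re_part s) S * (of_nat q powr (- expo S (re_part s))) ^ m"
      by (rule integral_hlevel[OF assms(1) S(1) finS B(1) gd])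
    also have "\<dots> = complex_of_real (a * (real q powr (- Re (expo S s))) ^ m)"
      unfolding ball_scale_def e1 e2 powr_q_of_real[OF q_ge_2] r(2) a_def by simp
    finally have "integral\<^sup>L (PJ J) (hlevel 0 m (re_part s) S B) = complex_of_real (a * (real q powr (- Re (expo S s))) ^ m)" .
    then have "integral\<^sup>L (PJ J) (?R m) = a * (real q powr (- Re (expo S s))) ^ m"
      using integral_Re[OF int] by simp
    moreover have "1 \<le> (real q powr (- Re (expo S s))) ^ m"
      by (rule one_le_power) (rule norm_powr_q_ge_1[OF q_ge_2 S(3)])
    ultimately show ?thesis using a by simp
  qed
  have int_R: "integrable (PJ J) (?R m)" for m
    by (intro integrable_Re integrable_hlevel[OF assms(1) S(1) finS B(1) gd])
  have meas_t: "?t \<in> borel_measurable (PJ J')" if "J - S \<subseteq> J'" for J'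
  proof -
    have [measurable]: "hker s (J - S) B' \<in> borel_measurable (PJ J')"
      using measurable_hker[OF that _ B(2)] assms(2) by simp
    show ?thesis by measurable
  qed
  have int_t: "integrable (PJ J) ?t"
    by (rule P.integrable_const_bound[of _ 1]) (auto intro: meas_t)
  have meas_R: "(\<lambda>x. ?R m x) \<in> borel_measurable (PJ S)" for m
  proof -
    have *: "hker (re_part s) {i \<in> S. g i = D} D \<in> borel_measurable (PJ S)"
      if "g \<in> S \<rightarrow>\<^sub>E children l C" "D \<in> g ` S" for g D l C
      by (rule measurable_hker[of _ _ _ "Suc l"]) (use that finS in \<open>auto simp: children_def\<close>)
    have [measurable]: "hsplit l (re_part s) S C \<in> borel_measurable (PJ S)" for l C
      unfolding hsplit_def[abs_def] split_term_def
      by (intro borel_measurable_sum borel_measurable_times borel_measurable_const borel_measurable_prod *) auto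
    show ?thesis unfolding hlevel_def[abs_def] by measurable
  qed
  have R_restrict: "?R m (restrict x S) = ?R m x" for m x
  proof -
    have *: "hker (re_part s) {i \<in> S. g i = D} D (restrict x S) = hker (re_part s) {i \<in> S. g i = D} D x" for g D
      using hker_restrict[of "re_part s" "{i \<in> S. g i = D}" D "restrict x S"] hker_restrict[of "re_part s" "{i \<in> S. g i = D}" D x]
      by (simp add: Int_absorb1 Int_Collect conj_commute cong: rev_conj_cong)
    show ?thesis unfolding hlevel_def hsplit_def split_term_def * ..
  qed
  have t_restrict: "?t (restrict x (J - S)) = ?t x" for x by (simp add: hker_restrict)
  have prod: "integrable (PJ J) (\<lambda>x. ?R m x * ?t x) \<and> integral\<^sup>L (PJ J) (\<lambda>x. ?R m x * ?t x) = integral\<^sup>L (PJ J) (?R m) * integral\<^sup>L (PJ J) ?t" for m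
  proof -
    \<comment> \<open>Two factors on complementary sets of coordinates, indexed by
      \<open>bool\<close> to fit the general product lemma.\<close>
    let ?f = "\<lambda>b. if b then ?R m else ?t" and ?K = "\<lambda>b. if b then S else J - S"
    have c: "disjoint_family_on ?K UNIV" "\<And>l. ?K l \<subseteq> J" "\<And>l. ?f l \<in> borel_measurable (PJ (?K l))"
        "\<And>l x. ?f l (restrict x (?K l)) = ?f l x" "\<And>l. integrable (PJ J) (?f l)"
      using S(1) meas_R meas_t R_restrict t_restrict int_R int_t by (auto simp: disjoint_family_on_def)
    have "integrable (PJ J) (\<lambda>x. \<Prod>b\<in>UNIV. ?f b x)"
      by (rule integrable_prod_blocks[OF assms(1) finite c])
    moreover have "integral\<^sup>L (PJ J) (\<lambda>x. \<Prod>b\<in>UNIV. ?f b x) = (\<Prod>b\<in>UNIV. integral\<^sup>L (PJ J) (?f b))"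
      by (rule integral_prod_blocks[OF assms(1) finite c])
    ultimately have *: "integrable (PJ J) (\<lambda>x. \<Prod>b\<in>UNIV. ?f b x) \<and>
        integral\<^sup>L (PJ J) (\<lambda>x. \<Prod>b\<in>UNIV. ?f b x) = (\<Prod>b\<in>UNIV. integral\<^sup>L (PJ J) (?f b))" ..
    then show ?thesis by (simp add: UNIV_bool mult.commute)
  qed
  define \<tau> where "\<tau> = integral\<^sup>L (PJ J) ?t"
  have tau: "0 < \<tau>" unfolding \<tau>_def by (rule truncated_kernel_pos[OF assms(1) _ assms(2) B(2)]) auto
  have bound: "real n * (a * \<tau>) \<le> integral\<^sup>L (PJ J) (\<lambda>x. norm (hker s J (space M) x))" for n
  proof -
    have "real n * (a * \<tau>) = (\<Sum>m<n. a * \<tau>)" by simp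
    also have "\<dots> \<le> (\<Sum>m<n. integral\<^sup>L (PJ J) (\<lambda>x. ?R m x * ?t x))"
      using prod val tau by (intro sum_mono) (simp add: \<tau>_def[symmetric] mult_right_mono)
    also have "\<dots> = integral\<^sup>L (PJ J) (\<lambda>x. \<Sum>m<n. ?R m x * ?t x)"
      by (rule Bochner_Integration.integral_sum[symmetric]) (use prod in blast)
    also have "\<dots> \<le> integral\<^sup>L (PJ J) (\<lambda>x. norm (hker s J (space M) x))"
    proof (rule integral_mono)
      show "integrable (PJ J) (\<lambda>x. \<Sum>m<n. ?R m x * ?t x)"
        by (rule Bochner_Integration.integrable_sum) (use prod in blast)
      show "integrable (PJ J) (\<lambda>x. norm (hker s J (space M) x))" by (rule integrable_norm[OF assms(3)])
      fix x
      have "(\<Sum>m<n. ?R m x * ?t x) = (\<Sum>m<n. ?R m x) * ?t x" by (simp only: sum_distrib_right)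
      also have "\<dots> \<le> norm (hker s S B x) * norm (hker s (J - S) B' x)"
        by (rule mult_mono[OF sum_hlevel_le[OF finS neS B(1)]]) auto
      also have "\<dots> \<le> norm (hker s J (space M) x)"
        using kern_mult_le[OF S(1) assms(2)] B BB(3) by simp
      finally show "(\<Sum>m<n. ?R m x * ?t x) \<le> norm (hker s J (space M) x)" .
    qed
    finally show ?thesis .
  qed
  obtain n where "integral\<^sup>L (PJ J) (\<lambda>x. norm (hker s J (space M) x)) < real n * (a * \<tau>)"
    using reals_Archimedean3[of "a * \<tau>"] a tau by auto
  then show False using bound[of n] by simp
qed

end

subsection \<open>Nonarchimedean local fields\<close>

lemma card_image_eq_iff:
  assumes "\<And>x y. x \<in> A \<Longrightarrow> y \<in> A \<Longrightarrow> f x = f y \<longleftrightarrow> g x = g y"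
  shows "card (f ` A) = card (g ` A)"
proof -
  have h: "g (SOME a. a \<in> A \<and> f a = f x) = g x" if x: "x \<in> A" for x
  proof -
    have "(SOME a. a \<in> A \<and> f a = f x) \<in> A \<and> f (SOME a. a \<in> A \<and> f a = f x) = f x"
      by (rule someI[of _ x]) (use x in simp)
    then show ?thesis using assms x by metis
  qed
  have "bij_betw (\<lambda>y. g (SOME a. a \<in> A \<and> f a = y)) (f ` A) (g ` A)"
    unfolding bij_betw_def
  proof
    show "inj_on (\<lambda>y. g (SOME a. a \<in> A \<and> f a = y)) (f ` A)"
      using h assms by (auto simp: inj_on_def)
    show "(\<lambda>y. g (SOME a. a \<in> A \<and> f a = y)) ` f ` A = g ` A"
      unfolding image_image by (rule image_cong[OF refl h])
  qed
  then show ?thesis by (rule bij_betw_same_card)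
qed

locale local_field =
  fixes v :: "'k::field \<Rightarrow> real"
  assumes lf: "nonarch_local_field v"
begin

definition q :: nat where "q = residue_card v"

lemma abs: "nonarch_abs v" using lf by (simp add: nonarch_local_field_def)

lemma v_nonneg [simp]: "0 \<le> v x" and v_eq_0 [simp]: "v x = 0 \<longleftrightarrow> x = 0"
  and v_mult: "v (x * y) = v x * v y" and v_add: "v (x + y) \<le> max (v x) (v y)"
  using abs by (auto simp: nonarch_abs_def)

lemma v_0 [simp]: "v 0 = 0" by simp

lemma v_1 [simp]: "v 1 = 1"
  using v_mult[of 1 1] v_eq_0[of 1] by simp

lemma v_minus [simp]: "v (- x) = v x"
proof -
  have "v (- 1) = 1" using v_mult[of "- 1" "- 1"] v_nonneg[of "- 1"] by (simp add: square_eq_1_iff)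
  then show ?thesis using v_mult[of "- 1" x] by simp
qed

lemma v_diff_commute: "v (x - y) = v (y - x)"
  using v_minus[of "x - y"] by simp

lemma v_diff: "v (x - y) \<le> max (v x) (v y)"
  using v_add[of x "- y"] by simp

lemma v_pos: "x \<noteq> 0 \<Longrightarrow> 0 < v x"
  using v_nonneg[of x] v_eq_0[of x] by (simp add: less_le del: v_eq_0 v_nonneg)

lemma v_inverse: "v (inverse x) = inverse (v x)"
proof (cases "x = 0")
  case False
  then have "v x * v (inverse x) = 1" using v_mult[of x "inverse x"] by simp
  then show ?thesis using False by (simp add: field_simps)
qed simp

lemma v_divide: "v (x / y) = v x / v y"
  by (simp add: divide_inverse v_mult v_inverse)

lemma v_power: "v (x ^ n) = v x ^ n"
  by (induction n) (simp_all add: v_mult)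

lemma v_eq_of_close: "v (x - y) < v x \<Longrightarrow> v y = v x"
proof -
  assume *: "v (x - y) < v x"
  have "v y \<le> max (v x) (v (x - y))" using v_diff[of x "x - y"] by simp
  moreover have "v x \<le> max (v y) (v (x - y))" using v_add[of y "x - y"] by simp
  ultimately show ?thesis using * by auto
qed

lemma exists_small: "\<exists>c. 0 < v c \<and> v c < 1"
proof -
  obtain x where x: "x \<noteq> 0" "v x \<noteq> 1" using lf by (auto simp: nonarch_local_field_def)
  show ?thesis
  proof (cases "v x < 1")
    case True
    then show ?thesis using v_pos x by blast
  next
    case False
    then have "v (inverse x) < 1" using x by (simp add: v_inverse inverse_less_1_iff)
    then show ?thesis using v_pos[of "inverse x"] x by auto
  qed
qed

lemma metric: "Metric_space UNIV (\<lambda>x y. v (x - y))"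
  by (rule Metric_space_abs[OF abs])

text \<open>Local compactness gives a compact, hence totally bounded, set around 0 that contains a
  ball. Multiplication by a small \<open>a\<close> carries the unit ball into it, and a cover there
  by balls of radius \<open>e * v a\<close> is carried back to one of radius
  \<open>e\<close>.\<close>

lemma int_ring_totally_bounded:
  assumes "0 < e"
  shows "\<exists>K. finite K \<and> (\<forall>x. v x \<le> 1 \<longrightarrow> (\<exists>k\<in>K. v (x - k) < e))"
proof -
  interpret Metric_space UNIV "\<lambda>x y. v (x - y)" by (rule metric)
  have "locally_compact_space mtopology" using lf by (simp add: nonarch_local_field_def field_topology_def)
  then obtain U K where U: "openin mtopology U" "compactin mtopology K" "0 \<in> U" "U \<subseteq> K"
    unfolding locally_compact_space_def topspace_mtopology by blast
  then obtain r where r: "0 < r" "mball 0 r \<subseteq> U" unfolding openin_mtopology by blast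
  obtain c where c: "0 < v c" "v c < 1" using exists_small by blast
  obtain n where n: "v c ^ n < r" using real_arch_pow_inv[OF r(1) c(2)] by blast
  define a where "a = c ^ n"
  have a: "v a < r" "0 < v a" "a \<noteq> 0" using n c by (auto simp: a_def v_power)
  have "mtotally_bounded K" using U(2) by (rule compactin_imp_mtotally_bounded)
  moreover have "0 < e * v a" using assms a by simp
  ultimately obtain F where F: "finite F" "K \<subseteq> (\<Union>x\<in>F. mball x (e * v a))"
    unfolding mtotally_bounded_def by blast
  have "\<exists>k\<in>(\<lambda>y. y / a) ` F. v (x - k) < e" if x: "v x \<le> 1" for x
  proof -
    have "v (a * x) \<le> v a" using x a by (simp add: v_mult mult_left_le)
    then have "a * x \<in> mball 0 r" using a by simp
    then obtain y where y: "y \<in> F" "a * x \<in> mball y (e * v a)" using r U F by blast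
    then have "v (a * (x - y / a)) < e * v a"
      using a by (simp add: right_diff_distrib v_diff_commute[of y])
    then have "v (x - y / a) < e" using a by (simp add: v_mult mult.commute)
    then show ?thesis using y by blast
  qed
  then show ?thesis using F by (intro exI[of _ "(\<lambda>y. y / a) ` F"]) auto
qed

abbreviation resid :: "('k \<times> 'k) set" where
  "resid \<equiv> {(x, y). x \<in> int_ring v \<and> y \<in> int_ring v \<and> x - y \<in> max_ideal v}"

lemma resid_class_eq_iff:
  assumes "v x \<le> 1" "v y \<le> 1"
  shows "resid `` {x} = resid `` {y} \<longleftrightarrow> v (x - y) < 1"
proof
  assume "resid `` {x} = resid `` {y}"
  moreover have "x \<in> resid `` {x}" using assms by (auto simp: int_ring_def max_ideal_def)
  ultimately have "x \<in> resid `` {y}" by simp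
  then show "v (x - y) < 1" by (simp add: max_ideal_def v_diff_commute[of x])
next
  have *: "v (y - z) < 1" if "v (x - y) < 1" "v (x - z) < 1" for x y z
    using v_diff[of "x - z" "x - y"] that by simp
  assume "v (x - y) < 1"
  then show "resid `` {x} = resid `` {y}"
    using assms *[of x y] *[of y x] by (auto simp: int_ring_def max_ideal_def v_diff_commute[of y x])
qed

lemma residue_classes_eq: "residue_classes v = (\<lambda>x. resid `` {x}) ` {x. v x \<le> 1}"
  by (auto simp: residue_classes_def quotient_def int_ring_def)

lemma finite_residue_classes: "finite (residue_classes v)"
proof -
  obtain K where K: "finite K" "\<And>x. v x \<le> 1 \<Longrightarrow> \<exists>k\<in>K. v (x - k) < 1"
    using int_ring_totally_bounded[of 1] by auto
  have "residue_classes v \<subseteq> (\<lambda>x. resid `` {x}) ` K"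
  proof
    fix c assume "c \<in> residue_classes v"
    then obtain x where x: "v x \<le> 1" "c = resid `` {x}" by (auto simp: residue_classes_eq)
    then obtain k where k: "k \<in> K" "v (x - k) < 1" using K by blast
    have "v k \<le> 1" using v_diff[of x "x - k"] x k by simp
    then have "c = resid `` {k}" using resid_class_eq_iff[OF x(1), of k] x(2) k(2) by simp
    then show "c \<in> (\<lambda>x. resid `` {x}) ` K" using k by blast
  qed
  then show ?thesis using K(1) finite_subset by blast
qed

lemma q_ge_2: "2 \<le> q"
proof -
  have "resid `` {0} \<noteq> resid `` {1}" using resid_class_eq_iff[of 0 1] by simp
  then have "card {resid `` {0}, resid `` {1}} = 2" by (rule card_2_iff[THEN iffD2, OF exI, OF exI, OF conjI, OF refl])
  moreover have "{resid `` {0}, resid `` {1}} \<subseteq> residue_classes v"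
    unfolding residue_classes_eq insert_subset by (intro conjI imageI empty_subsetI) auto
  then have "card {resid `` {0}, resid `` {1}} \<le> card (residue_classes v)"
    by (rule card_mono[OF finite_residue_classes])
  ultimately show ?thesis unfolding q_def residue_card_def by simp
qed

text \<open>A cover of the unit ball by balls of radius \<open>v c\<close> shows that
  \<open>v\<close> takes only finitely many values in \<open>[v c, 1)\<close>: by
  \<open>v_eq_of_close\<close> each is taken at one of the centres. An element of largest value
  below 1 generates the maximal ideal, and the normalization in \<open>nonarch_local_field\<close>
  fixes that value.\<close>

lemma exists_uniformizer: "\<exists>p. v p = 1 / real q \<and> (\<forall>x. v x < 1 \<longrightarrow> v x \<le> 1 / real q)"
proof -
  obtain c where c: "0 < v c" "v c < 1" using exists_small by blast
  obtain K where K: "finite K" "\<And>x. v x \<le> 1 \<Longrightarrow> \<exists>k\<in>K. v (x - k) < v c"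
    using int_ring_totally_bounded[OF c(1)] by auto
  define S where "S = v ` {x. v c \<le> v x \<and> v x < 1}"
  have "S \<subseteq> v ` K"
  proof
    fix y assume "y \<in> S"
    then obtain x where x: "y = v x" "v c \<le> v x" "v x < 1" by (auto simp: S_def)
    then obtain k where "k \<in> K" "v (x - k) < v c" using K(2)[of x] by auto
    then show "y \<in> v ` K" using v_eq_of_close[of x k] x by (metis image_eqI order_less_le_trans)
  qed
  then have "finite S" using K(1) finite_subset by blast
  moreover have "v c \<in> S" using c by (auto simp: S_def)
  ultimately have "Max S \<in> S" and top: "\<And>y. y \<in> S \<Longrightarrow> y \<le> Max S" by (auto intro: Max_in)
  then obtain p where p: "v p = Max S" "v c \<le> v p" "v p < 1" by (auto simp: S_def)
  have le: "v x \<le> v p" if "v x < 1" for x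
  proof (cases "v c \<le> v x")
    case True
    then have "v x \<in> S" using that by (auto simp: S_def)
    then show ?thesis using top p by simp
  qed (use p in simp)
  have p0: "p \<noteq> 0" using p c by auto
  have "max_ideal v = {p * r | r. r \<in> int_ring v}"
  proof (intro equalityI subsetI)
    fix x assume "x \<in> max_ideal v"
    then have "v (x / p) \<le> 1" using le[of x] p0 v_pos by (simp add: max_ideal_def v_divide)
    then show "x \<in> {p * r | r. r \<in> int_ring v}" using p0 by (auto simp: int_ring_def intro!: exI[of _ "x / p"])
  next
    fix x assume "x \<in> {p * r | r. r \<in> int_ring v}"
    then obtain r where "x = p * r" "v r \<le> 1" by (auto simp: int_ring_def)
    then have "v x \<le> v p" by (simp add: v_mult mult_left_le)
    then show "x \<in> max_ideal v" using p by (simp add: max_ideal_def)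
  qed
  then have "v p = 1 / real q" using lf unfolding nonarch_local_field_def q_def by blast
  then show ?thesis using le by metis
qed

definition unif :: 'k where "unif = (SOME p. v p = 1 / real q \<and> (\<forall>x. v x < 1 \<longrightarrow> v x \<le> 1 / real q))"

lemma v_unif: "v unif = 1 / real q" and v_less_1: "v x < 1 \<Longrightarrow> v x \<le> 1 / real q"
  using someI_ex[OF exists_uniformizer] unfolding unif_def by auto

lemma unif_nz: "unif \<noteq> 0"
  using v_unif q_ge_2 by (auto simp del: v_eq_0 simp: v_eq_0[symmetric])

lemma v_unif_power: "v (unif ^ k) = 1 / real q ^ k"
  by (simp add: v_power v_unif power_divide)

text \<open>Division by \<open>unif ^ k\<close> reduces this to the gap between \<open>1 / q\<close>
  and 1 in the value group.\<close>

lemma v_discrete: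
  assumes "v x \<le> 1 / real q ^ k" "1 / real q ^ Suc k < v x"
  shows "v x = 1 / real q ^ k"
proof (rule ccontr)
  assume "v x \<noteq> 1 / real q ^ k"
  then have "v (x / unif ^ k) < 1" using assms q_ge_2 by (simp add: v_divide v_unif_power field_simps)
  then have "v (x / unif ^ k) \<le> 1 / real q" by (rule v_less_1)
  then show False using assms(2) q_ge_2 by (simp add: v_divide v_unif_power field_simps)
qed

subsection \<open>The spherical metric\<close>

definition nrm :: "'k \<times> 'k \<Rightarrow> real" where "nrm x = max (v (fst x)) (v (snd x))"

definition dt :: "'k \<times> 'k \<Rightarrow> 'k \<times> 'k \<Rightarrow> 'k" where "dt x y = fst x * snd y - snd x * fst y"

fun act :: "'k \<times> 'k \<times> 'k \<times> 'k \<Rightarrow> 'k \<times> 'k \<Rightarrow> 'k \<times> 'k" where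
  "act (a, b, c, d) x = (a * fst x + b * snd x, c * fst x + d * snd x)"

text \<open>The adjugate matrix: for nonzero determinant it inverts the action up to the scalar
  \<open>det2 g\<close>, hence exactly on the projective line.\<close>

fun adj :: "'k \<times> 'k \<times> 'k \<times> 'k \<Rightarrow> 'k \<times> 'k \<times> 'k \<times> 'k" where
  "adj (a, b, c, d) = (d, - b, - c, a)"

fun det2 :: "'k \<times> 'k \<times> 'k \<times> 'k \<Rightarrow> 'k" where
  "det2 (a, b, c, d) = a * d - b * c"

abbreviation \<delta> where "\<delta> \<equiv> proj_delta v"

lemma delta_class: "\<delta> (proj_class x) (proj_class y) = v (dt x y) / (nrm x * nrm y)"
  by (simp add: proj_delta_class[OF abs] vec_delta_def dt_def nrm_def)

lemma nrm_scale: "nrm (c * fst x, c * snd x) = v c * nrm x"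
  by (simp add: nrm_def v_mult max_mult_distrib_left)

lemma nrm_pos: "x \<noteq> (0, 0) \<Longrightarrow> 0 < nrm x"
  using v_pos by (cases x) (auto simp: nrm_def less_max_iff_disj)

lemma proj_class_scale:
  assumes "(c::'k) \<noteq> 0"
  shows "proj_class (c * fst x, c * snd x) = proj_class x"
proof -
  have *: "proj_class y = (\<lambda>k. (k * fst y, k * snd y)) ` (- {0})" for y :: "'k \<times> 'k"
    by (auto simp: proj_class_def)
  have "(\<lambda>k. (k * (c * fst x), k * (c * snd x))) ` (- {0}) = (\<lambda>k. (k * fst x, k * snd x)) ` (\<lambda>k. k * c) ` (- {0})"
    unfolding image_image by (simp add: mult.assoc)
  also have "(\<lambda>k. k * c) ` (- {0}) = - {0}"
  proof (intro equalityI subsetI)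
    fix y assume "y \<in> - {0::'k}"
    then show "y \<in> (\<lambda>k. k * c) ` (- {0})" using assms by (intro image_eqI[of _ _ "y / c"]) auto
  qed (use assms in auto)
  finally show ?thesis unfolding * by simp
qed

lemma normalized_rep:
  assumes "X \<in> proj_line"
  obtains x where "X = proj_class x" "nrm x = 1"
proof -
  obtain y where y: "X = proj_class y" "y \<noteq> (0, 0)" using assms by (auto simp: proj_line_def)
  obtain c where c: "v c = nrm y" by (metis nrm_def max_def)
  then have "c \<noteq> 0" using nrm_pos[OF y(2)] by auto
  then have "proj_class (inverse c * fst y, inverse c * snd y) = X" using proj_class_scale y by simp
  moreover have "nrm (inverse c * fst y, inverse c * snd y) = 1"
    using nrm_scale[of "inverse c" y] c nrm_pos[OF y(2)] by (simp add: v_inverse)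
  ultimately show ?thesis using that by metis
qed

lemma proj_line_class: "nrm x = 1 \<Longrightarrow> proj_class x \<in> proj_line"
  by (auto simp: proj_line_def nrm_def)

lemma delta_normalized: "nrm x = 1 \<Longrightarrow> nrm y = 1 \<Longrightarrow> \<delta> (proj_class x) (proj_class y) = v (dt x y)"
  by (simp add: delta_class)

lemma dt_act: "dt (act g x) (act g y) = det2 g * dt x y"
  by (cases g) (simp add: dt_def algebra_simps)

lemma adj_act: "act (adj g) (act g x) = (det2 g * fst x, det2 g * snd x)"
  and act_adj: "act g (act (adj g) x) = (det2 g * fst x, det2 g * snd x)"
  by (cases g; simp add: algebra_simps)+

lemma GL2_iff: "g \<in> GL2_int v \<longleftrightarrow> (case g of (a, b, c, d) \<Rightarrow> v a \<le> 1 \<and> v b \<le> 1 \<and> v c \<le> 1 \<and> v d \<le> 1) \<and> v (det2 g) = 1"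
proof -
  obtain a b c d where g: "g = (a, b, c, d)" by (cases g) auto
  have le: "v (a * d - b * c) \<le> 1" if "v a \<le> 1" "v b \<le> 1" "v c \<le> 1" "v d \<le> 1"
    using v_diff[of "a * d" "b * c"] that mult_le_one[of "v a" "v d"] mult_le_one[of "v b" "v c"] by (simp add: v_mult)
  have "(\<exists>u. v u \<le> 1 \<and> (a * d - b * c) * u = 1) \<longleftrightarrow> v (a * d - b * c) = 1" if "v (a * d - b * c) \<le> 1"
  proof
    assume "\<exists>u. v u \<le> 1 \<and> (a * d - b * c) * u = 1"
    then obtain u where u: "v u \<le> 1" "(a * d - b * c) * u = 1" by blast
    then have e: "v (a * d - b * c) * v u = 1" using v_mult[of "a * d - b * c" u] by simp
    have "v (a * d - b * c) * v u \<le> v (a * d - b * c)" using u by (simp add: mult_left_le)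
    then show "v (a * d - b * c) = 1" using e that by simp
  next
    assume 1: "v (a * d - b * c) = 1"
    then have "a * d - b * c \<noteq> 0" by (metis v_0 zero_neq_one)
    then show "\<exists>u. v u \<le> 1 \<and> (a * d - b * c) * u = 1"
      using 1 by (intro exI[of _ "inverse (a * d - b * c)"]) (simp add: v_inverse)
  qed
  then show ?thesis using le by (auto simp: g GL2_int_def int_ring_def)
qed

lemma adj_GL2: "g \<in> GL2_int v \<Longrightarrow> adj g \<in> GL2_int v"
  by (cases g) (auto simp: GL2_iff mult.commute)

lemma nrm_act_le:
  assumes "g \<in> GL2_int v"
  shows "nrm (act g x) \<le> nrm x"
proof -
  obtain a b c d where g: "g = (a, b, c, d)" by (cases g) auto
  have "v (a * fst x + b * snd x) \<le> nrm x" if "v a \<le> 1" "v b \<le> 1" for a b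
  proof -
    have "v (a * fst x) \<le> v (fst x)" "v (b * snd x) \<le> v (snd x)"
      using that by (simp_all add: v_mult mult_left_le_one_le)
    then show ?thesis using v_add[of "a * fst x" "b * snd x"] by (simp add: nrm_def max_def split: if_splits)
  qed
  then show ?thesis using assms unfolding GL2_iff g by (simp add: nrm_def[of "(_, _)"])
qed

text \<open>Integral entries cannot increase the norm; the same for the adjugate gives the reverse
  inequality, the determinant being a unit. This is what makes the action isometric for
  \<open>\<delta>\<close>.\<close>

lemma nrm_act:
  assumes "g \<in> GL2_int v"
  shows "nrm (act g x) = nrm x"
proof (rule antisym[OF nrm_act_le[OF assms]])
  have "nrm x = nrm (act (adj g) (act g x))"
    using assms unfolding adj_act nrm_scale by (simp add: GL2_iff)
  also have "\<dots> \<le> nrm (act g x)" by (rule nrm_act_le[OF adj_GL2[OF assms]])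
  finally show "nrm x \<le> nrm (act g x)" .
qed

lemma proj_act: "proj_act g (proj_class x) = proj_class (act g x)"
  by (cases g) (simp add: proj_act_class)

lemma proj_act_in: "g \<in> GL2_int v \<Longrightarrow> X \<in> proj_line \<Longrightarrow> proj_act g X \<in> proj_line"
  by (metis normalized_rep proj_act nrm_act proj_line_class)

lemma proj_act_surj:
  assumes "g \<in> GL2_int v" "Y \<in> proj_line"
  obtains X where "X \<in> proj_line" "Y = proj_act g X"
proof -
  obtain y where y: "Y = proj_class y" "nrm y = 1" using assms(2) by (rule normalized_rep)
  have "det2 g \<noteq> 0" using assms(1) by (auto simp: GL2_iff)
  then have "proj_act g (proj_class (act (adj g) y)) = Y" unfolding proj_act act_adj y(1) by (rule proj_class_scale)
  moreover have "proj_class (act (adj g) y) \<in> proj_line"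
    using nrm_act[OF adj_GL2[OF assms(1)]] y by (intro proj_line_class) simp
  ultimately show ?thesis using that by metis
qed

lemma delta_act:
  assumes "g \<in> GL2_int v" "X \<in> proj_line" "Y \<in> proj_line"
  shows "\<delta> (proj_act g X) (proj_act g Y) = \<delta> X Y"
proof -
  obtain x y where "X = proj_class x" "nrm x = 1" "Y = proj_class y" "nrm y = 1"
    using assms normalized_rep by metis
  then show ?thesis using assms(1) by (simp add: proj_act delta_class nrm_act dt_act v_mult GL2_iff)
qed

abbreviation base :: "('k \<times> 'k) set" where "base \<equiv> proj_class (1, 0)"

lemma origin: "base \<in> proj_line" by (rule proj_line_class) (simp add: nrm_def)

lemma transitive:
  assumes "X \<in> proj_line"
  obtains g where "g \<in> GL2_int v" "X = proj_act g base"
proof -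
  obtain x where x: "X = proj_class x" "nrm x = 1" using assms by (rule normalized_rep)
  obtain a b where ab: "x = (a, b)" by (cases x)
  have le: "v a \<le> 1" "v b \<le> 1" and "v a = 1 \<or> v b = 1"
    using x(2) by (auto simp: ab nrm_def max_def split: if_splits)
  then consider "v a = 1" | "v b = 1" by blast
  then show ?thesis
  proof cases
    case 1
    \<comment> \<open>The normalized vector is the first column; the second is chosen to make the
      determinant \<open>a\<close> here and \<open>- b\<close> in the other case, a unit each
      time.\<close>
    then show ?thesis using le that[of "(a, 0, b, 1)"] by (simp add: GL2_iff proj_act x ab)
  next
    case 2
    then show ?thesis using le that[of "(a, 1, b, 0)"] by (simp add: GL2_iff proj_act x ab)
  qed
qed

lemma delta_self [simp]: "X \<in> proj_line \<Longrightarrow> \<delta> X X = 0"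
  by (elim normalized_rep) (simp add: delta_normalized dt_def mult.commute)

lemma delta_nonneg: "X \<in> proj_line \<Longrightarrow> Y \<in> proj_line \<Longrightarrow> 0 \<le> \<delta> X Y"
  by (elim normalized_rep) (simp add: delta_normalized)

lemma delta_commute: "X \<in> proj_line \<Longrightarrow> Y \<in> proj_line \<Longrightarrow> \<delta> X Y = \<delta> Y X"
proof (elim normalized_rep)
  fix x y assume "X = proj_class x" "nrm x = 1" "Y = proj_class y" "nrm y = 1"
  then show ?thesis using v_diff_commute[of "fst x * snd y" "snd x * fst y"]
    by (simp add: delta_normalized dt_def mult.commute)
qed

lemma delta_le_1: "X \<in> proj_line \<Longrightarrow> Y \<in> proj_line \<Longrightarrow> \<delta> X Y \<le> 1"
proof (elim normalized_rep)
  fix x y assume *: "X = proj_class x" "nrm x = 1" "Y = proj_class y" "nrm y = 1"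
  then have "v (fst x) \<le> 1" "v (snd x) \<le> 1" "v (fst y) \<le> 1" "v (snd y) \<le> 1"
    unfolding nrm_def by linarith+
  then show ?thesis using v_diff[of "fst x * snd y" "snd x * fst y"] *
      mult_le_one[of "v (fst x)" "v (snd y)"] mult_le_one[of "v (snd x)" "v (fst y)"]
    by (simp add: delta_normalized dt_def v_mult)
qed

text \<open>Transitivity moves \<open>Y\<close> to \<open>[1 : 0]\<close>, where the distance to a
  normalized \<open>x\<close> is just \<open>v (snd x)\<close>; the claim becomes the ultrametric
  inequality for the determinant of \<open>x\<close> and \<open>z\<close>.\<close>

lemma delta_ultra:
  assumes "X \<in> proj_line" "Y \<in> proj_line" "Z \<in> proj_line"
  shows "\<delta> X Z \<le> max (\<delta> X Y) (\<delta> Y Z)"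
proof -
  obtain g where g: "g \<in> GL2_int v" "Y = proj_act g base" using transitive[OF assms(2)] .
  obtain X' where X: "X' \<in> proj_line" "X = proj_act g X'" using proj_act_surj[OF g(1) assms(1)] .
  obtain Z' where Z: "Z' \<in> proj_line" "Z = proj_act g Z'" using proj_act_surj[OF g(1) assms(3)] .
  obtain x z where x: "X' = proj_class x" "nrm x = 1" and z: "Z' = proj_class z" "nrm z = 1"
    using X Z normalized_rep by metis
  have one: "nrm (1, 0) = 1" by (simp add: nrm_def)
  have le: "v (fst x) \<le> 1" "v (fst z) \<le> 1" using x(2) z(2) unfolding nrm_def by linarith+
  have "v (fst x * snd z) \<le> v (snd z)" "v (snd x * fst z) \<le> v (snd x)"
    using le by (simp_all add: v_mult mult_left_le_one_le mult_left_le)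
  then have "v (dt x z) \<le> max (v (dt x (1, 0))) (v (dt (1, 0) z))"
    using v_diff[of "fst x * snd z" "snd x * fst z"] by (simp add: dt_def max_def split: if_splits)
  then have "\<delta> X' Z' \<le> max (\<delta> X' base) (\<delta> base Z')"
    by (simp add: x z delta_normalized one)
  then show ?thesis using g X Z origin by (simp add: delta_act)
qed

subsection \<open>Balls in the projective line\<close>

definition pball :: "nat \<Rightarrow> ('k \<times> 'k) set \<Rightarrow> ('k \<times> 'k) set set" where
  "pball k X = {Y \<in> proj_line. \<delta> X Y \<le> 1 / real q ^ k}"

definition pballs :: "nat \<Rightarrow> ('k \<times> 'k) set set set" where
  "pballs k = pball k ` proj_line"

lemma pball_self: "X \<in> proj_line \<Longrightarrow> X \<in> pball k X" by (simp add: pball_def)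

lemma pball_eq_iff:
  assumes "X \<in> proj_line" "Y \<in> proj_line"
  shows "pball k X = pball k Y \<longleftrightarrow> \<delta> X Y \<le> 1 / real q ^ k"
proof
  assume "pball k X = pball k Y"
  then have "Y \<in> pball k X" using pball_self assms by simp
  then show "\<delta> X Y \<le> 1 / real q ^ k" by (simp add: pball_def)
next
  have *: "\<delta> Y Z \<le> 1 / real q ^ k" if "\<delta> X Y \<le> 1 / real q ^ k" "\<delta> X Z \<le> 1 / real q ^ k"
    "X \<in> proj_line" "Y \<in> proj_line" "Z \<in> proj_line" for X Y Z
    using delta_ultra[of Y X Z] that delta_commute[of X Y] by simp
  assume "\<delta> X Y \<le> 1 / real q ^ k"
  then show "pball k X = pball k Y"
    unfolding pball_def using assms *[of X Y] *[of Y X] delta_commute[of X Y] by auto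
qed

lemma pball_eqI: "X \<in> proj_line \<Longrightarrow> Y \<in> pball k X \<Longrightarrow> pball k Y = pball k X"
  using pball_eq_iff[of X Y k] unfolding pball_def by simp

lemma pball_Suc_subset_iff:
  assumes "X \<in> proj_line" "Y \<in> proj_line"
  shows "pball (Suc k) Y \<subseteq> pball k X \<longleftrightarrow> Y \<in> pball k X"
proof
  assume "Y \<in> pball k X"
  then have eq: "pball k X = pball k Y" using pball_eq_iff assms by (simp add: pball_def)
  have "1 / real q ^ Suc k \<le> 1 / real q ^ k" using q_ge_2 by (simp add: field_simps)
  then show "pball (Suc k) Y \<subseteq> pball k X" unfolding eq by (auto simp: pball_def)
qed (use pball_self assms in blast)

lemma pball_0: "X \<in> proj_line \<Longrightarrow> pball 0 X = proj_line"
  using delta_le_1 by (auto simp: pball_def)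

lemma pballs_children:
  assumes "X \<in> proj_line"
  shows "{C \<in> pballs (Suc k). C \<subseteq> pball k X} = pball (Suc k) ` pball k X"
  using pball_Suc_subset_iff[OF assms] by (auto simp: pballs_def pball_def)

text \<open>A chart around \<open>[1 : 0]\<close> with the scale \<open>q^-k\<close> divided out, so
  that \<open>y\<close> runs through the ring of integers. For \<open>k > 0\<close> it fills the
  ball of radius \<open>q^-k\<close>; for \<open>k = 0\<close> it misses exactly the ball of radius
  \<open>1 / q\<close> around \<open>[0 : 1]\<close>.\<close>

definition line_pt :: "nat \<Rightarrow> 'k \<Rightarrow> ('k \<times> 'k) set" where
  "line_pt k y = proj_class (1, unif ^ k * y)"

lemma nrm_line_pt: "v y \<le> 1 \<Longrightarrow> nrm (1, unif ^ k * y) = 1"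
proof -
  assume y: "v y \<le> 1"
  have "1 / real q ^ k \<le> 1" using q_ge_2 by simp
  then have "v (unif ^ k * y) \<le> 1" using y by (simp only: v_mult v_unif_power) (rule mult_le_one, auto)
  then show ?thesis by (simp add: nrm_def)
qed

lemma delta_line_pt:
  assumes "v y \<le> 1" "v z \<le> 1"
  shows "\<delta> (line_pt k y) (line_pt k z) = v (y - z) / real q ^ k"
proof -
  have "\<delta> (line_pt k y) (line_pt k z) = v (unif ^ k * (z - y))"
    unfolding line_pt_def by (subst delta_normalized) (use assms nrm_line_pt in \<open>auto simp: dt_def algebra_simps\<close>)
  then show ?thesis by (simp only: v_mult v_unif_power v_diff_commute[of z]) simp
qed

lemma line_pt_in: "v y \<le> 1 \<Longrightarrow> line_pt k y \<in> proj_line"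
  unfolding line_pt_def by (rule proj_line_class[OF nrm_line_pt])

lemma line_pt_cover:
  assumes "nrm (a, b) = 1" "v a = 1" "v b \<le> 1 / real q ^ k"
  obtains y where "v y \<le> 1" "proj_class (a, b) = line_pt k y"
proof -
  have a0: "a \<noteq> 0" using assms(2) by auto
  define y where "y = b / (a * unif ^ k)"
  have "v y \<le> 1" using assms(2,3) q_ge_2 by (simp add: y_def v_divide v_mult v_unif_power field_simps)
  moreover have "(a * fst (1, unif ^ k * y), a * snd (1, unif ^ k * y)) = (a, b)"
    using a0 unif_nz by (simp add: y_def)
  then have "proj_class (a, b) = line_pt k y" unfolding line_pt_def by (metis proj_class_scale[OF a0])
  ultimately show ?thesis using that by blast
qed

text \<open>In the chart, two points lie in the same ball of level \<open>k + 1\<close> iff their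
  coordinates differ by at most \<open>1 / q\<close>, that is, by less than 1: these balls
  correspond to the residue classes. The isometry \<open>g\<close> moves the centre
  anywhere.\<close>

lemma card_line_pt:
  assumes "g \<in> GL2_int v"
  shows "card ((\<lambda>y. pball (Suc k) (proj_act g (line_pt k y))) ` {y. v y \<le> 1}) = q"
proof -
  have "card ((\<lambda>y. pball (Suc k) (proj_act g (line_pt k y))) ` {y. v y \<le> 1}) = card ((\<lambda>x. resid `` {x}) ` {x. v x \<le> 1})"
  proof (rule card_image_eq_iff)
    fix x y assume "x \<in> {y. v y \<le> 1}" "y \<in> {y. v y \<le> 1}"
    then have xy: "v x \<le> 1" "v y \<le> 1" by auto
    have "pball (Suc k) (proj_act g (line_pt k x)) = pball (Suc k) (proj_act g (line_pt k y)) \<longleftrightarrow>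
        v (x - y) / real q ^ k \<le> 1 / real q ^ Suc k"
      using pball_eq_iff proj_act_in[OF assms line_pt_in] delta_act[OF assms line_pt_in line_pt_in] delta_line_pt xy by simp
    also have "\<dots> \<longleftrightarrow> v (x - y) \<le> 1 / real q" using q_ge_2 by (simp add: field_simps)
    also have "\<dots> \<longleftrightarrow> v (x - y) < 1"
    proof -
      have "1 / real q < 1" using q_ge_2 by simp
      then show ?thesis using v_less_1[of "x - y"] by linarith
    qed
    also have "\<dots> \<longleftrightarrow> resid `` {x} = resid `` {y}" using resid_class_eq_iff[OF xy] by simp
    finally show "pball (Suc k) (proj_act g (line_pt k x)) = pball (Suc k) (proj_act g (line_pt k y)) \<longleftrightarrow>
      resid `` {x} = resid `` {y}" .
  qed
  then show ?thesis unfolding residue_classes_eq[symmetric] by (simp add: q_def residue_card_def)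
qed

text \<open>The chart at level 0 accounts for \<open>q\<close> balls; the extra one is around
  \<open>[0 : 1]\<close>, which is at distance 1 from the whole chart.\<close>

lemma card_children_0: "card (pball (Suc 0) ` proj_line) = Suc q"
proof -
  have id: "(1, 0, 0, 1) \<in> GL2_int v" by (simp add: GL2_iff)
  have act_id: "proj_act (1, 0, 0, 1) X = X" if "X \<in> proj_line" for X :: "('k \<times> 'k) set"
    by (rule normalized_rep[OF that]) (simp add: proj_act)
  define A where "A = (\<lambda>y. pball (Suc 0) (line_pt 0 y)) ` {y. v y \<le> 1}"
  have cA: "card A = q"
  proof -
    have "A = (\<lambda>y. pball (Suc 0) (proj_act (1, 0, 0, 1) (line_pt 0 y))) ` {y. v y \<le> 1}"
      unfolding A_def using act_id[OF line_pt_in] by (intro image_cong) auto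
    then show ?thesis using card_line_pt[OF id, of 0] by simp
  qed
  let ?z = "proj_class (0, 1 :: 'k)"
  have nz: "nrm (0, 1) = 1" by (simp add: nrm_def)
  have z: "?z \<in> proj_line" by (rule proj_line_class[OF nz])
  have notin: "pball (Suc 0) ?z \<notin> A"
  proof
    assume "pball (Suc 0) ?z \<in> A"
    then obtain y where y: "v y \<le> 1" "pball (Suc 0) ?z = pball (Suc 0) (line_pt 0 y)" by (auto simp: A_def)
    then have "\<delta> ?z (line_pt 0 y) \<le> 1 / real q" using pball_eq_iff[OF z line_pt_in[OF y(1)], of "Suc 0"] by simp
    moreover have "\<delta> ?z (line_pt 0 y) = 1"
      unfolding line_pt_def using delta_normalized[OF nz nrm_line_pt[OF y(1), of 0]] by (simp add: dt_def)
    ultimately show False using q_ge_2 by (simp add: field_simps)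
  qed
  have "pball (Suc 0) ` proj_line = insert (pball (Suc 0) ?z) A"
  proof (intro equalityI subsetI)
    fix B assume "B \<in> pball (Suc 0) ` proj_line"
    then obtain X where X: "X \<in> proj_line" "B = pball (Suc 0) X" by blast
    obtain a b where x: "X = proj_class (a, b)" "nrm (a, b) = 1" using normalized_rep[OF X(1)] by (metis surj_pair)
    have le: "v a \<le> 1" "v b \<le> 1" using x(2) unfolding nrm_def by auto
    show "B \<in> insert (pball (Suc 0) ?z) A"
    proof (cases "v a = 1")
      case True
      obtain y where "v y \<le> 1" "X = line_pt 0 y" using line_pt_cover[OF x(2) True, of 0] le x(1) by auto
      then show ?thesis using X by (auto simp: A_def)
    next
      case False
      then have "v a \<le> 1 / real q" using le v_less_1[of a] by simp
      then have "\<delta> ?z X \<le> 1 / real q ^ Suc 0" unfolding x(1) using delta_normalized[OF nz x(2)] by (simp add: dt_def)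
      then show ?thesis using pball_eq_iff[OF z X(1)] X(2) by blast
    qed
  next
    fix B assume "B \<in> insert (pball (Suc 0) ?z) A"
    then show "B \<in> pball (Suc 0) ` proj_line" using z line_pt_in by (auto simp: A_def)
  qed
  moreover have "finite A" using cA q_ge_2 by (metis card.infinite not_numeral_le_zero)
  ultimately show ?thesis using notin cA by simp
qed

text \<open>With the centre moved to \<open>[1 : 0]\<close>, a normalized point
  \<open>[a : b]\<close> of the ball has \<open>v b < 1\<close> because \<open>k > 0\<close>, hence
  \<open>v a = 1\<close>, and the chart covers it. For \<open>k = 0\<close> this fails, which is the
  source of the extra child.\<close>

lemma card_children_pos:
  assumes "X \<in> proj_line" "0 < k"
  shows "card (pball (Suc k) ` pball k X) = q"
proof -
  obtain g where g: "g \<in> GL2_int v" "X = proj_act g base" using transitive[OF assms(1)] .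
  have "1 / real q ^ k < 1" using q_ge_2 assms(2) by (simp add: one_less_power)
  have "pball (Suc k) ` pball k X = (\<lambda>y. pball (Suc k) (proj_act g (line_pt k y))) ` {y. v y \<le> 1}" (is "_ = ?S")
  proof (intro equalityI subsetI)
    fix C assume "C \<in> pball (Suc k) ` pball k X"
    then obtain Y where Y: "Y \<in> proj_line" "\<delta> X Y \<le> 1 / real q ^ k" "C = pball (Suc k) Y" by (auto simp: pball_def)
    obtain Z where Z: "Z \<in> proj_line" "Y = proj_act g Z" using proj_act_surj[OF g(1) Y(1)] .
    obtain a b where ab: "Z = proj_class (a, b)" "nrm (a, b) = 1" using normalized_rep[OF Z(1)] by (metis surj_pair)
    have "\<delta> base Z \<le> 1 / real q ^ k" using Y(2) delta_act[OF g(1) origin Z(1)] unfolding g Z by simp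
    then have b: "v b \<le> 1 / real q ^ k"
      unfolding ab(1) by (subst (asm) delta_normalized) (use ab in \<open>auto simp: nrm_def dt_def\<close>)
    then have "v b < 1" using \<open>1 / real q ^ k < 1\<close> by linarith
    then have "v a = 1" using ab(2) by (auto simp: nrm_def max_def split: if_splits)
    then obtain y where "v y \<le> 1" "Z = line_pt k y" using line_pt_cover[OF ab(2) _ b] ab(1) by metis
    then show "C \<in> ?S" using Y Z by auto
  next
    fix C assume "C \<in> ?S"
    then obtain y where y: "v y \<le> 1" "C = pball (Suc k) (proj_act g (line_pt k y))" by auto
    have "base = line_pt k 0" by (simp add: line_pt_def)
    then have "\<delta> base (line_pt k y) \<le> 1 / real q ^ k" using delta_line_pt[of 0 y k] y by (simp add: divide_right_mono)
    then have "proj_act g (line_pt k y) \<in> pball k X"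
      using delta_act[OF g(1) origin line_pt_in[OF y(1)]] proj_act_in[OF g(1) line_pt_in[OF y(1)]] g by (simp add: pball_def)
    then show "C \<in> pball (Suc k) ` pball k X" using y by blast
  qed
  then show ?thesis using card_line_pt[OF g(1)] by simp
qed

text \<open>Changing each coordinate of a representative of norm \<open>m\<close> by less than
  \<open>m / q^(k+1)\<close> does not lower its norm and moves the point by at most
  \<open>q^-k\<close>, so the preimage of the ball in the plane is open.\<close>

lemma openin_pball:
  assumes "X \<in> proj_line"
  shows "openin (proj_topology v) (pball k X)"
  unfolding openin_proj_topology[OF abs]
proof
  show "pball k X \<subseteq> proj_line" by (auto simp: pball_def)
  interpret Metric_space UNIV "\<lambda>x y. v (x - y)" by (rule metric)
  define S where "S = {x \<in> UNIV - {(0, 0)}. proj_class x \<in> pball k X}"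
  have "openin (prod_topology mtopology mtopology) S"
    unfolding openin_prod_topology_alt
  proof (intro allI impI)
    fix a b assume ab: "(a, b) \<in> S"
    then have nz: "(a, b) \<noteq> (0, 0)" and in': "proj_class (a, b) \<in> pball k X" by (auto simp: S_def)
    define m where "m = nrm (a, b)"
    \<comment> \<open>The exponent \<open>Suc k\<close> keeps \<open>r < m\<close> even for
      \<open>k = 0\<close>, so that the coordinate of largest absolute value keeps its
      value.\<close>
    define r where "r = m / real q ^ Suc k"
    have m: "0 < m" using nrm_pos[OF nz] by (simp add: m_def)
    have q1: "1 < real q ^ Suc k" using q_ge_2 by (intro one_less_power) auto
    have r: "0 < r" "r < m" using m q1 by (auto simp: r_def field_simps)
    have "mball a r \<times> mball b r \<subseteq> S"
    proof safe
      fix a' b' assume a': "a' \<in> mball a r" and b': "b' \<in> mball b r"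
      then have d: "v (a - a') < r" "v (b - b') < r" by auto
      have "m \<le> nrm (a', b')"
      proof (cases "v a = m")
        case True
        then have "v a' = m" using v_eq_of_close[of a a'] d r by simp
        then show ?thesis by (simp add: nrm_def)
      next
        case False
        then have "v b = m" by (auto simp: m_def nrm_def max_def split: if_splits)
        then have "v b' = m" using v_eq_of_close[of b b'] d r by simp
        then show ?thesis by (simp add: nrm_def)
      qed
      then have m': "m \<le> nrm (a', b')" .
      have nz': "(a', b') \<noteq> (0, 0)" using m' m by (auto simp: nrm_def)
      have ab: "v a \<le> m" "v b \<le> m" by (auto simp: m_def nrm_def)
      have "dt (a, b) (a', b') = b * (a - a') - a * (b - b')" by (simp add: dt_def algebra_simps)
      then have "v (dt (a, b) (a', b')) \<le> max (v b * v (a - a')) (v a * v (b - b'))"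
        using v_diff[of "b * (a - a')" "a * (b - b')"] by (simp add: v_mult)
      also have "\<dots> \<le> m * r" using ab d m by (intro max.boundedI mult_mono) auto
      finally have "\<delta> (proj_class (a, b)) (proj_class (a', b')) \<le> (m * r) / (m * nrm (a', b'))"
        unfolding delta_class m_def[symmetric] using m m' by (intro divide_right_mono) auto
      also have "\<dots> \<le> (m * r) / (m * m)" using m m' r by (intro divide_left_mono mult_left_mono) auto
      also have "\<dots> = 1 / real q ^ Suc k" using m by (simp add: r_def)
      also have "\<dots> \<le> 1 / real q ^ k" using q_ge_2 by (simp add: field_simps)
      finally have *: "\<delta> (proj_class (a, b)) (proj_class (a', b')) \<le> 1 / real q ^ k" .
      have pl: "proj_class (a, b) \<in> proj_line" "proj_class (a', b') \<in> proj_line"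
        using nz nz' by (auto simp: proj_line_def)
      have "pball k (proj_class (a, b)) = pball k X"
        using pball_eqI[OF assms in'] .
      then have "proj_class (a', b') \<in> pball k X" using * pl by (auto simp: pball_def)
      then show "(a', b') \<in> S" using nz' by (simp add: S_def)
    qed
    then show "\<exists>U V. openin mtopology U \<and> openin mtopology V \<and> a \<in> U \<and> b \<in> V \<and> U \<times> V \<subseteq> S"
      using r by (intro exI[of _ "mball a r"] exI[of _ "mball b r"]) auto
  qed
  then show "openin (punctured_plane v) {x \<in> UNIV - {(0, 0)}. proj_class x \<in> pball k X}"
    unfolding punctured_plane_def field_topology_def openin_subtopology S_def[symmetric]
    by (intro exI[of _ S]) (auto simp: S_def)
qed

end

locale local_field_measure = local_field v for v :: "'k::field \<Rightarrow> real" +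
  fixes \<nu> :: "('k \<times> 'k) set measure"
  assumes inv: "invariant_prob v \<nu>"
begin

lemma prob: "prob_space \<nu>" and sets_eq: "sets \<nu> = sets (proj_borel v)"
  and distr_act: "g \<in> GL2_int v \<Longrightarrow> distr \<nu> (proj_borel v) (proj_act g) = \<nu>"
  using inv by (auto simp: invariant_prob_def)

lemma open_subset: "{U. openin (proj_topology v) U} \<subseteq> Pow proj_line"
  using openin_proj_topology[OF abs] by blast

lemma space_eq: "space \<nu> = proj_line"
  using sets_eq_imp_space_eq[OF sets_eq] open_subset by (simp add: proj_borel_def)

lemma pball_sets: "X \<in> proj_line \<Longrightarrow> pball k X \<in> sets \<nu>"
  unfolding sets_eq proj_borel_def using open_subset openin_pball by (simp add: sets_measure_of)

text \<open>The action need not be shown measurable: \<open>distr\<close> is the null measure whenever its defining set function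
  fails to be a measure.\<close>

lemma emeasure_act:
  assumes "g \<in> GL2_int v" "B \<in> sets \<nu>"
  shows "emeasure \<nu> B = emeasure \<nu> (proj_act g -` B \<inter> space \<nu>)"
proof -
  let ?D = "distr \<nu> (proj_borel v) (proj_act g)"
  have em: "emeasure ?D A = (if A \<in> sets \<nu> \<and> measure_space (space (proj_borel v)) (sets (proj_borel v)) (\<lambda>A. emeasure \<nu> (proj_act g -` A \<inter> space \<nu>))
      then emeasure \<nu> (proj_act g -` A \<inter> space \<nu>) else 0)" for A
    unfolding distr_def emeasure_measure_of_conv sets_eq by (simp add: sets.sigma_sets_eq)
  have "emeasure ?D (space \<nu>) = 1"
    unfolding distr_act[OF assms(1)] by (rule prob_space.emeasure_space_1[OF prob])
  then have "measure_space (space (proj_borel v)) (sets (proj_borel v)) (\<lambda>A. emeasure \<nu> (proj_act g -` A \<inter> space \<nu>))"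
    unfolding em by (auto split: if_splits)
  then have "emeasure ?D B = emeasure \<nu> (proj_act g -` B \<inter> space \<nu>)" unfolding em using assms by simp
  then show ?thesis unfolding distr_act[OF assms(1)] .
qed

text \<open>An element of \<open>GL2_int\<close> carrying \<open>base\<close> to \<open>X\<close> is
  an isometry, so the preimage of the ball around \<open>X\<close> is the ball around
  \<open>base\<close>, and invariance applies.\<close>

lemma measure_pball:
  assumes "X \<in> proj_line"
  shows "measure \<nu> (pball k X) = measure \<nu> (pball k base)"
proof -
  obtain g where g: "g \<in> GL2_int v" "X = proj_act g base" using transitive[OF assms] .
  have "proj_act g -` pball k X \<inter> space \<nu> = pball k base"
    unfolding space_eq using proj_act_in[OF g(1)] delta_act[OF g(1) origin] by (auto simp: pball_def g(2))
  then show ?thesis using emeasure_act[OF g(1) pball_sets[OF assms]] by (simp add: measure_def)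
qed

lemma finite_children:
  assumes "X \<in> proj_line"
  shows "card (pball (Suc k) ` pball k X) = (if k = 0 then Suc q else q)" and "finite (pball (Suc k) ` pball k X)"
proof -
  show c: "card (pball (Suc k) ` pball k X) = (if k = 0 then Suc q else q)"
    using card_children_0 card_children_pos[OF assms] pball_0[OF assms] by simp
  show "finite (pball (Suc k) ` pball k X)"
    by (rule card_ge_0_finite) (use c q_ge_2 in auto)
qed

lemma measure_pball_children:
  assumes "X \<in> proj_line"
  shows "measure \<nu> (pball k X) = (if k = 0 then Suc q else q) * measure \<nu> (pball (Suc k) X)"
proof -
  interpret prob_space \<nu> by (rule prob)
  have "pball k X = \<Union>(pball (Suc k) ` pball k X)"
  proof (intro equalityI subsetI)
    fix Y assume "Y \<in> pball k X"
    then show "Y \<in> \<Union>(pball (Suc k) ` pball k X)" using pball_self[of Y "Suc k"] by (auto simp: pball_def)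
  next
    fix Y assume "Y \<in> \<Union>(pball (Suc k) ` pball k X)"
    then obtain Z where "Z \<in> pball k X" "Y \<in> pball (Suc k) Z" by blast
    then show "Y \<in> pball k X" using pball_Suc_subset_iff[OF assms, of Z k] by (auto simp: pball_def)
  qed
  then have "measure \<nu> (pball k X) = measure \<nu> (\<Union>(pball (Suc k) ` pball k X))" by simp
  also have "\<dots> = (\<Sum>B\<in>pball (Suc k) ` pball k X. measure \<nu> B)"
  proof (rule measure_Union'[OF finite_children(2)[OF assms]])
    show "B \<in> fmeasurable \<nu>" if "B \<in> pball (Suc k) ` pball k X" for B
    proof -
      obtain Y where "Y \<in> proj_line" "B = pball (Suc k) Y" using \<open>B \<in> _\<close> by (auto simp: pball_def)
      then show ?thesis using pball_sets fmeasurable_eq_sets by simp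
    qed
    show "pairwise disjnt (pball (Suc k) ` pball k X)"
    proof (rule pairwiseI, rule ccontr)
      fix x y assume xy: "x \<in> pball (Suc k) ` pball k X" "y \<in> pball (Suc k) ` pball k X" "x \<noteq> y" "\<not> disjnt x y"
      then obtain W where W: "W \<in> x" "W \<in> y" by (auto simp: disjnt_def)
      obtain Y Z where YZ: "Y \<in> proj_line" "Z \<in> proj_line" "x = pball (Suc k) Y" "y = pball (Suc k) Z"
        using xy by (auto simp: pball_def)
      then show False using W xy(3) pball_eqI[of Y W "Suc k"] pball_eqI[of Z W "Suc k"] by auto
    qed
  qed
  also have "\<dots> = (\<Sum>B\<in>pball (Suc k) ` pball k X. measure \<nu> (pball (Suc k) base))"
  proof (rule sum.cong[OF refl])
    fix B assume "B \<in> pball (Suc k) ` pball k X"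
    then obtain Y where "Y \<in> proj_line" "B = pball (Suc k) Y" by (auto simp: pball_def)
    then show "measure \<nu> B = measure \<nu> (pball (Suc k) base)" using measure_pball by simp
  qed
  finally show ?thesis using finite_children(1)[OF assms] measure_pball[OF assms, of "Suc k"] by simp
qed

lemma measure_pball_eq:
  assumes "X \<in> proj_line"
  shows "measure \<nu> (pball (Suc k) X) = 1 / (real (Suc q) * real q ^ k)"
proof (induction k)
  case 0
  have "measure \<nu> (pball 0 X) = 1" unfolding pball_0[OF assms] space_eq[symmetric] by (rule prob_space.prob_space[OF prob])
  then show ?case using measure_pball_children[OF assms, of 0] by (simp add: field_simps)
next
  case (Suc k)
  then have "1 / (real (Suc q) * real q ^ k) = real q * measure \<nu> (pball (Suc (Suc k)) X)"
    using measure_pball_children[OF assms, of "Suc k"] by simp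
  then have "measure \<nu> (pball (Suc (Suc k)) X) = (1 / (real (Suc q) * real q ^ k)) / real q"
    using q_ge_2 by simp
  then show ?case by (simp add: mult_ac)
qed

lemma delta_discrete:
  assumes "X \<in> proj_line" "Y \<in> proj_line" "\<delta> X Y \<le> 1 / real q ^ k" "1 / real q ^ Suc k < \<delta> X Y"
  shows "\<delta> X Y = 1 / real q ^ k"
proof -
  obtain x y where "X = proj_class x" "nrm x = 1" "Y = proj_class y" "nrm y = 1"
    using assms normalized_rep by metis
  then show ?thesis using assms(3,4) v_discrete[of "dt x y" k] by (simp add: delta_normalized)
qed

lemma pballs_tree: "ball_tree \<nu> pballs q \<delta>"
proof -
  interpret prob_space \<nu> by (rule prob)
  have mem: "\<delta> x y \<le> 1 / real q ^ k" "x \<in> proj_line" "y \<in> proj_line" if B: "B \<in> pballs k" and xy: "x \<in> B" "y \<in> B" for B k x y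
  proof -
    obtain X where X: "X \<in> proj_line" "B = pball k X" using B by (auto simp: pballs_def)
    have "y \<in> pball k x" using pball_eqI[OF X(1), of x k] xy X(2) by simp
    then show "\<delta> x y \<le> 1 / real q ^ k" by (simp add: pball_def)
    show "x \<in> proj_line" "y \<in> proj_line" using xy X(2) by (auto simp: pball_def)
  qed
  show ?thesis
  proof
    show "2 \<le> q" by (rule q_ge_2)
    show "pballs 0 = {space \<nu>}"
    proof -
      have "pball 0 ` proj_line = (\<lambda>_. proj_line) ` (proj_line :: ('k \<times> 'k) set set)"
        by (rule image_cong[OF refl pball_0])
      then show ?thesis unfolding pballs_def space_eq using origin by (simp only: image_constant)
    qed
    show "B \<in> events" if "B \<in> pballs k" for B k using that pball_sets by (auto simp: pballs_def)
    show "B = C" if B: "B \<in> pballs k" and C: "C \<in> pballs k" and x: "x \<in> B" "x \<in> C" for B k C x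
    proof -
      obtain X Y where XY: "X \<in> proj_line" "B = pball k X" "Y \<in> proj_line" "C = pball k Y"
        using B C by (auto simp: pballs_def)
      then show ?thesis using pball_eqI[of X x k] pball_eqI[of Y x k] x by simp
    qed
    show "\<exists>C\<in>pballs (Suc k). C \<subseteq> B \<and> x \<in> C" if B: "B \<in> pballs k" and xB: "x \<in> B" for B k x
    proof -
      obtain X where X: "X \<in> proj_line" "B = pball k X" using B by (auto simp: pballs_def)
      have x: "x \<in> proj_line" using xB X by (simp add: pball_def)
      then show ?thesis using X xB pball_Suc_subset_iff[OF X(1) x, of k] pball_self[OF x, of "Suc k"]
        by (auto simp: pballs_def)
    qed
    show "card {C \<in> pballs (Suc k). C \<subseteq> B} = (if k = 0 then Suc q else q)" if B: "B \<in> pballs k" for B k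
    proof -
      obtain X where X: "X \<in> proj_line" "B = pball k X" using B by (auto simp: pballs_def)
      show ?thesis unfolding X(2) pballs_children[OF X(1)] by (rule finite_children(1)[OF X(1)])
    qed
    show "measure \<nu> B = 1 / (real (Suc q) * real q ^ k)" if B: "B \<in> pballs (Suc k)" for B k
    proof -
      obtain X where X: "X \<in> proj_line" "B = pball (Suc k) X" using B by (auto simp: pballs_def)
      show ?thesis unfolding X(2) by (rule measure_pball_eq[OF X(1)])
    qed
    show "\<delta> x y = 1 / real q ^ k"
      if B: "B \<in> pballs k" "x \<in> B" "y \<in> B" and n: "\<not> (\<exists>C\<in>pballs (Suc k). x \<in> C \<and> y \<in> C)" for B k x y
    \<comment> \<open>Without a common child the distance exceeds \<open>q^-(k+1)\<close>, and the
      next possible value is \<open>q^-k\<close>.\<close>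
    proof (rule delta_discrete[OF mem(2,3,1)[OF B]])
      have xy: "x \<in> proj_line" "y \<in> proj_line" using mem[OF B] by auto
      have "pball (Suc k) x \<in> pballs (Suc k)" using xy by (simp add: pballs_def)
      then have "y \<notin> pball (Suc k) x" using n pball_self[OF xy(1)] by blast
      then show "1 / real q ^ Suc k < \<delta> x y" using xy unfolding pball_def by auto
    qed
    show "\<delta> x y = 0" if x: "x \<in> space \<nu>" and k: "\<And>k. \<exists>B\<in>pballs k. x \<in> B \<and> y \<in> B" for x y
    proof -
      have le: "\<delta> x y \<le> (1 / real q) ^ k" and xy: "x \<in> proj_line" "y \<in> proj_line" for k
        using k[of k] mem[of _ k x y] by (auto simp: power_one_over)
      have "(\<lambda>k. (1 / real q) ^ k) \<longlonglongrightarrow> 0" using q_ge_2 by (intro LIMSEQ_power_zero) auto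
      then have "\<delta> x y \<le> 0" using le by (intro LIMSEQ_le_const) auto
      then show ?thesis using delta_nonneg[OF xy] by simp
    qed
  qed
qed

end

subsection \<open>The integral as a sum over chains\<close>

lemma branch_subset:
  assumes "2 \<le> N" "\<Phi> \<in> reduced_chains N" "\<beta> \<in> branches \<Phi>"
  shows "\<beta> \<subseteq> {1..N} \<and> 1 < card \<beta>"
proof -
  have sc: "split_chain {1..N} \<Phi>" "hd \<Phi> = {{1..N}}" using assms(2) unfolding reduced_chains_eq[OF assms(1)] by auto
  then obtain l where l: "l < length \<Phi> - 1" "\<beta> \<in> \<Phi> ! l" "1 < card \<beta>"
    using assms(3) unfolding split_chain_branches[OF assms(1) sc] by blast
  then have "partition_on {1..N} (\<Phi> ! l)" by (intro split_chain_partition[OF assms(1) sc]) simp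
  then show ?thesis using l unfolding partition_on_def by blast
qed

text \<open>The one-block partition contributes \<open>q + 1\<close> times the tree value of
  \<open>[N]\<close>, itself a sum over the partitions into at least two blocks. Merging it with the
  remaining terms, coefficient by coefficient, produces the root factor of
  \<open>chain_term\<close>; the common factor \<open>q + 1\<close> lowers the power in front to
  \<open>N - 1\<close>.\<close>

lemma sum_partitions_eq_sum_chains:
  assumes "2 \<le> q" "2 \<le> N" "0 < Re (expo {1..N} s)"
  shows "1 / of_nat (Suc q) ^ N * (\<Sum>\<pi>\<in>{\<pi>. partition_on {1..N} \<pi>}. of_nat (\<Prod>k<card \<pi>. Suc q - k) * (\<Prod>\<mu>\<in>\<pi>. tree_val q s \<mu>)) =
    1 / of_nat (q + 1) ^ (N - 1) * (\<Sum>\<Phi>\<in>reduced_chains N. chain_term q N s \<Phi>)"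
proof -
  let ?A = "{1..N}" and ?q = "of_nat q :: complex"
  let ?P = "{\<pi>. partition_on ?A \<pi> \<and> 2 \<le> card \<pi>}"
  let ?T = "\<lambda>\<pi>. \<Prod>\<mu>\<in>\<pi>. tree_val q s \<mu>"
  let ?S = "(\<Sum>\<pi>\<in>{\<pi>. partition_on ?A \<pi>}. of_nat (\<Prod>k<card \<pi>. Suc q - k) * ?T \<pi>)"
  define E where "E = ?q powr expo ?A s"
  have E1: "E - 1 \<noteq> 0" using powr_q_neq_1[OF assms(1,3)] by (simp add: E_def)
  define F where "F d = (?q powr (of_nat N + (\<Sum>(i, j)\<in>pairs ?A. s i j)) + 1 - of_nat d) *
      (falling (?q - 1) (d - 2) / (E - 1))" for d
  have tv: "tree_val q s = tree_sum (tree_weight q s)" by (simp add: tree_val_def[OF assms(1)])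
  have "chain_term q N s \<Phi> = F (chain_deg \<Phi> ?A) * (\<Prod>\<beta>\<in>branches \<Phi> - {?A}. tree_weight q s \<beta> (chain_deg \<Phi> \<beta>))" for \<Phi>
    unfolding chain_term_def F_def branch_factor_def tree_weight_def[OF assms(1)] E_def ..
  then have chains: "(\<Sum>\<Phi>\<in>reduced_chains N. chain_term q N s \<Phi>) = (\<Sum>\<pi>\<in>?P. F (card \<pi>) * ?T \<pi>)"
    using sum_reduced_chains(2)[OF assms(2), of F "tree_weight q s"] unfolding tv by simp
  have pA: "partition_on ?A {?A}" using assms(2) by (intro partition_on_space) auto
  have fin: "finite {\<pi>. partition_on ?A \<pi>}" by (rule finitely_many_partition_on) simp
  have split: "{\<pi>. partition_on ?A \<pi>} = insert {?A} ?P"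
  proof (intro equalityI subsetI)
    fix \<pi> assume p: "\<pi> \<in> {\<pi>. partition_on ?A \<pi>}"
    then have un: "\<Union>\<pi> = ?A" and "finite \<pi>" by (auto simp: partition_on_def intro: finite_elements[of ?A])
    then have "card \<pi> \<noteq> 0" using assms(2) by auto
    show "\<pi> \<in> insert {?A} ?P"
    proof (cases "card \<pi> = 1")
      case True
      then obtain \<mu> where "\<pi> = {\<mu>}" by (rule card_1_singletonE)
      then show ?thesis using un by simp
    next
      case False
      then show ?thesis using \<open>card \<pi> \<noteq> 0\<close> p by simp
    qed
  qed (use pA in auto)
  have finP: "finite ?P" using fin by (rule rev_finite_subset) auto
  have tA: "tree_val q s ?A = (\<Sum>\<pi>\<in>?P. tree_weight q s ?A (card \<pi>) * ?T \<pi>)"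
    unfolding tv using assms(2) by (subst tree_sum.simps) simp
  \<comment> \<open>After removing common factors and using \<open>e + 1 = N + sum s\<close>, this
    is \<open>q (q^e - 1) + (q + 1 - d) = q^(e+1) + 1 - d\<close>.\<close>
  have term_eq: "of_nat (\<Prod>k<d. Suc q - k) + of_nat (Suc q) * tree_weight q s ?A d = of_nat (Suc q) * F d" if d: "2 \<le> d" for d
  proof -
    obtain n where n: "d = Suc (Suc n)" using d by (metis add_2_eq_Suc le_Suc_ex)
    have fall: "falling (of_nat (Suc q)) d = of_nat (Suc q) * (?q * falling (?q - 1) (d - 2))"
      unfolding n falling_Suc[OF assms(1)] by simp
    have weight: "tree_weight q s ?A d = (?q + 1 - of_nat d) * falling (?q - 1) (d - 2) / (E - 1)"
      unfolding tree_weight_def[OF assms(1)] falling_cancel[OF d] E_def by simp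
    have "of_nat N + (\<Sum>(i, j)\<in>pairs ?A. s i j) = 1 + expo ?A s" by (simp add: expo_def)
    then have pow: "?q powr (of_nat N + (\<Sum>(i, j)\<in>pairs ?A. s i j)) = ?q * E"
      by (simp only: powr_q_add[OF assms(1)] powr_q_1[OF assms(1)] E_def)
    have "S * (x * f) + S * ((x + 1 - y) * f / (E - 1)) = S * ((x * E + 1 - y) * (f / (E - 1)))" for S x y f :: complex
      using E1 by (simp add: divide_simps) (simp add: algebra_simps)
    then show ?thesis unfolding of_nat_prod_diff[OF assms(1)] F_def fall weight pow .
  qed
  have "?S =
      of_nat (Suc q) * tree_val q s ?A + (\<Sum>\<pi>\<in>?P. of_nat (\<Prod>k<card \<pi>. Suc q - k) * ?T \<pi>)"
    unfolding split by (subst sum.insert[OF finP]) auto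
  also have "\<dots> = (\<Sum>\<pi>\<in>?P. of_nat (Suc q) * tree_weight q s ?A (card \<pi>) * ?T \<pi> + of_nat (\<Prod>k<card \<pi>. Suc q - k) * ?T \<pi>)"
    unfolding tA sum_distrib_left sum.distrib by (simp only: mult.assoc)
  also have "\<dots> = (\<Sum>\<pi>\<in>?P. of_nat (Suc q) * (F (card \<pi>) * ?T \<pi>))"
  proof (rule sum.cong[OF refl])
    fix \<pi> assume "\<pi> \<in> ?P"
    then have "of_nat (\<Prod>k<card \<pi>. Suc q - k) + of_nat (Suc q) * tree_weight q s ?A (card \<pi>) = of_nat (Suc q) * F (card \<pi>)"
      by (intro term_eq) simp
    then have "(of_nat (Suc q) * tree_weight q s ?A (card \<pi>) + of_nat (\<Prod>k<card \<pi>. Suc q - k)) * ?T \<pi> = of_nat (Suc q) * F (card \<pi>) * ?T \<pi>"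
      by (simp only: add.commute)
    then show "of_nat (Suc q) * tree_weight q s ?A (card \<pi>) * ?T \<pi> + of_nat (\<Prod>k<card \<pi>. Suc q - k) * ?T \<pi> = of_nat (Suc q) * (F (card \<pi>) * ?T \<pi>)"
      by (simp only: distrib_right mult.assoc)
  qed
  also have "\<dots> = of_nat (Suc q) * (\<Sum>\<pi>\<in>?P. F (card \<pi>) * ?T \<pi>)" by (simp only: sum_distrib_left)
  finally have "?S = of_nat (Suc q) * (\<Sum>\<pi>\<in>?P. F (card \<pi>) * ?T \<pi>)" .
  moreover have "1 / of_nat (Suc q) ^ N * (of_nat (Suc q) * x) = 1 / of_nat (q + 1) ^ (N - 1) * x" for x :: complex
  proof -
    obtain M where "N = Suc M" using assms(2) by (cases N) auto
    moreover have "(of_nat (Suc q) :: complex) \<noteq> 0" by (rule of_nat_neq_0)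
    ultimately show ?thesis by (simp del: of_nat_Suc)
  qed
  ultimately show ?thesis unfolding chains by simp
qed

theorem theorem2p1:
  fixes v :: "'k::field \<Rightarrow> real"
    and \<nu> :: "('k \<times> 'k) set measure"
    and N q :: nat
    and s :: "nat \<Rightarrow> nat \<Rightarrow> complex"
  assumes "nonarch_local_field v"
    and "q = residue_card v"
    and "invariant_prob v \<nu>"
    and "2 \<le> N"
  shows "(integrable (PiM {1..N} (\<lambda>_. \<nu>)) (integrand v N s) \<longleftrightarrow> s \<in> Omega N) \<and>
    (s \<in> Omega N \<longrightarrow>
      integral\<^sup>L (PiM {1..N} (\<lambda>_. \<nu>)) (integrand v N s) =
        1 / of_nat (q + 1) ^ (N - 1) * (\<Sum>\<Phi> \<in> reduced_chains N. chain_term q N s \<Phi>)) \<and>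
    finite (reduced_chains N) \<and>
    (\<forall>\<Phi> \<in> reduced_chains N.
      {1..N} \<in> branches \<Phi> \<and>
      (\<forall>Q :: nat. primepow Q \<longrightarrow>
        falling (of_nat Q - 1) (chain_deg \<Phi> {1..N} - 1) =
          (of_nat Q + 1 - of_nat (chain_deg \<Phi> {1..N})) * falling (of_nat Q - 1) (chain_deg \<Phi> {1..N} - 2) \<and>
        (s \<in> Omega N \<longrightarrow> (\<forall>\<beta> \<in> branches \<Phi>. of_nat Q powr expo \<beta> s - 1 \<noteq> 0)) \<and>
        (Q + 1 \<noteq> chain_deg \<Phi> {1..N} \<longrightarrow>
          chain_term Q N s \<Phi> =
            (of_nat Q powr (of_nat N + (\<Sum>(i, j) \<in> pairs {1..N}. s i j)) + 1
                - of_nat (chain_deg \<Phi> {1..N})) /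
              (of_nat Q + 1 - of_nat (chain_deg \<Phi> {1..N})) *
            (\<Prod>\<beta> \<in> branches \<Phi>.
               falling (of_nat Q - 1) (chain_deg \<Phi> \<beta> - 1) / (of_nat Q powr expo \<beta> s - 1)))))"
proof -
  interpret L: local_field_measure v \<nu> using assms(1,3) by unfold_locales
  have q: "L.q = q" using assms(2) by (simp add: L.q_def)
  interpret T: ball_tree \<nu> "L.pballs" q "proj_delta v" using L.pballs_tree unfolding q .
  have J: "{1..N} \<noteq> {}" "finite {1..N}" using assms(4) by auto
  \<comment> \<open>On the product space every entry lies in the projective line, so the cut-off in
    \<open>hker\<close> is void.\<close>
  have eq: "integrand v N s x = T.hker s {1..N} (space \<nu>) x" if "x \<in> space (T.PJ {1..N})" for x
    using T.PJ_in_space[OF that] by (simp add: integrand_def T.hker_def T.kern_def)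
  have int_eq: "integrable (T.PJ {1..N}) (integrand v N s) \<longleftrightarrow> integrable (T.PJ {1..N}) (T.hker s {1..N} (space \<nu>))"
    by (rule Bochner_Integration.integrable_cong[OF refl eq])
  have Omega: "s \<in> Omega N \<longleftrightarrow> (\<forall>\<mu>. \<mu> \<subseteq> {1..N} \<longrightarrow> 1 < card \<mu> \<longrightarrow> 0 < Re (expo \<mu> s))"
    by (auto simp: Omega_def)
  have conv: "integrable (T.PJ {1..N}) (integrand v N s) \<longleftrightarrow> s \<in> Omega N"
    unfolding int_eq Omega using T.integrable_imp_expo_pos[OF J] T.integrable_total[OF J] by blast
  have val: "integral\<^sup>L (T.PJ {1..N}) (integrand v N s) =
      1 / of_nat (q + 1) ^ (N - 1) * (\<Sum>\<Phi> \<in> reduced_chains N. chain_term q N s \<Phi>)" if "s \<in> Omega N"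
  proof -
    have "integral\<^sup>L (T.PJ {1..N}) (integrand v N s) = integral\<^sup>L (T.PJ {1..N}) (T.hker s {1..N} (space \<nu>))"
      by (rule Bochner_Integration.integral_cong[OF refl eq])
    also have "\<dots> = 1 / of_nat (Suc q) ^ card {1..N} * (\<Sum>\<pi>\<in>{\<pi>. partition_on {1..N} \<pi>}. of_nat (\<Prod>k<card \<pi>. Suc q - k) * (\<Prod>\<mu>\<in>\<pi>. tree_val q s \<mu>))"
      by (rule T.integral_total[OF J]) (use that Omega in blast)
    also have "\<dots> = 1 / of_nat (q + 1) ^ (N - 1) * (\<Sum>\<Phi> \<in> reduced_chains N. chain_term q N s \<Phi>)"
      using sum_partitions_eq_sum_chains[OF T.q_ge_2 assms(4), of s] that assms(4) unfolding Omega by simp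
    finally show ?thesis .
  qed
  have sc: "splitting_chain N \<Phi>" if "\<Phi> \<in> reduced_chains N" for \<Phi> using that by (simp add: reduced_chains_def)
  \<comment> \<open>\<open>Q\<close> ranges over all prime powers, not just the residue cardinality;
    \<open>2 \<le> Q\<close> and \<open>Re e > 0\<close> keep the norm of \<open>Q^e\<close> above
    1.\<close>
  have ne: "of_nat Q powr expo \<beta> s - 1 \<noteq> 0"
    if "\<Phi> \<in> reduced_chains N" "primepow Q" "s \<in> Omega N" "\<beta> \<in> branches \<Phi>" for \<Phi> \<beta> and Q :: nat
  proof -
    have "2 \<le> Q" using primepow_gt_Suc_0[OF that(2)] by simp
    moreover have "0 < Re (expo \<beta> s)" using branch_subset[OF assms(4) that(1,4)] that(3) unfolding Omega by blast
    ultimately show ?thesis using powr_q_neq_1 by simp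
  qed
  show ?thesis
    by (intro conjI ballI allI impI conv val sum_reduced_chains(1) full_in_branches falling_cancel full_deg_ge_2
        chain_term_eq assms(4) sc) (use ne in blast)+
qed

end
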